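(* Let $\ell>2$ be an odd prime, let $c\in\mathbb F_\ell^*$ with $c\neq1$, let $\mathcal E_c$ be the smooth projective model over $\mathbb F_\ell$ of the affine curve $Y^2=(X^2-1)(X^2-c)$, and let $t_c=\ell+1-\#\mathcal E_c(\mathbb F_\ell)$ be its Frobenius trace. Then, for every $A\in\mathbb F_\ell^*$, $$K(A,cA)=-1-\chi(A)\,t_c.$$ Equivalently, $K(A,cA)=-1-t_c$ if $A$ is a square in $\mathbb F_\ell^*$, and $K(A,cA)=-1+t_c$ if $A$ is a nonsquare.
   Context: $\chi$ denotes the Legendre symbol modulo $\ell$ on $\mathbb F_\ell$, with $\chi(0)=0$. $K(A,B)=\sum_{z\in\mathbb F_\ell}\chi\bigl((z^2-A)(z^2-B)\bigr)$. The smooth projective model of an affine curve over $\mathbb F_\ell$ is the nonsingular projective curve over $\mathbb F_\ell$ birational to it. *)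

theory Defs
  imports
    "HOL-Analysis.Cartesian_Space"
    "HOL-Library.Poly_Mapping"
    "HOL-Library.Numeral_Type"
    "HOL-Algebra.Algebraic_Closure_Type"
    "HOL-Number_Theory.Residues"
    "Berlekamp_Zassenhaus.Finite_Field"
begin

text \<open>
  The prime field with \<open>CARD('l)\<close> elements is \<open>'l mod_ring\<close> (with \<open>'l :: prime_card\<close>), and the
  algebraic closure of a field \<open>'k\<close> is \<open>'k alg_closure\<close>, with embedding \<open>to_ac\<close>.

  Algebraic geometry is set up in the classical language of varieties: a variety is a set of
  points with coordinates in the algebraic closure of a ground field \<open>'k\<close>, together with the
  property of being defined over \<open>'k\<close>. The ground field is meant to be perfect.
\<close>

section \<open>Polynomials and projective space\<close>

text \<open>
  Polynomials over \<open>'a\<close> in variables indexed by the finite type \<open>'n\<close>; the projective space with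
  homogeneous coordinates indexed by \<open>'n\<close> has dimension \<open>CARD('n) - 1\<close>.
\<close>

type_synonym ('n, 'a) mpoly = "('n \<Rightarrow>\<^sub>0 nat) \<Rightarrow>\<^sub>0 'a"

definition mpeval :: "('n::finite, 'a::comm_ring_1) mpoly \<Rightarrow> 'a ^ 'n \<Rightarrow> 'a" where
  "mpeval F v =
     (\<Sum>m\<in>Poly_Mapping.keys F.
        Poly_Mapping.lookup F m * (\<Prod>i\<in>UNIV. (v $ i) ^ Poly_Mapping.lookup m i))"

definition mpderiv :: "'n \<Rightarrow> ('n::finite, 'a::comm_ring_1) mpoly \<Rightarrow> ('n, 'a) mpoly" where
  "mpderiv i F =
     (\<Sum>m\<in>Poly_Mapping.keys F.
        Poly_Mapping.single (m - Poly_Mapping.single i 1)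
          (of_nat (Poly_Mapping.lookup m i) * Poly_Mapping.lookup F m))"

definition form_of_degree :: "nat \<Rightarrow> ('n::finite, 'a::comm_ring_1) mpoly \<Rightarrow> bool" where
  "form_of_degree d F \<longleftrightarrow>
     (\<forall>m\<in>Poly_Mapping.keys F. (\<Sum>i\<in>UNIV. Poly_Mapping.lookup m i) = d)"

definition is_form :: "('n::finite, 'a::comm_ring_1) mpoly \<Rightarrow> bool" where
  "is_form F \<longleftrightarrow> (\<exists>d. form_of_degree d F)"

lemma module_over_itself: "Modules.module ((*) :: 'a::comm_ring_1 \<Rightarrow> 'a \<Rightarrow> 'a)"
  by unfold_locales (simp_all add: algebra_simps)

text \<open>The ideals of a commutative ring are its submodules.\<close>

definition ideal_gen :: "'a::comm_ring_1 set \<Rightarrow> 'a set" where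
  "ideal_gen S = Modules.module.span (*) S"

definition is_prime_ideal :: "'a::comm_ring_1 set \<Rightarrow> bool" where
  "is_prime_ideal I \<longleftrightarrow>
     ideal_gen I = I \<and> 1 \<notin> I \<and> (\<forall>a b. a * b \<in> I \<longrightarrow> a \<in> I \<or> b \<in> I)"

text \<open>A projective point is the set of all its homogeneous coordinate vectors.\<close>

type_synonym ('n, 'a) ppoint = "('a ^ 'n) set"

definition ppoint :: "'a::field ^ 'n \<Rightarrow> ('n::finite, 'a) ppoint" where
  "ppoint v = {s *s v | s. s \<noteq> 0}"

definition proj_space :: "('n::finite, 'a::field) ppoint set" where
  "proj_space = ppoint ` {v. v \<noteq> 0}"

definition zero_locus :: "('n::finite, 'a::field) mpoly set \<Rightarrow> ('n, 'a) ppoint set" where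
  "zero_locus T = {P \<in> proj_space. \<forall>F\<in>T. \<forall>v\<in>P. mpeval F v = 0}"

definition zariski_closed :: "('n::finite, 'a::field) ppoint set \<Rightarrow> bool" where
  "zariski_closed V \<longleftrightarrow> (\<exists>T. (\<forall>F\<in>T. is_form F) \<and> V = zero_locus T)"

definition vanishing_ideal :: "('n::finite, 'a::field) ppoint set \<Rightarrow> ('n, 'a) mpoly set" where
  "vanishing_ideal V = ideal_gen {F. is_form F \<and> (\<forall>P\<in>V. \<forall>v\<in>P. mpeval F v = 0)}"


section \<open>Projective varieties over a field\<close>

definition proj_variety :: "('n::finite, 'k::field alg_closure) ppoint set \<Rightarrow> bool" where
  "proj_variety V \<longleftrightarrow> zariski_closed V \<and> is_prime_ideal (vanishing_ideal V)"

definition base_change :: "('n, 'k::field) mpoly \<Rightarrow> ('n, 'k alg_closure) mpoly" where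
  "base_change F = Poly_Mapping.map to_ac F"

definition defined_over_base :: "('n::finite, 'k::field alg_closure) ppoint set \<Rightarrow> bool" where
  "defined_over_base V \<longleftrightarrow>
     (\<exists>S :: ('n, 'k) mpoly set. (\<forall>F\<in>S. is_form F) \<and>
        vanishing_ideal V = ideal_gen (base_change ` S))"

definition irreducible_chain ::
    "('n::finite, 'k::field alg_closure) ppoint set \<Rightarrow> nat \<Rightarrow>
     (nat \<Rightarrow> ('n, 'k alg_closure) ppoint set) \<Rightarrow> bool" where
  "irreducible_chain V d Z \<longleftrightarrow>
     (\<forall>i\<le>d. proj_variety (Z i) \<and> Z i \<subseteq> V) \<and> (\<forall>i<d. Z i \<subset> Z (Suc i))"

definition has_dim :: "('n::finite, 'k::field alg_closure) ppoint set \<Rightarrow> nat \<Rightarrow> bool" where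
  "has_dim V d \<longleftrightarrow>
     (\<exists>Z. irreducible_chain V d Z) \<and> \<not> (\<exists>Z. irreducible_chain V (Suc d) Z)"

definition gradient :: "('n::finite, 'a::field) mpoly \<Rightarrow> 'a ^ 'n \<Rightarrow> 'a ^ 'n" where
  "gradient F v = (\<chi> i. mpeval (mpderiv i F) v)"

text \<open>
  The Jacobian criterion: in projective space of dimension \<open>CARD('n) - 1\<close>, the Jacobian matrix of
  a variety of dimension \<open>d\<close> has rank \<open>CARD('n) - 1 - d\<close> at each point. By Euler's relation the
  rank with respect to homogeneous coordinates is the rank in any affine chart around the point,
  and by the product rule the gradients of the elements of the ideal span the same space as
  those of any system of generators.
\<close>

definition nonsingular :: "('n::finite, 'k::field alg_closure) ppoint set \<Rightarrow> bool" where
  "nonsingular V \<longleftrightarrow>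
     (\<exists>d. has_dim V d \<and>
        (\<forall>P\<in>V. \<forall>v\<in>P.
           vec.dim ((\<lambda>F. gradient F v) ` vanishing_ideal V) + d + 1 = CARD('n)))"

definition nonsingular_proj_curve :: "('n::finite, 'k::field alg_closure) ppoint set \<Rightarrow> bool" where
  "nonsingular_proj_curve C \<longleftrightarrow>
     proj_variety C \<and> defined_over_base C \<and> has_dim C 1 \<and> nonsingular C"

definition rational_points ::
    "('n::finite, 'k::field alg_closure) ppoint set \<Rightarrow> ('n, 'k alg_closure) ppoint set" where
  "rational_points V = {P \<in> V. \<exists>v\<in>P. \<forall>i. v $ i \<in> Set.range to_ac}"


section \<open>Birational equivalence\<close>

text \<open>Holding on a nonempty relatively open subset; used for irreducible \<open>V\<close>.\<close>

definition generically ::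
    "('n::finite, 'a::field) ppoint set \<Rightarrow> (('n, 'a) ppoint \<Rightarrow> bool) \<Rightarrow> bool" where
  "generically V Q \<longleftrightarrow> (\<exists>Z. zariski_closed Z \<and> \<not> V \<subseteq> Z \<and> (\<forall>P\<in>V - Z. Q P))"

text \<open>
  A tuple of forms of equal degree over \<open>'k\<close> represents a rational map over \<open>'k\<close>, which the
  tuple defines at the points where its entries have no common zero.
\<close>

definition rational_tuple :: "(('m::finite, 'k::field) mpoly) ^ 'n \<Rightarrow> bool" where
  "rational_tuple f \<longleftrightarrow> (\<exists>d. \<forall>j. form_of_degree d (f $ j))"

definition tuple_eval ::
    "(('m::finite, 'k::field) mpoly) ^ 'n \<Rightarrow> 'k alg_closure ^ 'm \<Rightarrow> 'k alg_closure ^ 'n" where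
  "tuple_eval f v = (\<chi> j. mpeval (base_change (f $ j)) v)"

definition tuple_maps ::
    "(('m::finite, 'k::field) mpoly) ^ 'n \<Rightarrow> ('m, 'k alg_closure) ppoint \<Rightarrow>
     ('n::finite, 'k alg_closure) ppoint \<Rightarrow> bool" where
  "tuple_maps f P Q \<longleftrightarrow> (\<exists>v\<in>P. tuple_eval f v \<noteq> 0 \<and> Q = ppoint (tuple_eval f v))"

text \<open>
  Mutually inverse rational maps over \<open>'k\<close> between irreducible locally closed sets: each maps a
  general point of its source to a point of the target at which the other one is defined and
  takes it back.
\<close>

definition birational ::
    "('m::finite, 'k::field alg_closure) ppoint set \<Rightarrow>
     ('n::finite, 'k alg_closure) ppoint set \<Rightarrow> bool" where
  "birational V W \<longleftrightarrow>
     (\<exists>(f :: (('m, 'k) mpoly) ^ 'n) (g :: (('n, 'k) mpoly) ^ 'm).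
        rational_tuple f \<and> rational_tuple g \<and>
        generically V (\<lambda>P. \<exists>Q\<in>W. tuple_maps f P Q \<and> tuple_maps g Q P) \<and>
        generically W (\<lambda>Q. \<exists>P\<in>V. tuple_maps g Q P \<and> tuple_maps f P Q))"

text \<open>An affine plane curve lies in the projective plane via \<open>(x, y) \<mapsto> [1 : x : y]\<close>.\<close>

definition affine_in_plane :: "('a \<times> 'a) set \<Rightarrow> (3, 'a::field) ppoint set" where
  "affine_in_plane A = (\<lambda>(x, y). ppoint (vector [1, x, y])) ` A"

definition smooth_projective_model ::
    "('n::finite, 'k::field alg_closure) ppoint set \<Rightarrow> ('k alg_closure \<times> 'k alg_closure) set \<Rightarrow>
     bool" where
  "smooth_projective_model C A \<longleftrightarrow>
     nonsingular_proj_curve C \<and> birational C (affine_in_plane A)"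


section \<open>The character sum and the curve\<close>

definition chi :: "'l::prime_card mod_ring \<Rightarrow> int" where
  "chi x = Legendre (to_int_mod_ring x) (int CARD('l))"

definition K :: "'l::prime_card mod_ring \<Rightarrow> 'l mod_ring \<Rightarrow> int" where
  "K A B = (\<Sum>z\<in>UNIV. chi ((z\<^sup>2 - A) * (z\<^sup>2 - B)))"

definition quartic_curve :: "'k::field \<Rightarrow> ('k alg_closure \<times> 'k alg_closure) set" where
  "quartic_curve c = {(x, y). y\<^sup>2 = (x\<^sup>2 - 1) * (x\<^sup>2 - to_ac c)}"

definition frobenius_trace ::
    "('n::finite, 'l::prime_card mod_ring alg_closure) ppoint set \<Rightarrow> int" where
  "frobenius_trace C = int CARD('l) + 1 - int (card (rational_points C))"

end

theory Submission
  imports Defs "HOL-Computational_Algebra.Formal_Laurent_Series"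
begin

text \<open>
  Why the theorem holds. Writing the sum \<open>K(A, cA)\<close> as a sum over \<open>w = z\<^sup>2\<close> and substituting
  \<open>w = A u\<close> separates a quadratic character sum, equal to \<open>- 1\<close>, from a cubic one that depends on
  \<open>A\<close> through the factor \<open>\<chi>(A)\<close> only (\<open>K_twist\<close>). So everything reduces to \<open>K(1, c)\<close>, which is
  \<open>- \<ell>\<close> plus the number of points of the affine curve \<open>y\<^sup>2 = (x\<^sup>2 - 1)(x\<^sup>2 - c)\<close> over \<open>\<F>\<^sub>\<ell>\<close>
  (\<open>card_affine_points\<close>).

  What remains is the geometric part: every smooth projective model of the affine curve has
  exactly two rational points more. For one explicit model this is seen by inspection, namely
  for the curve \<open>w\<^sub>1 w\<^sub>3 = w\<^sub>2\<^sup>2\<close>, \<open>w\<^sub>4\<^sup>2 = (w\<^sub>3 - w\<^sub>1)(w\<^sub>3 - c w\<^sub>1)\<close> in space, the closure of the image of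
  \<open>(x, y) \<mapsto> [1 : x : x\<^sup>2 : y]\<close>, whose points at infinity are \<open>[0 : 0 : 1 : \<plusminus>1]\<close>
  (\<open>card_rational_points_space_model\<close>). It then has to be shown that two models of the same
  function field have equally many rational points (\<open>rational_points_equinumerous\<close>).

  For this the function field \<open>L\<close> over the algebraic closure \<open>k\<close> of \<open>\<F>\<^sub>\<ell>\<close> is realized inside the
  Laurent series in \<open>1/x\<close>, and a model is given by a generic point, a vector over \<open>L\<close>. The
  points of a model correspond to the nontrivial places of \<open>L\<close>: every such place has a center
  because projective space is complete (\<open>center_exists\<close>), every point is the center of a place by
  Chevalley's theorem (\<open>place_exists\<close>, \<open>place_over_point\<close>), and at a nonsingular point the place
  is unique on \<open>L\<close>, since the order of vanishing along a uniformizer decides membership in its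
  ideal (\<open>same_center_same_place\<close>). The uniformizer comes from the Jacobian criterion, with
  Euler's relation and Nakayama's lemma (\<open>jacobian_uniformizer\<close>). Hence the points of two models
  correspond to each other through common places. Frobenius acts on the coefficients of Laurent
  series, and both generic points are fixed by it; taking preimages of places shows that the
  correspondence commutes with Frobenius, so it restricts to rational points.

  The rational maps of the birational equivalence provide a generic point of the given model, and
  the irreducibility of the model makes a form vanish on it iff it vanishes at that generic
  point (\<open>vanishes_iff\<close>).
\<close>

(* The notation for coefficients of power series would hide the one for components of vectors. *)
unbundle no Formal_Power_Series.fps_syntax

section \<open>Quadratic character sums over a prime field\<close>

lemma of_int_mod_ring_congruence:
  "(of_int a :: 'l::prime_card mod_ring) = of_int b \<longleftrightarrow> [a = b] (mod int CARD('l))"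
  unfolding of_int_of_int_mod_ring cong_def by transfer simp

lemma chi_altdef:
  "chi (x :: 'l::prime_card mod_ring) = (if x = 0 then 0 else if \<exists>y. x = y\<^sup>2 then 1 else - 1)"
proof -
  have of_int_surj: "\<exists>a. y = of_int a" for y :: "'l mod_ring"
    by (metis of_int_mod_ring_to_int_mod_ring of_int_of_int_mod_ring)
  have x: "x = of_int (to_int_mod_ring x)"
    by (simp add: of_int_of_int_mod_ring)
  have "[to_int_mod_ring x = 0] (mod int CARD('l)) \<longleftrightarrow> x = 0"
    using of_int_mod_ring_congruence[where 'l='l, of "to_int_mod_ring x" 0] x by simp
  moreover have "QuadRes (int CARD('l)) (to_int_mod_ring x) \<longleftrightarrow> (\<exists>y. x = y\<^sup>2)"
    unfolding QuadRes_def of_int_mod_ring_congruence[where 'l='l, symmetric] x[symmetric]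
    using of_int_surj by (metis of_int_power)
  ultimately show ?thesis
    by (simp add: chi_def Legendre_def)
qed

lemma chi_0 [simp]: "chi 0 = 0"
  by (simp add: chi_altdef)

lemma chi_1 [simp]: "chi 1 = 1"
  by (auto simp: chi_altdef intro: exI[of _ 1])

lemma chi_square: "b \<noteq> 0 \<Longrightarrow> chi (b\<^sup>2) = 1"
  by (auto simp: chi_altdef)

lemma chi_mult_square:
  assumes "b \<noteq> 0"
  shows "chi (b\<^sup>2 * x) = chi x"
proof -
  have "(\<exists>y. b\<^sup>2 * x = y\<^sup>2) \<longleftrightarrow> (\<exists>y. x = y\<^sup>2)"
  proof
    assume "\<exists>y. b\<^sup>2 * x = y\<^sup>2"
    then obtain y where "b\<^sup>2 * x = y\<^sup>2" by blast
    hence "x = (y / b)\<^sup>2"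
      using assms by (simp add: field_simps)
    thus "\<exists>y. x = y\<^sup>2" by blast
  qed (metis power_mult_distrib)
  thus ?thesis
    using assms by (simp add: chi_altdef)
qed

lemma two_neq_zero_mod_ring:
  assumes "CARD('l::prime_card) > 2"
  shows "(2 :: 'l mod_ring) \<noteq> 0"
proof
  assume "(2 :: 'l mod_ring) = 0"
  hence "[2 = 0] (mod int CARD('l))"
    using of_int_mod_ring_congruence[where 'l='l, of 2 0] by simp
  thus False
    using assms zdvd_imp_le[of "int CARD('l)" 2] by (simp add: cong_0_iff)
qed

text \<open>
  A nonzero square has the two roots \<open>\<plusminus>y\<close>, distinct in odd characteristic.
\<close>

lemma card_square_roots:
  fixes w :: "'l::prime_card mod_ring"
  assumes "CARD('l) > 2"
  shows "int (card {y. y\<^sup>2 = w}) = 1 + chi w"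
proof -
  consider "w = 0" | y where "w = y\<^sup>2" "y \<noteq> 0" | "\<nexists>y. w = y\<^sup>2"
    by fastforce
  thus ?thesis
  proof cases
    case 2
    have "y \<noteq> - y"
      using 2 two_neq_zero_mod_ring[OF assms]
      by (metis add.right_inverse mult_2 mult_eq_0_iff)
    moreover have "{z. z\<^sup>2 = w} = {y, - y}"
      using 2 by (auto simp: power2_eq_iff)
    ultimately show ?thesis
      using 2 by (simp add: chi_square)
  next
    case 3
    hence "{y. y\<^sup>2 = w} = {}" "w \<noteq> 0"
      by (force, metis zero_power2)
    thus ?thesis
      using 3 by (simp add: chi_altdef)
  qed simp
qed

lemma sum_over_squares:
  fixes h :: "'l::prime_card mod_ring \<Rightarrow> int"
  assumes "CARD('l) > 2"
  shows "(\<Sum>z\<in>UNIV. h (z\<^sup>2)) = (\<Sum>w\<in>UNIV. (1 + chi w) * h w)"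
proof -
  have "(\<Sum>z\<in>UNIV. h (z\<^sup>2)) = (\<Sum>w\<in>UNIV. \<Sum>z\<in>{z\<in>UNIV. z\<^sup>2 = w}. h (z\<^sup>2))"
    by (rule sum.group[symmetric]) auto
  also have "\<dots> = (\<Sum>w\<in>UNIV. (1 + chi w) * h w)"
    by (rule sum.cong) (auto simp flip: card_square_roots[OF assms])
  finally show ?thesis .
qed

text \<open>The case \<open>h = 1\<close> of the preceding substitution.\<close>

lemma sum_chi_eq_0:
  assumes "CARD('l::prime_card) > 2"
  shows "(\<Sum>w\<in>UNIV. chi (w :: 'l mod_ring)) = 0"
  using sum_over_squares[OF assms, of "\<lambda>_. 1"] by (simp add: sum.distrib)

text \<open>
  A nonsquare swaps the squares and the nonsquares of \<open>\<F>\<^sub>\<ell>\<^sup>*\<close>: it maps the squares into the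
  nonsquares, and the vanishing of the character sum makes the two sets equally large.
\<close>

lemma chi_mult:
  fixes x y :: "'l::prime_card mod_ring"
  assumes "CARD('l) > 2"
  shows "chi (x * y) = chi x * chi y"
proof (cases "x = 0 \<or> y = 0 \<or> (\<exists>z. x = z\<^sup>2)")
  case True
  moreover have "chi (z\<^sup>2 * y) = chi (z\<^sup>2) * chi y" for z
    by (cases "z = 0") (simp_all add: chi_square chi_mult_square)
  ultimately show ?thesis
    by auto
next
  case False
  define S where "S = {w :: 'l mod_ring. chi w = 1}"
  define N where "N = {w :: 'l mod_ring. chi w = - 1}"
  have "(\<Sum>w\<in>UNIV. chi (w :: 'l mod_ring)) = (\<Sum>w\<in>UNIV. of_bool (w \<in> S) - of_bool (w \<in> N))"
    by (rule sum.cong) (auto simp: S_def N_def chi_altdef)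
  hence card_SN: "card S = card N"
    using sum_chi_eq_0[OF assms] by (simp add: sum_subtractf)
  have "(*) x ` S \<subseteq> N"
  proof
    fix w assume "w \<in> (*) x ` S"
    then obtain v where v: "chi v = 1" "w = x * v"
      by (auto simp: S_def)
    from v(1) have "v \<noteq> 0" "\<exists>z. v = z\<^sup>2"
      by (auto simp: chi_altdef split: if_splits)
    then obtain z where "v = z\<^sup>2" "z \<noteq> 0"
      by auto
    with v(2) have z: "w = x * z\<^sup>2" "z \<noteq> 0"
      by simp_all
    hence "chi w = chi x"
      using chi_mult_square[of z x] by (simp add: mult.commute)
    thus "w \<in> N"
      using False by (simp add: N_def chi_altdef)
  qed
  moreover have inj: "inj_on ((*) x) A" for A
    using False by (auto intro: inj_onI)
  hence "card ((*) x ` S) = card N"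
    by (metis card_image card_SN)
  ultimately have image: "(*) x ` S = N"
    by (simp add: card_subset_eq)
  show ?thesis
  proof (cases "chi y = 1")
    case True
    hence "x * y \<in> N" using image by (auto simp: S_def)
    thus ?thesis using True False by (simp add: N_def chi_altdef)
  next
    case y: False
    have "x * y \<notin> N"
    proof
      assume "x * y \<in> N"
      then obtain z where "z \<in> S" "x * y = x * z" using image by blast
      thus False using y False by (simp add: S_def)
    qed
    moreover have "x * y \<noteq> 0" "chi x = - 1" "chi y = - 1"
      using False y by (auto simp: chi_altdef split: if_splits)
    ultimately show ?thesis
      by (auto simp: N_def chi_altdef split: if_splits)
  qed
qed

text \<open>
  Dividing by the square \<open>(u - c)\<^sup>2\<close> turns the summand into \<open>\<chi>\<close> of the Moebius transform
  \<open>(u - 1)/(u - c)\<close>, which for \<open>u \<noteq> c\<close> takes every value except \<open>1\<close> exactly once; so the full sum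
  of \<open>\<chi>\<close>, which is \<open>0\<close>, lacks only \<open>\<chi>(1)\<close>.
\<close>

lemma sum_chi_quadratic:
  fixes c :: "'l::prime_card mod_ring"
  assumes "CARD('l) > 2" "c \<noteq> 1"
  shows "(\<Sum>u\<in>UNIV. chi ((u - 1) * (u - c))) = - 1"
proof -
  have "(\<Sum>u\<in>UNIV. chi ((u - 1) * (u - c))) = (\<Sum>u\<in>UNIV - {c}. chi ((u - 1) * (u - c)))"
    by (rule sum.mono_neutral_right) auto
  also have "\<dots> = (\<Sum>u\<in>UNIV - {c}. chi ((u - 1) / (u - c)))"
  proof (rule sum.cong)
    fix u assume u: "u \<in> UNIV - {c}"
    hence "(u - 1) * (u - c) = (u - c)\<^sup>2 * ((u - 1) / (u - c))"
      by (simp add: power2_eq_square)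
    thus "chi ((u - 1) * (u - c)) = chi ((u - 1) / (u - c))"
      using u by (metis DiffE chi_mult_square eq_iff_diff_eq_0 singletonI)
  qed simp
  also have "\<dots> = (\<Sum>w\<in>UNIV - {1}. chi (w :: 'l mod_ring))"
  proof (rule sum.reindex_bij_witness
          [where j = "\<lambda>u. (u - 1) / (u - c)" and i = "\<lambda>w. (w * c - 1) / (w - 1)"])
    fix u assume "u \<in> UNIV - {c}"
    hence u: "u - c \<noteq> 0" by simp
    have *: "(u - 1) / (u - c) - 1 = (c - 1) / (u - c)"
      "(u - 1) / (u - c) * c - 1 = u * ((c - 1) / (u - c))"
      using u by (simp_all add: divide_simps) (simp_all add: algebra_simps)
    show "((u - 1) / (u - c) * c - 1) / ((u - 1) / (u - c) - 1) = u"
      using u assms(2) unfolding * by simp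
    show "(u - 1) / (u - c) \<in> UNIV - {1}"
      using u assms(2) * by auto
  next
    fix w :: "'l mod_ring" assume "w \<in> UNIV - {1}"
    hence w: "w - 1 \<noteq> 0" by simp
    have *: "(w * c - 1) / (w - 1) - 1 = w * ((c - 1) / (w - 1))"
      "(w * c - 1) / (w - 1) - c = (c - 1) / (w - 1)"
      using w by (simp_all add: divide_simps) (simp_all add: algebra_simps)
    show "((w * c - 1) / (w - 1) - 1) / ((w * c - 1) / (w - 1) - c) = w"
      using w assms(2) unfolding * by simp
    show "(w * c - 1) / (w - 1) \<in> UNIV - {c}"
      using w assms(2) * by auto
  qed simp
  also have "\<dots> = (\<Sum>w\<in>UNIV. chi (w :: 'l mod_ring)) - chi (1 :: 'l mod_ring)"
    by (simp add: sum_diff1)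
  finally show ?thesis
    using sum_chi_eq_0[OF assms(1)] by simp
qed

text \<open>
  With \<open>z\<^sup>2 = w = A u\<close> the summand becomes \<open>(1 + \<chi>(A u)) \<chi>((u - 1)(u - c))\<close>, as \<open>A\<^sup>2\<close> is a square.
  The part without \<open>\<chi>(A u)\<close> does not depend on \<open>A\<close>, the other one is \<open>\<chi>(A)\<close> times a sum
  independent of \<open>A\<close>; the case \<open>A = 1\<close> identifies that sum.
\<close>

lemma K_twist:
  fixes c A :: "'l::prime_card mod_ring"
  assumes "CARD('l) > 2" "c \<noteq> 1" "A \<noteq> 0"
  shows "K A (c * A) = - 1 + chi A * (K 1 c + 1)"
proof -
  define S where "S = (\<Sum>u\<in>UNIV. chi (u * ((u - 1) * (u - c))))"
  have twist: "K A (c * A) = - 1 + chi A * S" if "A \<noteq> 0" for A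
  proof -
    have "K A (c * A) = (\<Sum>w\<in>UNIV. (1 + chi w) * chi ((w - A) * (w - c * A)))"
      unfolding K_def by (rule sum_over_squares[OF assms(1)])
    also have "\<dots> = (\<Sum>u\<in>UNIV. (1 + chi (A * u)) * chi ((A * u - A) * (A * u - c * A)))"
      by (rule sum.reindex_bij_witness[where i = "\<lambda>u. A * u" and j = "\<lambda>w. w / A"])
         (use that in auto)
    also have "\<dots> = (\<Sum>u\<in>UNIV. chi ((u - 1) * (u - c)) + chi A * chi (u * ((u - 1) * (u - c))))"
    proof (rule sum.cong)
      fix u
      have "chi ((A * u - A) * (A * u - c * A)) = chi (A\<^sup>2 * ((u - 1) * (u - c)))"
        by (simp add: algebra_simps power2_eq_square)
      also have "\<dots> = chi ((u - 1) * (u - c))"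
        using that by (rule chi_mult_square)
      finally show "(1 + chi (A * u)) * chi ((A * u - A) * (A * u - c * A)) =
          chi ((u - 1) * (u - c)) + chi A * chi (u * ((u - 1) * (u - c)))"
        by (simp add: chi_mult[OF assms(1), of A u] chi_mult[OF assms(1), of u] distrib_right
            del: mult_eq_0_iff)
    qed simp
    finally show ?thesis
      by (simp add: sum.distrib sum_chi_quadratic[OF assms(1,2)] S_def sum_distrib_left)
  qed
  show ?thesis
    using twist[of 1] twist[OF assms(3)] by simp
qed

lemma card_affine_points:
  fixes c :: "'l::prime_card mod_ring"
  assumes "CARD('l) > 2"
  shows "int (card {(a, b). b\<^sup>2 = (a\<^sup>2 - 1) * (a\<^sup>2 - c)}) = int CARD('l) + K 1 c"
proof -
  have "{(a, b). b\<^sup>2 = (a\<^sup>2 - 1) * (a\<^sup>2 - c)} = (SIGMA a:UNIV. {b. b\<^sup>2 = (a\<^sup>2 - 1) * (a\<^sup>2 - c)})"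
    by auto
  hence "int (card {(a, b). b\<^sup>2 = (a\<^sup>2 - 1) * (a\<^sup>2 - c)}) =
      (\<Sum>a\<in>UNIV. int (card {b. b\<^sup>2 = (a\<^sup>2 - 1) * (a\<^sup>2 - c)}))"
    by simp
  thus ?thesis
    by (simp add: card_square_roots[OF assms] sum.distrib K_def)
qed

section \<open>Polynomials in several variables and their evaluation\<close>

text \<open>
  The coefficients and the point of evaluation live in different fields (a ground field, its
  algebraic closure, a function field), so evaluation carries the ring homomorphism along.
\<close>

definition hom_eval :: "('a::comm_ring_1 \<Rightarrow> 'b::comm_ring_1) \<Rightarrow> ('n::finite, 'a) mpoly \<Rightarrow> 'b ^ 'n \<Rightarrow> 'b" where
  "hom_eval \<phi> F z =
     (\<Sum>m\<in>Poly_Mapping.keys F.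
        \<phi> (Poly_Mapping.lookup F m) * (\<Prod>i\<in>UNIV. (z $ i) ^ Poly_Mapping.lookup m i))"

definition monomial_at :: "'b::comm_ring_1 ^ 'n::finite \<Rightarrow> ('n \<Rightarrow>\<^sub>0 nat) \<Rightarrow> 'b" where
  "monomial_at z m = (\<Prod>i\<in>UNIV. (z $ i) ^ Poly_Mapping.lookup m i)"

definition mpvar :: "'n \<Rightarrow> ('n::finite, 'a::comm_ring_1) mpoly" where
  "mpvar i = Poly_Mapping.single (Poly_Mapping.single i 1) 1"

definition mpconst :: "'a \<Rightarrow> ('n::finite, 'a::comm_ring_1) mpoly" where
  "mpconst a = Poly_Mapping.single 0 a"

definition mdegree :: "('n::finite \<Rightarrow>\<^sub>0 nat) \<Rightarrow> nat" where
  "mdegree m = (\<Sum>i\<in>UNIV. Poly_Mapping.lookup m i)"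

lemma mdegree_add: "mdegree (m + n) = mdegree m + mdegree n"
  by (simp add: mdegree_def lookup_add sum.distrib)

lemma mdegree_single [simp]: "mdegree (Poly_Mapping.single i k) = k"
  by (simp add: mdegree_def lookup_single when_def)

lemma mdegree_0 [simp]: "mdegree 0 = 0"
  by (simp add: mdegree_def)

lemma mdegree_eq_0: "mdegree m = 0 \<Longrightarrow> m = 0"
  by (auto simp: mdegree_def intro!: poly_mapping_eqI)

lemma monomial_at_0 [simp]: "monomial_at z 0 = 1"
  by (simp add: monomial_at_def)

lemma monomial_at_add: "monomial_at z (m + n) = monomial_at z m * monomial_at z n"
  by (simp add: monomial_at_def lookup_add power_add prod.distrib)

lemma monomial_at_single [simp]: "monomial_at z (Poly_Mapping.single i k) = z $ i ^ k"
proof -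
  have "monomial_at z (Poly_Mapping.single i k) = (\<Prod>j\<in>UNIV. if j = i then z $ i ^ k else 1)"
    unfolding monomial_at_def by (rule prod.cong) (auto simp: lookup_single when_def)
  thus ?thesis by simp
qed

lemma monomial_at_scale: "monomial_at (s *s z) m = s ^ mdegree m * monomial_at z m"
  by (simp add: monomial_at_def mdegree_def power_mult_distrib prod.distrib power_sum)

lemma mpoly_sum_monomials:
  "(\<Sum>m\<in>Poly_Mapping.keys F. Poly_Mapping.single m (Poly_Mapping.lookup F m)) = F"
  by (rule poly_mapping_eqI)
     (auto simp: lookup_sum lookup_single when_def in_keys_iff)

lemma mpoly_additive_induct [case_names single add]:
  fixes F :: "('n::finite, 'a::comm_ring_1) mpoly"
  assumes "\<And>m a. P (Poly_Mapping.single m a)" "\<And>F G. P F \<Longrightarrow> P G \<Longrightarrow> P (F + G)"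
  shows "P F"
proof -
  have "P (\<Sum>m\<in>A. Poly_Mapping.single m (Poly_Mapping.lookup F m))" if "finite A" for A
    using that
  proof induction
    case empty
    show ?case using assms(1)[of 0 0] by simp
  qed (simp add: assms)
  from this[of "Poly_Mapping.keys F"] show ?thesis
    by (simp add: mpoly_sum_monomials)
qed

lemma mpoly_ring_induct [case_names const var add mult]:
  fixes F :: "('n::finite, 'a::comm_ring_1) mpoly"
  assumes const: "\<And>a. P (mpconst a)" and var: "\<And>i. P (mpvar i)"
    and add: "\<And>F G. P F \<Longrightarrow> P G \<Longrightarrow> P (F + G)" and mult: "\<And>F G. P F \<Longrightarrow> P G \<Longrightarrow> P (F * G)"
  shows "P F"
proof (induction F rule: mpoly_additive_induct)
  case (single m a)
  show ?case
  proof (induction "mdegree m" arbitrary: m)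
    case 0
    hence "m = 0" using mdegree_eq_0[of m] by simp
    thus ?case using const[of a] by (simp add: mpconst_def)
  next
    case (Suc k)
    then obtain i where i: "Poly_Mapping.lookup m i \<noteq> 0"
      by (metis mdegree_0 nat.distinct(1) poly_mapping_eqI lookup_zero)
    define m' where "m' = m - Poly_Mapping.single i 1"
    have m: "m = m' + Poly_Mapping.single i 1"
      using i by (intro poly_mapping_eqI) (auto simp: m'_def lookup_add lookup_minus lookup_single when_def)
    hence "k = mdegree m'"
      using Suc.hyps(2) by (simp add: mdegree_add)
    from mult[OF Suc.hyps(1)[OF this] var[of i]] show ?case
      by (simp add: mpvar_def mult_single m)
  qed
qed (use add in blast)

context comm_ring_hom
begin

lemma hom_eval_superset:
  assumes "finite A" "Poly_Mapping.keys F \<subseteq> A"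
  shows "hom_eval hom F z = (\<Sum>m\<in>A. hom (Poly_Mapping.lookup F m) * monomial_at z m)"
  unfolding hom_eval_def monomial_at_def
  by (rule sum.mono_neutral_left) (use assms in \<open>auto simp: in_keys_iff\<close>)

lemma hom_eval_add: "hom_eval hom (F + G) z = hom_eval hom F z + hom_eval hom G z"
proof -
  let ?A = "Poly_Mapping.keys F \<union> Poly_Mapping.keys G"
  have "Poly_Mapping.keys (F + G) \<subseteq> ?A" by (rule keys_add)
  thus ?thesis
    using hom_eval_superset[of ?A]
    by (simp add: lookup_add hom_add distrib_right sum.distrib)
qed

lemma hom_eval_single [simp]:
  "hom_eval hom (Poly_Mapping.single m a) z = hom a * monomial_at z m"
  using hom_eval_superset[of "{m}" "Poly_Mapping.single m a"] by simp

lemma hom_eval_0 [simp]: "hom_eval hom 0 z = 0"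
  by (simp add: hom_eval_def)

lemma hom_eval_sum: "hom_eval hom (\<Sum>x\<in>A. F x) z = (\<Sum>x\<in>A. hom_eval hom (F x) z)"
  by (induction A rule: infinite_finite_induct) (simp_all add: hom_eval_add)

lemma hom_eval_mpconst [simp]: "hom_eval hom (mpconst a) z = hom a"
  by (simp add: mpconst_def)

lemma hom_eval_mpvar [simp]: "hom_eval hom (mpvar i) z = z $ i"
  by (simp add: mpvar_def)

lemma hom_eval_mult: "hom_eval hom (F * G) z = hom_eval hom F z * hom_eval hom G z"
proof (induction F rule: mpoly_additive_induct)
  case (single m a)
  show ?case
    by (induction G rule: mpoly_additive_induct)
       (simp_all add: mult_single monomial_at_add hom_mult distrib_left hom_eval_add)
qed (simp add: distrib_right hom_eval_add)

lemma hom_eval_1 [simp]: "hom_eval hom 1 z = 1"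
  using hom_eval_mpconst[of 1 z] by (simp add: mpconst_def)

lemma hom_eval_uminus: "hom_eval hom (- F) z = - hom_eval hom F z"
  using hom_eval_add[of F "- F" z] by (simp add: eq_neg_iff_add_eq_0 add.commute)

lemma hom_eval_diff: "hom_eval hom (F - G) z = hom_eval hom F z - hom_eval hom G z"
  using hom_eval_add[of F "- G" z] by (simp add: hom_eval_uminus)

lemma hom_eval_scale:
  assumes "form_of_degree d F"
  shows "hom_eval hom F (s *s z) = s ^ d * hom_eval hom F z"
proof -
  have "mdegree m = d" if "m \<in> Poly_Mapping.keys F" for m
    using assms that by (simp add: form_of_degree_def mdegree_def)
  thus ?thesis
    using hom_eval_superset[of "Poly_Mapping.keys F" F]
    by (simp add: monomial_at_scale sum_distrib_left algebra_simps)
qed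

end

lemma form_of_degree_add: "form_of_degree d F \<Longrightarrow> form_of_degree d G \<Longrightarrow> form_of_degree d (F + G)"
  unfolding form_of_degree_def using keys_add[of F G] by blast

lemma form_of_degree_0 [simp]: "form_of_degree d 0"
  by (simp add: form_of_degree_def)

lemma form_of_degree_sum:
  "(\<And>x. x \<in> A \<Longrightarrow> form_of_degree d (F x)) \<Longrightarrow> form_of_degree d (\<Sum>x\<in>A. F x)"
  by (induction A rule: infinite_finite_induct) (simp_all add: form_of_degree_add)

lemma form_of_degree_single: "form_of_degree (mdegree m) (Poly_Mapping.single m a)"
  by (simp add: form_of_degree_def mdegree_def)

lemma form_of_degree_mult:
  assumes "form_of_degree d F" "form_of_degree e G"
  shows "form_of_degree (d + e) (F * G)"
  unfolding form_of_degree_def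
proof
  fix m assume "m \<in> Poly_Mapping.keys (F * G)"
  then obtain a b where "m = a + b" "a \<in> Poly_Mapping.keys F" "b \<in> Poly_Mapping.keys G"
    using keys_mult[of F G] by blast
  thus "(\<Sum>i\<in>UNIV. Poly_Mapping.lookup m i) = d + e"
    using assms by (simp add: form_of_degree_def lookup_add sum.distrib)
qed

lemma is_form_mult: "is_form F \<Longrightarrow> is_form G \<Longrightarrow> is_form (F * G)"
  unfolding is_form_def using form_of_degree_mult by blast

text \<open>
  Homogenization, adapted to representatives whose \<open>i\<close>-th coordinate is the constant \<open>a\<close>
  rather than \<open>1\<close>.
\<close>

definition homogenization :: "'n::finite \<Rightarrow> 'a \<Rightarrow> ('n, 'a::field) mpoly \<Rightarrow> ('n, 'a) mpoly" where
  "homogenization i a F =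
     (let D = Max (mdegree ` Poly_Mapping.keys F)
      in \<Sum>m\<in>Poly_Mapping.keys F.
           Poly_Mapping.single (m + Poly_Mapping.single i (D - mdegree m))
             (Poly_Mapping.lookup F m / a ^ (D - mdegree m)))"

lemma is_form_homogenization: "is_form (homogenization i a F)"
proof -
  define D where "D = Max (mdegree ` Poly_Mapping.keys F)"
  have "mdegree m \<le> D" if "m \<in> Poly_Mapping.keys F" for m
    unfolding D_def using that by (intro Max_ge) auto
  hence "form_of_degree D (Poly_Mapping.single (m + Poly_Mapping.single i (D - mdegree m)) b)"
    if "m \<in> Poly_Mapping.keys F" for m b
    using that form_of_degree_single[of "m + Poly_Mapping.single i (D - mdegree m)" b]
    by (simp add: mdegree_add)
  hence "form_of_degree D (homogenization i a F)"
    unfolding homogenization_def Let_def D_def[symmetric] by (intro form_of_degree_sum)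
  thus ?thesis unfolding is_form_def by blast
qed

lemma (in field_hom) hom_eval_homogenization:
  fixes z :: "'b ^ 'n::finite"
  assumes "a \<noteq> 0" "z $ i = hom a"
  shows "hom_eval hom (homogenization i a F) z = hom_eval hom F z"
proof -
  have "hom a \<noteq> 0"
    using assms(1) by simp
  hence "hom_eval hom (homogenization i a F) z =
      (\<Sum>m\<in>Poly_Mapping.keys F. hom (Poly_Mapping.lookup F m) * monomial_at z m)"
    unfolding homogenization_def Let_def hom_eval_sum
    by (intro sum.cong) (simp_all add: monomial_at_add assms(2) hom_distribs)
  thus ?thesis
    by (simp add: hom_eval_superset[of "Poly_Mapping.keys F"])
qed

lemma comm_ring_hom_identity: "comm_ring_hom (\<lambda>x :: 'a::comm_ring_1. x)"
  by unfold_locales auto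

lemma mpeval_conv_hom_eval: "mpeval F v = hom_eval (\<lambda>x. x) F v"
  by (simp add: mpeval_def hom_eval_def)

lemmas mpeval_add = comm_ring_hom.hom_eval_add[OF comm_ring_hom_identity, folded mpeval_conv_hom_eval]
  and mpeval_mult = comm_ring_hom.hom_eval_mult[OF comm_ring_hom_identity, folded mpeval_conv_hom_eval]
  and mpeval_diff = comm_ring_hom.hom_eval_diff[OF comm_ring_hom_identity, folded mpeval_conv_hom_eval]
  and mpeval_sum = comm_ring_hom.hom_eval_sum[OF comm_ring_hom_identity, folded mpeval_conv_hom_eval]
  and mpeval_single = comm_ring_hom.hom_eval_single[OF comm_ring_hom_identity, folded mpeval_conv_hom_eval]
  and mpeval_mpconst [simp] = comm_ring_hom.hom_eval_mpconst[OF comm_ring_hom_identity, folded mpeval_conv_hom_eval]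
  and mpeval_mpvar [simp] = comm_ring_hom.hom_eval_mpvar[OF comm_ring_hom_identity, folded mpeval_conv_hom_eval]
  and mpeval_0 [simp] = comm_ring_hom.hom_eval_0[OF comm_ring_hom_identity, folded mpeval_conv_hom_eval]
  and mpeval_1 [simp] = comm_ring_hom.hom_eval_1[OF comm_ring_hom_identity, folded mpeval_conv_hom_eval]
  and mpeval_scale = comm_ring_hom.hom_eval_scale[OF comm_ring_hom_identity, folded mpeval_conv_hom_eval]

lemma mpeval_homogenization:
  fixes F :: "('n::finite, 'a::field) mpoly" and v :: "'a ^ 'n"
  assumes "v $ i \<noteq> 0"
  shows "mpeval (homogenization i (v $ i) F) v = mpeval F v"
proof -
  have "field_hom (\<lambda>x :: 'a. x)"
    by unfold_locales auto
  thus ?thesis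
    unfolding mpeval_conv_hom_eval using assms by (intro field_hom.hom_eval_homogenization) auto
qed

lemma mpeval_base_change: "mpeval (base_change F) v = hom_eval to_ac F v"
proof -
  have "Poly_Mapping.keys (base_change F) = Poly_Mapping.keys F"
    by (auto simp: base_change_def in_keys_iff Poly_Mapping.map.rep_eq when_def)
  moreover have "Poly_Mapping.lookup (base_change F) m = to_ac (Poly_Mapping.lookup F m)" for m
    by (simp add: base_change_def Poly_Mapping.map.rep_eq when_def)
  ultimately show ?thesis
    by (simp add: mpeval_def hom_eval_def)
qed

lemma hom_eval_compose:
  assumes "comm_ring_hom \<psi>"
  shows "\<psi> (hom_eval \<phi> F z) = hom_eval (\<lambda>x. \<psi> (\<phi> x)) F (\<chi> i. \<psi> (z $ i))"
proof -
  interpret comm_ring_hom \<psi> by fact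
  show ?thesis
    by (simp add: hom_eval_def hom_sum hom_prod hom_mult hom_power)
qed


subsection \<open>Derivatives\<close>

lemma mpderiv_superset:
  assumes "finite A" "Poly_Mapping.keys F \<subseteq> A"
  shows "mpderiv i F = (\<Sum>m\<in>A. Poly_Mapping.single (m - Poly_Mapping.single i 1)
           (of_nat (Poly_Mapping.lookup m i) * Poly_Mapping.lookup F m))"
  unfolding mpderiv_def
  by (rule sum.mono_neutral_left) (use assms in \<open>auto simp: in_keys_iff\<close>)

lemma mpderiv_add: "mpderiv i (F + G) = mpderiv i F + mpderiv i G"
proof -
  let ?A = "Poly_Mapping.keys F \<union> Poly_Mapping.keys G"
  have "Poly_Mapping.keys (F + G) \<subseteq> ?A" by (rule keys_add)
  thus ?thesis
    using mpderiv_superset[of ?A F i] mpderiv_superset[of ?A G i] mpderiv_superset[of ?A "F + G" i]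
    by (simp add: lookup_add single_add distrib_left sum.distrib)
qed

lemma mpderiv_single:
  "mpderiv i (Poly_Mapping.single m a) =
     Poly_Mapping.single (m - Poly_Mapping.single i 1) (of_nat (Poly_Mapping.lookup m i) * a)"
  using mpderiv_superset[of "{m}" "Poly_Mapping.single m a"] by simp

lemma mpderiv_0 [simp]: "mpderiv i 0 = 0"
  by (simp add: mpderiv_def)

lemma mpderiv_sum: "mpderiv i (\<Sum>x\<in>A. F x) = (\<Sum>x\<in>A. mpderiv i (F x))"
  by (induction A rule: infinite_finite_induct) (simp_all add: mpderiv_add)

lemma mpderiv_mpconst [simp]: "mpderiv i (mpconst a) = 0"
  by (simp add: mpconst_def mpderiv_single)

lemma mpderiv_mpvar: "mpderiv i (mpvar j) = (if i = j then 1 else 0)"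
  by (simp add: mpvar_def mpderiv_single lookup_single)

lemma mpderiv_diff: "mpderiv i (F - G) = mpderiv i F - mpderiv i G"
  using mpderiv_add[of i "F - G" G] by (simp add: algebra_simps)

lemma mpderiv_mult_single:
  fixes a b :: "'a::comm_ring_1" and m n :: "'n::finite \<Rightarrow>\<^sub>0 nat"
  shows "mpderiv i (Poly_Mapping.single m a * Poly_Mapping.single n b) =
     mpderiv i (Poly_Mapping.single m a) * Poly_Mapping.single n b +
     Poly_Mapping.single m a * mpderiv i (Poly_Mapping.single n b)"
proof -
  let ?e = "Poly_Mapping.single i 1"
  have shift: "Poly_Mapping.single (m - ?e + n) (of_nat (Poly_Mapping.lookup m i) * c) =
      Poly_Mapping.single (m + n - ?e) (of_nat (Poly_Mapping.lookup m i) * c)"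
    for m n :: "'n \<Rightarrow>\<^sub>0 nat" and c :: 'a
  proof (cases "Poly_Mapping.lookup m i = 0")
    case False
    hence "m - ?e + n = m + n - ?e"
      by (intro poly_mapping_eqI) (auto simp: lookup_add lookup_minus lookup_single when_def)
    thus ?thesis by simp
  qed simp
  have "mpderiv i (Poly_Mapping.single m a) * Poly_Mapping.single n b =
      Poly_Mapping.single (m + n - ?e) (of_nat (Poly_Mapping.lookup m i) * (a * b))"
    using shift[of m n "a * b"] by (simp add: mpderiv_single mult_single ac_simps)
  moreover have "Poly_Mapping.single m a * mpderiv i (Poly_Mapping.single n b) =
      Poly_Mapping.single (m + n - ?e) (of_nat (Poly_Mapping.lookup n i) * (a * b))"
    using shift[of n m "a * b"] by (simp add: mpderiv_single mult_single ac_simps)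
  ultimately show ?thesis
    by (simp add: mpderiv_single mult_single lookup_add single_add[symmetric] distrib_right)
qed

lemma mpderiv_mult: "mpderiv i (F * G) = mpderiv i F * G + F * mpderiv i G"
proof (induction F rule: mpoly_additive_induct)
  case (single m a)
  show ?case
    by (induction G rule: mpoly_additive_induct)
       (simp_all add: mpderiv_mult_single mpderiv_add algebra_simps)
qed (simp add: mpderiv_add algebra_simps)

lemma gradient_add: "gradient (F + G) v = gradient F v + gradient G v"
  by (simp add: gradient_def vec_eq_iff mpderiv_add mpeval_add)

lemma gradient_mult:
  "gradient (F * G) v = mpeval G v *s gradient F v + mpeval F v *s gradient G v"
  by (simp add: gradient_def vec_eq_iff mpderiv_mult mpeval_add mpeval_mult ac_simps)

text \<open>Euler's relation: the gradient of a form at a zero is orthogonal to the zero.\<close>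

lemma euler_relation:
  fixes F :: "('n::finite, 'a::comm_ring_1) mpoly"
  assumes "form_of_degree d F"
  shows "(\<Sum>i\<in>UNIV. v $ i * mpeval (mpderiv i F) v) = of_nat d * mpeval F v"
proof -
  have monomial_term: "v $ i * mpeval (Poly_Mapping.single (m - Poly_Mapping.single i 1)
        (of_nat (Poly_Mapping.lookup m i) * a)) v =
      of_nat (Poly_Mapping.lookup m i) * (a * monomial_at v m)" for i m a
  proof (cases "Poly_Mapping.lookup m i = 0")
    case False
    hence "m = (m - Poly_Mapping.single i 1) + Poly_Mapping.single i 1"
      by (intro poly_mapping_eqI) (auto simp: lookup_add lookup_minus lookup_single when_def)
    hence "monomial_at v m = monomial_at v (m - Poly_Mapping.single i 1) * v $ i"
      by (metis monomial_at_add monomial_at_single power_one_right)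
    thus ?thesis
      by (simp add: mpeval_single ac_simps)
  qed (simp add: mpeval_single)
  have deg: "(\<Sum>i\<in>UNIV. of_nat (Poly_Mapping.lookup m i)) = (of_nat d :: 'a)"
    if "m \<in> Poly_Mapping.keys F" for m
    using assms that by (simp add: form_of_degree_def flip: of_nat_sum)
  have "(\<Sum>i\<in>UNIV. v $ i * mpeval (mpderiv i F) v) =
      (\<Sum>i\<in>UNIV. \<Sum>m\<in>Poly_Mapping.keys F.
         of_nat (Poly_Mapping.lookup m i) * (Poly_Mapping.lookup F m * monomial_at v m))"
    by (simp only: mpderiv_def mpeval_sum sum_distrib_left monomial_term)
  also have "\<dots> = (\<Sum>m\<in>Poly_Mapping.keys F.
      (\<Sum>i\<in>UNIV. of_nat (Poly_Mapping.lookup m i)) * (Poly_Mapping.lookup F m * monomial_at v m))"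
    by (subst sum.swap) (simp add: sum_distrib_right)
  also have "\<dots> = of_nat d * mpeval F v"
    by (simp add: deg sum_distrib_left mpeval_def monomial_at_def)
  finally show ?thesis .
qed

text \<open>
  The expansion of a polynomial around a point to first order. Here the coefficients are again
  polynomials; their values at the point are the partial derivatives.
\<close>

lemma expand_at_point:
  fixes F :: "('n::finite, 'a::comm_ring_1) mpoly"
  obtains H where "F - mpconst (mpeval F v) = (\<Sum>k\<in>UNIV. H k * (mpvar k - mpconst (v $ k)))"
    and "\<And>j. mpeval (H j) v = mpeval (mpderiv j F) v"
proof -
  have "\<exists>H. F - mpconst (mpeval F v) = (\<Sum>k\<in>UNIV. H k * (mpvar k - mpconst (v $ k)))"
  proof (induction F rule: mpoly_ring_induct)
    case (const a)
    show ?case by (rule exI[of _ "\<lambda>_. 0"]) simp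
  next
    case (var i)
    have "(\<Sum>k\<in>UNIV. (if k = i then 1 else 0) * (mpvar k - mpconst (v $ k))) =
        mpvar i - mpconst (v $ i)"
      by (subst sum.cong[OF refl, of _ _ "\<lambda>k. if k = i then mpvar k - mpconst (v $ k) else 0"]) auto
    thus ?case by (intro exI[of _ "\<lambda>k. if k = i then 1 else 0"]) simp
  next
    case (add F G)
    from add.IH(1) obtain H where
      H: "F - mpconst (mpeval F v) = (\<Sum>k\<in>UNIV. H k * (mpvar k - mpconst (v $ k)))" ..
    from add.IH(2) obtain H' where
      H': "G - mpconst (mpeval G v) = (\<Sum>k\<in>UNIV. H' k * (mpvar k - mpconst (v $ k)))" ..
    have const: "mpconst (mpeval (F + G) v) = mpconst (mpeval F v) + (mpconst (mpeval G v) :: ('n, 'a) mpoly)"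
      by (simp add: mpconst_def mpeval_add single_add)
    have "F + G - mpconst (mpeval (F + G) v) =
        (F - mpconst (mpeval F v)) + (G - mpconst (mpeval G v))"
      unfolding const by (rule add_diff_add)
    also have "\<dots> = (\<Sum>k\<in>UNIV. (H k + H' k) * (mpvar k - mpconst (v $ k)))"
      by (simp only: H H' distrib_right sum.distrib)
    finally show ?case by (rule exI[of _ "\<lambda>k. H k + H' k"])
  next
    case (mult F G)
    from mult.IH(1) obtain H where
      H: "F - mpconst (mpeval F v) = (\<Sum>k\<in>UNIV. H k * (mpvar k - mpconst (v $ k)))" ..
    from mult.IH(2) obtain H' where
      H': "G - mpconst (mpeval G v) = (\<Sum>k\<in>UNIV. H' k * (mpvar k - mpconst (v $ k)))" ..
    have const: "mpconst (mpeval (F * G) v) = mpconst (mpeval F v) * (mpconst (mpeval G v) :: ('n, 'a) mpoly)"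
      by (simp add: mpconst_def mpeval_mult mult_single)
    have "F * G - mpconst (mpeval (F * G) v) =
        mpconst (mpeval G v) * (F - mpconst (mpeval F v)) + F * (G - mpconst (mpeval G v))"
      unfolding const by (simp add: algebra_simps)
    also have "\<dots> = (\<Sum>k\<in>UNIV. (mpconst (mpeval G v) * H k + F * H' k) * (mpvar k - mpconst (v $ k)))"
      by (simp only: H H' distrib_right sum.distrib sum_distrib_left mult.assoc)
    finally show ?case by (rule exI[of _ "\<lambda>k. mpconst (mpeval G v) * H k + F * H' k"])
  qed
  then obtain H where
    H: "F - mpconst (mpeval F v) = (\<Sum>k\<in>UNIV. H k * (mpvar k - mpconst (v $ k)))" ..
  have derivative: "mpeval (H j) v = mpeval (mpderiv j F) v" for j
  proof -
    have summand: "mpeval (mpderiv j (H k * (mpvar k - mpconst (v $ k)))) v =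
        (if k = j then mpeval (H k) v else 0)" for k
      by (simp add: mpderiv_mult mpderiv_diff mpderiv_mpvar mpeval_add mpeval_mult mpeval_diff)
    have "mpeval (mpderiv j F) v = mpeval (mpderiv j (F - mpconst (mpeval F v))) v"
      by (simp add: mpderiv_diff)
    also have "\<dots> = (\<Sum>k\<in>UNIV. if k = j then mpeval (H k) v else 0)"
      by (simp only: H mpderiv_sum mpeval_sum summand)
    finally show ?thesis by simp
  qed
  show ?thesis by (rule that[OF H derivative])
qed

section \<open>Places\<close>

definition is_subring :: "'o::comm_ring_1 set \<Rightarrow> bool" where
  "is_subring B \<longleftrightarrow> 1 \<in> B \<and> (\<forall>a\<in>B. \<forall>b\<in>B. a - b \<in> B \<and> a * b \<in> B)"

definition is_proper_ideal :: "'o::comm_ring_1 set \<Rightarrow> 'o set \<Rightarrow> bool" where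
  "is_proper_ideal B N \<longleftrightarrow>
     N \<subseteq> B \<and> 0 \<in> N \<and> (\<forall>a\<in>N. \<forall>b\<in>N. a + b \<in> N) \<and> (\<forall>a\<in>N. \<forall>b\<in>B. a * b \<in> N) \<and> 1 \<notin> N"

text \<open>A place is a valuation ring \<open>B\<close> of the field together with its maximal ideal \<open>N\<close>.\<close>

definition is_place :: "'o::field set \<Rightarrow> 'o set \<Rightarrow> bool" where
  "is_place B N \<longleftrightarrow>
     is_subring B \<and> is_proper_ideal B N \<and>
     (\<forall>h. h \<notin> B \<longrightarrow> inverse h \<in> N) \<and> (\<forall>h\<in>B - N. inverse h \<in> B)"

lemma subring_closed:
  assumes "is_subring B"
  shows "1 \<in> B" "0 \<in> B" "a \<in> B \<Longrightarrow> b \<in> B \<Longrightarrow> a + b \<in> B" "a \<in> B \<Longrightarrow> b \<in> B \<Longrightarrow> a - b \<in> B"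
    "a \<in> B \<Longrightarrow> - a \<in> B" "a \<in> B \<Longrightarrow> b \<in> B \<Longrightarrow> a * b \<in> B"
proof -
  note * = assms[unfolded is_subring_def]
  show one: "1 \<in> B" using * by blast
  show diff: "a \<in> B \<Longrightarrow> b \<in> B \<Longrightarrow> a - b \<in> B" for a b using * by blast
  show "a \<in> B \<Longrightarrow> b \<in> B \<Longrightarrow> a * b \<in> B" using * by blast
  show zero: "0 \<in> B" using diff[OF one one] by simp
  show uminus: "a \<in> B \<Longrightarrow> - a \<in> B" for a using diff[OF zero, of a] by simp
  show "a \<in> B \<Longrightarrow> b \<in> B \<Longrightarrow> a + b \<in> B" using diff[of a "- b"] uminus[of b] by simp
qed

lemma subring_power: "is_subring B \<Longrightarrow> a \<in> B \<Longrightarrow> a ^ n \<in> B"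
  by (induction n) (auto simp: subring_closed)

lemma subring_sum: "is_subring B \<Longrightarrow> (\<And>x. x \<in> A \<Longrightarrow> f x \<in> B) \<Longrightarrow> sum f A \<in> B"
  by (induction A rule: infinite_finite_induct) (auto simp: subring_closed)

lemma subring_prod: "is_subring B \<Longrightarrow> (\<And>x. x \<in> A \<Longrightarrow> f x \<in> B) \<Longrightarrow> prod f A \<in> B"
  by (induction A rule: infinite_finite_induct) (auto simp: subring_closed)

lemma proper_ideal_closed:
  assumes "is_proper_ideal B N"
  shows "a \<in> N \<Longrightarrow> a \<in> B" "0 \<in> N" "a \<in> N \<Longrightarrow> b \<in> N \<Longrightarrow> a + b \<in> N" "a \<in> N \<Longrightarrow> b \<in> B \<Longrightarrow> a * b \<in> N"
    "b \<in> B \<Longrightarrow> a \<in> N \<Longrightarrow> b * a \<in> N" "1 \<notin> N"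
  using assms unfolding is_proper_ideal_def by (auto simp: mult.commute)

lemma proper_ideal_uminus:
  "is_subring B \<Longrightarrow> is_proper_ideal B N \<Longrightarrow> a \<in> N \<Longrightarrow> - a \<in> N"
  using proper_ideal_closed(4)[of B N a "- 1"] by (simp add: subring_closed)

lemma proper_ideal_sum:
  "is_proper_ideal B N \<Longrightarrow> (\<And>x. x \<in> A \<Longrightarrow> f x \<in> N) \<Longrightarrow> sum f A \<in> N"
  by (induction A rule: infinite_finite_induct) (auto simp: proper_ideal_closed)

subsection \<open>Existence of places\<close>

definition coeffs_in :: "'o::comm_ring_1 set \<Rightarrow> 'o poly \<Rightarrow> bool" where
  "coeffs_in N p \<longleftrightarrow> (\<forall>i. coeff p i \<in> N)"

lemma coeffs_in_mult:
  assumes "is_subring B" "is_proper_ideal B N \<or> N = B" "coeffs_in N p" "coeffs_in B q"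
  shows "coeffs_in N (p * q)"
proof -
  have product: "coeff p i * coeff q j \<in> N" for i j
    using assms unfolding coeffs_in_def by (auto intro: subring_closed proper_ideal_closed(4))
  from assms(2) show ?thesis
    unfolding coeffs_in_def coeff_mult
    by (elim disjE) (auto intro!: product subring_sum[OF assms(1)] proper_ideal_sum[of B N])
qed

text \<open>
  A subring with a proper ideal that cannot both be enlarged is a valuation ring with its maximal
  ideal.
\<close>

locale maximal_pair =
  fixes B N :: "'o::field set"
  assumes subring: "is_subring B" and ideal: "is_proper_ideal B N"
    and maximal: "\<And>B' N'. is_subring B' \<Longrightarrow> is_proper_ideal B' N' \<Longrightarrow> B \<subseteq> B' \<Longrightarrow> N \<subseteq> N' \<Longrightarrow>
                    B' = B \<and> N' = N"
begin

lemmas closed = subring_closed[OF subring] proper_ideal_closed[OF ideal]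

text \<open>The localization at \<open>1 + N\<close> is not larger.\<close>

lemma inverse_one_minus:
  assumes "n \<in> N"
  shows "inverse (1 - n) \<in> B"
proof -
  define Q where "Q S = {a / (1 - m) | a m. a \<in> S \<and> m \<in> N}" for S :: "'o set"
  have nz: "1 - m \<noteq> 0" if "m \<in> N" for m
    using that closed(12) by auto
  have Q_contains: "S \<subseteq> Q S" for S
    using closed(8) unfolding Q_def by (force intro: exI[of _ 0])
  have denom: "(1 - m) * (1 - m') = 1 - (m + m' * (1 - m))" for m m' :: 'o
    by (simp add: algebra_simps)
  have denom_in: "m + m' * (1 - m) \<in> N" if "m \<in> N" "m' \<in> N" for m m'
    using that closed by auto
  have diff_in: "x - y \<in> Q S"
    if "x \<in> Q S" "y \<in> Q S" and S: "\<And>a b. a \<in> S \<Longrightarrow> b \<in> B \<Longrightarrow> a * b \<in> S" "\<And>a b. a \<in> S \<Longrightarrow> b \<in> S \<Longrightarrow> a - b \<in> S"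
    for x y S
  proof -
    from that obtain a m b m' where *: "x = a / (1 - m)" "y = b / (1 - m')" "a \<in> S" "b \<in> S" "m \<in> N" "m' \<in> N"
      unfolding Q_def by blast
    have "x - y = (a * (1 - m') - b * (1 - m)) / (1 - (m + m' * (1 - m)))"
      using * nz[of m] nz[of m'] unfolding denom[symmetric] by (simp add: diff_frac_eq)
    moreover have "a * (1 - m') - b * (1 - m) \<in> S"
      using * S closed by auto
    ultimately show ?thesis
      unfolding Q_def using denom_in * by blast
  qed
  have mult_in: "x * y \<in> Q S"
    if "x \<in> Q S" "y \<in> Q B" and S: "\<And>a b. a \<in> S \<Longrightarrow> b \<in> B \<Longrightarrow> a * b \<in> S" for x y S
  proof -
    from that obtain a m b m' where *: "x = a / (1 - m)" "y = b / (1 - m')" "a \<in> S" "b \<in> B" "m \<in> N" "m' \<in> N"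
      unfolding Q_def by blast
    have "x * y = (a * b) / (1 - (m + m' * (1 - m)))"
      using * unfolding denom[symmetric] by simp
    thus ?thesis
      unfolding Q_def using denom_in * S by blast
  qed
  have diffN: "a \<in> N \<Longrightarrow> b \<in> N \<Longrightarrow> a - b \<in> N" for a b
    using closed(9)[of a "- b"] proper_ideal_uminus[OF subring ideal, of b] by simp
  have "is_subring (Q B)"
    unfolding is_subring_def using diff_in[of _ B] mult_in[of _ B] Q_contains[of B] closed by blast
  moreover have "is_proper_ideal (Q B) (Q N)"
    unfolding is_proper_ideal_def
  proof (intro conjI ballI)
    show "Q N \<subseteq> Q B" unfolding Q_def using closed(7) by blast
    show "0 \<in> Q N" using Q_contains[of N] closed(8) by blast
    fix x y assume xy: "x \<in> Q N" "y \<in> Q N"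
    have "0 - y \<in> Q N"
      using diff_in[of 0 N y] xy \<open>0 \<in> Q N\<close> closed diffN by blast
    from diff_in[OF xy(1) this] closed diffN show "x + y \<in> Q N" by simp
  next
    fix x y assume "x \<in> Q N" "y \<in> Q B"
    thus "x * y \<in> Q N" using mult_in[of x N y] closed by blast
  next
    show "1 \<notin> Q N"
    proof
      assume "1 \<in> Q N"
      then obtain a m where "1 = a / (1 - m)" "a \<in> N" "m \<in> N" unfolding Q_def by blast
      hence "a + m = 1" using nz[of m] by (simp add: field_simps)
      thus False using closed(9)[OF \<open>a \<in> N\<close> \<open>m \<in> N\<close>] closed(12) by simp
    qed
  qed
  ultimately have "Q B = B"
    using maximal[of "Q B" "Q N"] Q_contains by blast
  moreover have "inverse (1 - n) \<in> Q B"
    unfolding Q_def using assms closed(1) by (auto simp: inverse_eq_divide)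
  ultimately show ?thesis by simp
qed

text \<open>
  Otherwise the ideal generated by \<open>N\<close> and \<open>h\<close> would be a larger proper ideal.
\<close>

lemma inverse_in:
  assumes "h \<in> B" "h \<notin> N"
  shows "inverse h \<in> B"
proof -
  define N' where "N' = {n + h * b | n b. n \<in> N \<and> b \<in> B}"
  have "N \<subseteq> N'" unfolding N'_def using closed(2) by force
  have "h \<in> N'" unfolding N'_def using closed(1,8) by force
  have "1 \<in> N'"
  proof (rule ccontr)
    assume "1 \<notin> N'"
    have "is_proper_ideal B N'"
      unfolding is_proper_ideal_def
    proof (intro conjI ballI)
      show "N' \<subseteq> B" unfolding N'_def using assms closed by auto
      show "0 \<in> N'" using \<open>N \<subseteq> N'\<close> closed(8) by blast
      show "1 \<notin> N'" by fact
    next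
      fix x y assume "x \<in> N'" "y \<in> N'"
      then obtain n b m d where "x = n + h * b" "y = m + h * d" "n \<in> N" "b \<in> B" "m \<in> N" "d \<in> B"
        unfolding N'_def by blast
      moreover from this have "x + y = (n + m) + h * (b + d)" "n + m \<in> N" "b + d \<in> B"
        by (simp_all add: closed(3,9) algebra_simps)
      ultimately show "x + y \<in> N'" unfolding N'_def by blast
    next
      fix x y assume "x \<in> N'" "y \<in> B"
      then obtain n b where "x = n + h * b" "n \<in> N" "b \<in> B" unfolding N'_def by blast
      moreover from this \<open>y \<in> B\<close> have "x * y = n * y + h * (b * y)" "n * y \<in> N" "b * y \<in> B"
        by (simp_all add: closed(6,10) algebra_simps)
      ultimately show "x * y \<in> N'" unfolding N'_def by blast
    qed
    hence "N' = N" using maximal[OF subring, of N'] \<open>N \<subseteq> N'\<close> by blast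
    with \<open>h \<in> N'\<close> assms show False by simp
  qed
  then obtain n b where *: "1 = n + h * b" "n \<in> N" "b \<in> B" unfolding N'_def by blast
  hence "1 - n = h * b" by (simp add: algebra_simps)
  moreover have "1 - n \<noteq> 0" using * closed(12) by auto
  ultimately have "inverse h = b * inverse (1 - n)" by simp
  thus ?thesis using * closed inverse_one_minus by simp
qed

text \<open>
  Otherwise \<open>N[y]\<close> would be a proper ideal of \<open>B[y]\<close>, enlarging the pair.
\<close>

lemma relation_if_not_in:
  assumes "y \<notin> B"
  shows "\<exists>p. coeffs_in N p \<and> poly p y = 1"
proof (rule ccontr)
  assume no: "\<nexists>p. coeffs_in N p \<and> poly p y = 1"
  define E where "E S = {poly p y | p. coeffs_in S p}" for S
  have EI: "poly p y \<in> E S" if "coeffs_in S p" for p S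
    unfolding E_def using that by blast
  have EE: "\<exists>p. coeffs_in S p \<and> x = poly p y" if "x \<in> E S" for x S
    using that unfolding E_def by blast
  have const: "x \<in> E S" if "x \<in> S" "0 \<in> S" for x S
    using that EI[of S "[:x:]"] by (auto simp: coeffs_in_def coeff_pCons split: nat.split)
  have "is_subring (E B)"
    unfolding is_subring_def
  proof (intro conjI ballI)
    show "1 \<in> E B" using const[of 1 B] closed(1,2) by simp
    fix a b assume "a \<in> E B" "b \<in> E B"
    then obtain p q where pq: "a = poly p y" "b = poly q y" "coeffs_in B p" "coeffs_in B q"
      using EE by metis
    have "coeffs_in B (p * q)" using coeffs_in_mult[OF subring] pq by blast
    moreover have "coeffs_in B (p - q)"
      using pq by (simp add: coeffs_in_def closed(4))
    ultimately show "a - b \<in> E B" "a * b \<in> E B"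
      using EI[of B "p - q"] EI[of B "p * q"] pq by simp_all
  qed
  moreover have "is_proper_ideal (E B) (E N)"
    unfolding is_proper_ideal_def
  proof (intro conjI ballI)
    show "E N \<subseteq> E B" unfolding E_def coeffs_in_def using closed(7) by blast
    show "0 \<in> E N" using const[of 0 N] closed(8) by simp
    show "1 \<notin> E N" using no EE[of 1 N] by metis
  next
    fix a b assume "a \<in> E N" "b \<in> E N"
    then obtain p q where pq: "a = poly p y" "b = poly q y" "coeffs_in N p" "coeffs_in N q"
      using EE by metis
    have "coeffs_in N (p + q)" using pq by (simp add: coeffs_in_def closed(9))
    thus "a + b \<in> E N" using EI[of N "p + q"] pq by simp
  next
    fix a b assume "a \<in> E N" "b \<in> E B"
    then obtain p q where pq: "a = poly p y" "b = poly q y" "coeffs_in N p" "coeffs_in B q"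
      using EE by metis
    have "coeffs_in N (p * q)" using coeffs_in_mult[OF subring] ideal pq by blast
    thus "a * b \<in> E N" using EI[of N "p * q"] pq by simp
  qed
  moreover have "B \<subseteq> E B" "N \<subseteq> E N" using const closed(2,8) by blast+
  ultimately have "E B = B" using maximal by blast
  moreover have "y \<in> E B"
    using EI[of B "[:0, 1:]"] closed(1,2) by (simp add: coeffs_in_def coeff_pCons split: nat.split)
  ultimately show False using assms by simp
qed

text \<open>
  The constant coefficient of \<open>q\<close> lies in \<open>N\<close>, so its difference from \<open>1\<close> is a unit. This makes
  the relation for \<open>1/y\<close> a substitution rule for high powers of \<open>y\<close>.
\<close>

lemma lower_degree_relation:
  assumes p: "coeffs_in N p" "poly p y = 1" and q: "coeffs_in N q" "poly q (inverse y) = 1"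
    and "y \<noteq> 0" "degree q \<le> degree p"
  shows "\<exists>p'. coeffs_in N p' \<and> poly p' y = 1 \<and> degree p' < degree p"
proof -
  define m n where "m = degree q" and "n = degree p"
  have "degree p \<noteq> 0"
  proof
    assume "degree p = 0"
    then obtain a where "p = [:a:]" by (rule degree_eq_zeroE)
    hence "coeff p 0 = 1" using p by simp
    thus False using p closed(12) unfolding coeffs_in_def by metis
  qed
  hence "n > 0" by (simp add: n_def)
  have "m \<le> n" using assms by (simp add: m_def n_def)
  define v where "v = inverse (1 - coeff q 0)"
  have v: "v \<in> B" "v * (1 - coeff q 0) = 1"
    using inverse_one_minus[of "coeff q 0"] q closed(12) unfolding v_def coeffs_in_def
    by (auto simp: field_simps) (metis eq_iff_diff_eq_0 left_inverse)
  \<comment> \<open>The relation \<open>q(1/y) = 1\<close>, multiplied by \<open>y^m\<close>, expresses \<open>y^m\<close> by lower powers.\<close>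
  define r where "r = (\<Sum>j\<in>{1..m}. monom (coeff q j) (m - j))"
  have r_in: "coeffs_in N r"
    unfolding r_def coeffs_in_def coeff_sum using q closed(8)
    by (auto intro!: proper_ideal_sum[OF ideal] simp: coeffs_in_def)
  have r_deg: "degree r \<le> m - 1"
    unfolding r_def by (rule degree_sum_le) (auto intro!: order.trans[OF degree_monom_le])
  have r_eval: "poly r y = y ^ m * (1 - coeff q 0)"
  proof -
    have "poly q (inverse y) = (\<Sum>j\<le>m. coeff q j * inverse y ^ j)"
      by (simp add: poly_altdef m_def)
    also have "\<dots> = coeff q 0 + (\<Sum>j\<in>{1..m}. coeff q j * inverse y ^ j)"
      by (simp add: atMost_atLeast0 sum.atLeast_Suc_atMost)
    finally have *: "1 - coeff q 0 = (\<Sum>j\<in>{1..m}. coeff q j * inverse y ^ j)"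
      using q by (simp add: algebra_simps)
    have "y ^ m * (1 - coeff q 0) = (\<Sum>j\<in>{1..m}. coeff q j * (y ^ m * inverse y ^ j))"
      unfolding * sum_distrib_left by (rule sum.cong) (simp_all add: mult.left_commute)
    also have "\<dots> = (\<Sum>j\<in>{1..m}. coeff q j * y ^ (m - j))"
      using \<open>y \<noteq> 0\<close> by (intro sum.cong) (auto simp: power_diff power_inverse field_simps)
    finally show ?thesis by (simp add: r_def poly_sum poly_monom)
  qed
  define p' where "p' = (p - monom (coeff p n) n) + smult (coeff p n * v) (monom 1 (n - m) * r)"
  have "coeff p n * v * coeff r i \<in> N" for i
    using p r_in v closed unfolding coeffs_in_def by auto
  moreover have "coeff (monom 1 (n - m) * r) i = (if n - m \<le> i then coeff r (i - (n - m)) else 0)" for i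
    by (simp add: coeff_monom_mult)
  ultimately have "coeffs_in N p'"
    unfolding p'_def coeffs_in_def using p closed unfolding coeffs_in_def
    by (auto simp: coeff_monom_mult intro!: closed(9))
  moreover have "poly p' y = 1"
  proof -
    have "poly p' y = poly p y - coeff p n * y ^ n + coeff p n * (v * (1 - coeff q 0)) * (y ^ (n - m) * y ^ m)"
      unfolding p'_def by (simp add: poly_monom r_eval algebra_simps)
    thus ?thesis using \<open>m \<le> n\<close> p by (simp add: v power_add[symmetric])
  qed
  moreover have "degree p' < n"
  proof -
    have "degree (p - monom (coeff p n) n) \<le> n - 1"
    proof (rule degree_le, intro allI impI)
      fix i assume "n - 1 < i"
      thus "coeff (p - monom (coeff p n) n) i = 0"
        using \<open>n > 0\<close> by (cases "i = n") (auto simp: n_def coeff_eq_0)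
    qed
    moreover have "degree (smult (coeff p n * v) (monom 1 (n - m) * r)) \<le> n - 1"
    proof (cases "m = 0")
      case True
      hence "r = 0" by (simp add: r_def)
      thus ?thesis by simp
    next
      case False
      have "degree (monom 1 (n - m) * r) \<le> (n - m) + (m - 1)"
        by (rule order.trans[OF degree_mult_le]) (use r_deg in \<open>auto intro!: add_mono degree_monom_le\<close>)
      thus ?thesis using False \<open>m \<le> n\<close> by (intro order.trans[OF degree_smult_le]) auto
    qed
    ultimately have "degree p' \<le> n - 1"
      unfolding p'_def by (rule degree_add_le)
    thus ?thesis using \<open>n > 0\<close> by simp
  qed
  ultimately show ?thesis unfolding n_def by blast
qed

text \<open>
  Descent on the sum of the degrees; the situation is symmetric in \<open>y\<close> and \<open>1/y\<close>.
\<close>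

lemma no_two_relations:
  assumes "coeffs_in N p" "poly p y = 1" "coeffs_in N q" "poly q (inverse y) = 1" "y \<noteq> 0"
  shows False
  using assms
proof (induction "degree p + degree q" arbitrary: p q rule: less_induct)
  case less
  show False
  proof (cases "degree q \<le> degree p")
    case True
    from lower_degree_relation[OF less.prems True] less.hyps less.prems show False
      by (metis add_less_cancel_right)
  next
    case False
    with lower_degree_relation[of q "inverse y" p] less.hyps less.prems show False
      by (metis add_less_cancel_left inverse_inverse_eq linorder_linear nonzero_imp_inverse_nonzero)
  qed
qed

lemma is_place: "is_place B N"
  unfolding is_place_def
proof (intro conjI allI impI ballI subring ideal)
  fix h assume h: "h \<notin> B"
  hence "h \<noteq> 0" using closed(2) by blast
  have "inverse h \<in> B"
    using relation_if_not_in[OF h] relation_if_not_in[of "inverse h"] no_two_relations \<open>h \<noteq> 0\<close> by blast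
  thus "inverse h \<in> N"
    using inverse_in[of "inverse h"] h by auto
qed (use inverse_in in blast)

end

text \<open>Chevalley's extension theorem, from Zorn's lemma.\<close>

theorem place_exists:
  fixes A M :: "'o::field set"
  assumes "is_subring A" "is_proper_ideal A M"
  obtains B N where "is_place B N" "A \<subseteq> B" "M \<subseteq> N"
proof -
  define S where "S = {(B :: 'o set, N). is_subring B \<and> is_proper_ideal B N \<and> A \<subseteq> B \<and> M \<subseteq> N}"
  define P where "P = (\<lambda>(B :: 'o set, N :: 'o set) (B', N'). B \<subseteq> B' \<and> N \<subseteq> N')"
  have "\<exists>m\<in>S. \<forall>a\<in>S. P m a \<longrightarrow> a = m"
  proof (rule predicate_Zorn)
    show "partial_order_on S (relation_of P S)"
      by (rule partial_order_on_relation_ofI) (auto simp: P_def)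
  next
    fix C assume "C \<in> Chains (relation_of P S)"
    hence sub: "C \<subseteq> S" and chain: "\<And>a b. a \<in> C \<Longrightarrow> b \<in> C \<Longrightarrow> P a b \<or> P b a"
      by (auto simp: Chains_def relation_of_def)
    show "\<exists>u\<in>S. \<forall>a\<in>C. P a u"
    proof (cases "C = {}")
      case True
      have "(A, M) \<in> S" using assms by (simp add: S_def)
      thus ?thesis using True by blast
    next
      case False
      define U V where "U = (\<Union>c\<in>C. fst c)" and "V = (\<Union>c\<in>C. snd c)"
      have C: "is_subring (fst c)" "is_proper_ideal (fst c) (snd c)" "A \<subseteq> fst c" "M \<subseteq> snd c" if "c \<in> C" for c
        using subsetD[OF sub that] by (auto simp: S_def case_prod_beta)
      have common: "\<exists>c\<in>C. fst a \<subseteq> fst c \<and> fst b \<subseteq> fst c \<and> snd a \<subseteq> snd c \<and> snd b \<subseteq> snd c"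
        if "a \<in> C" "b \<in> C" for a b
        using chain[OF that] that by (elim disjE) (auto simp: P_def case_prod_beta)
      obtain c0 where c0: "c0 \<in> C" using False by blast
      have "is_subring U"
        unfolding is_subring_def
      proof (intro conjI ballI)
        show "1 \<in> U" unfolding U_def using c0 subring_closed(1)[OF C(1)[OF c0]] by (intro UN_I)
        fix x y assume "x \<in> U" "y \<in> U"
        from \<open>x \<in> U\<close> obtain a where a: "a \<in> C" "x \<in> fst a"
          unfolding U_def by (rule UN_E)
        from \<open>y \<in> U\<close> obtain b where b: "b \<in> C" "y \<in> fst b"
          unfolding U_def by (rule UN_E)
        from common[OF a(1) b(1)] obtain c where "c \<in> C"
          and le: "fst a \<subseteq> fst c" "fst b \<subseteq> fst c" "snd a \<subseteq> snd c" "snd b \<subseteq> snd c"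
          by (elim bexE conjE) (rule that)
        hence c: "c \<in> C" "x \<in> fst c" "y \<in> fst c"
          using subsetD[OF le(1) a(2)] subsetD[OF le(2) b(2)] by simp_all
        show "x - y \<in> U" "x * y \<in> U"
          unfolding U_def using c subring_closed(4,6)[OF C(1)[OF c(1)] c(2,3)] by (auto intro: UN_I)
      qed
      moreover have "is_proper_ideal U V"
        unfolding is_proper_ideal_def
      proof (intro conjI ballI)
        show "V \<subseteq> U" unfolding U_def V_def by (rule UN_mono) (auto dest: C(2) proper_ideal_closed(1))
        show "0 \<in> V" unfolding V_def using c0 proper_ideal_closed(2)[OF C(2)[OF c0]] by (intro UN_I)
        show "1 \<notin> V" unfolding V_def by (auto dest: C(2) proper_ideal_closed(6))
      next
        fix x y assume "x \<in> V" "y \<in> V"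
        from \<open>x \<in> V\<close> obtain a where a: "a \<in> C" "x \<in> snd a"
          unfolding V_def by (rule UN_E)
        from \<open>y \<in> V\<close> obtain b where b: "b \<in> C" "y \<in> snd b"
          unfolding V_def by (rule UN_E)
        from common[OF a(1) b(1)] obtain c where "c \<in> C"
          and le: "fst a \<subseteq> fst c" "fst b \<subseteq> fst c" "snd a \<subseteq> snd c" "snd b \<subseteq> snd c"
          by (elim bexE conjE) (rule that)
        hence c: "c \<in> C" "x \<in> snd c" "y \<in> snd c"
          using subsetD[OF le(3) a(2)] subsetD[OF le(4) b(2)] by simp_all
        show "x + y \<in> V"
          unfolding V_def using c proper_ideal_closed(3)[OF C(2)[OF c(1)] c(2,3)] by (auto intro: UN_I)
      next
        fix x y assume "x \<in> V" "y \<in> U"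
        from \<open>x \<in> V\<close> obtain a where a: "a \<in> C" "x \<in> snd a"
          unfolding V_def by (rule UN_E)
        from \<open>y \<in> U\<close> obtain b where b: "b \<in> C" "y \<in> fst b"
          unfolding U_def by (rule UN_E)
        from common[OF a(1) b(1)] obtain c where "c \<in> C"
          and le: "fst a \<subseteq> fst c" "fst b \<subseteq> fst c" "snd a \<subseteq> snd c" "snd b \<subseteq> snd c"
          by (elim bexE conjE) (rule that)
        hence c: "c \<in> C" "x \<in> snd c" "y \<in> fst c"
          using subsetD[OF le(3) a(2)] subsetD[OF le(2) b(2)] by simp_all
        show "x * y \<in> V"
          unfolding V_def using c proper_ideal_closed(4)[OF C(2)[OF c(1)] c(2,3)] by (auto intro: UN_I)
      qed
      moreover have "A \<subseteq> U" "M \<subseteq> V"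
        unfolding U_def V_def using c0 C(3,4)[OF c0] by auto
      ultimately have "(U, V) \<in> S" by (simp add: S_def)
      moreover have "P a (U, V)" if "a \<in> C" for a
        using that by (auto simp: P_def U_def V_def split: prod.splits)
      ultimately show ?thesis by blast
    qed
  qed
  then obtain m where m: "m \<in> S" "\<forall>a\<in>S. P m a \<longrightarrow> a = m" ..
  obtain B N where "m = (B, N)" by (cases m)
  with m have BN: "(B, N) \<in> S" "\<And>a. a \<in> S \<Longrightarrow> P (B, N) a \<Longrightarrow> a = (B, N)" by simp_all
  have "maximal_pair B N"
  proof
    fix B' N' assume "is_subring B'" "is_proper_ideal B' N'" "B \<subseteq> B'" "N \<subseteq> N'"
    hence "(B', N') \<in> S" "P (B, N) (B', N')" using BN(1) by (auto simp: S_def P_def)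
    thus "B' = B \<and> N' = N" using BN(2) by blast
  qed (use BN(1) in \<open>auto simp: S_def\<close>)
  thus ?thesis
    using that[of B N] maximal_pair.is_place BN(1) by (auto simp: S_def)
qed

section \<open>Function fields and centers of places\<close>

definition algebraically_dependent :: "('k::field \<Rightarrow> 'o::field) \<Rightarrow> 'o \<Rightarrow> 'o \<Rightarrow> bool" where
  "algebraically_dependent \<iota> h u \<longleftrightarrow>
     (\<exists>d c. (\<exists>i\<le>d. \<exists>j\<le>d. c i j \<noteq> 0) \<and> (\<Sum>i\<le>d. \<Sum>j\<le>d. \<iota> (c i j) * h ^ i * u ^ j) = 0)"

definition hpoly :: "('k::comm_ring_1 \<Rightarrow> 'o::comm_ring_1) \<Rightarrow> 'k poly \<Rightarrow> 'o \<Rightarrow> 'o" where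
  "hpoly \<iota> p h = poly (map_poly \<iota> p) h"

context comm_ring_hom
begin

lemma hpoly_0 [simp]: "hpoly hom 0 h = 0"
  by (simp add: hpoly_def)

lemma hpoly_pCons [simp]: "hpoly hom (pCons a p) h = hom a + h * hpoly hom p h"
proof -
  have "map_poly hom (pCons a p) = pCons (hom a) (map_poly hom p)"
    by (rule poly_eqI) (simp add: coeff_map_poly coeff_pCons split: nat.split)
  thus ?thesis by (simp add: hpoly_def)
qed

lemma hpoly_1 [simp]: "hpoly hom 1 h = 1"
  by (simp add: one_pCons)

lemma hpoly_add: "hpoly hom (p + q) h = hpoly hom p h + hpoly hom q h"
  by (induction p q rule: poly_induct2) (simp_all add: hom_add algebra_simps)

lemma hpoly_smult: "hpoly hom (smult a p) h = hom a * hpoly hom p h"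
  by (induction p) (simp_all add: hom_mult algebra_simps)

lemma hpoly_mult: "hpoly hom (p * q) h = hpoly hom p h * hpoly hom q h"
  by (induction p) (simp_all add: hpoly_add hpoly_smult algebra_simps)

lemma hpoly_uminus: "hpoly hom (- p) h = - hpoly hom p h"
  using hpoly_smult[of "- 1" p h] by (simp add: hom_uminus)

lemma hpoly_diff: "hpoly hom (p - q) h = hpoly hom p h - hpoly hom q h"
  using hpoly_add[of p "- q" h] by (simp add: hpoly_uminus)

lemma hpoly_sum: "hpoly hom (\<Sum>x\<in>A. f x) h = (\<Sum>x\<in>A. hpoly hom (f x) h)"
  by (induction A rule: infinite_finite_induct) (simp_all add: hpoly_add)

lemma hpoly_monom: "hpoly hom (monom a n) h = hom a * h ^ n"
  by (induction n) (simp_all add: monom_0 monom_Suc algebra_simps)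

lemma hpoly_power: "hpoly hom (p ^ n) h = hpoly hom p h ^ n"
  by (induction n) (simp_all add: hpoly_mult)

lemma hpoly_in_subring:
  assumes "is_subring B" "range hom \<subseteq> B" "h \<in> B"
  shows "hpoly hom p h \<in> B"
proof -
  have "hom a \<in> B" for a using assms(2) by blast
  thus ?thesis
    using assms(3) by (induction p) (simp_all add: subring_closed[OF assms(1)])
qed

lemma hom_eval_in_subring:
  assumes "is_subring B" "range hom \<subseteq> B" "\<And>i. z $ i \<in> B"
  shows "hom_eval hom F z \<in> B"
  unfolding hom_eval_def using assms
  by (intro subring_sum subring_prod subring_closed(6) subring_power) auto

end

text \<open>
  A function field \<open>L\<close> of one variable over the constants, embedded in a field \<open>'o\<close>: any two of
  its elements are algebraically dependent. Places live on the whole of \<open>'o\<close>, so that they can be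
  pulled back along endomorphisms of \<open>'o\<close>, but only their traces on \<open>L\<close> matter.
\<close>

locale function_field = inj_idom_hom \<iota>
  for \<iota> :: "'k::alg_closed_field \<Rightarrow> 'o::field" +
  fixes L :: "'o set"
  assumes L_subring: "is_subring L"
    and L_inverse: "h \<in> L \<Longrightarrow> inverse h \<in> L"
    and const_in_L: "\<iota> a \<in> L"
    and dependent: "h \<in> L \<Longrightarrow> u \<in> L \<Longrightarrow> algebraically_dependent \<iota> h u"
    and nonconstant: "\<exists>x\<in>L. x \<notin> range \<iota>"
begin

lemma hom_inverse: "\<iota> (inverse a) = inverse (\<iota> a)"
proof (cases "a = 0")
  case False
  hence "\<iota> (inverse a) * \<iota> a = 1" by (simp flip: hom_mult)
  thus ?thesis by (metis inverse_unique mult.commute)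
qed simp

lemma field_hom: "field_hom \<iota>"
  by unfold_locales

text \<open>
  A relation between \<open>h\<close> and \<open>u\<close> is a polynomial in \<open>u\<close> with coefficients in \<open>k[h]\<close>; dividing
  by the highest possible power of \<open>u\<close> makes the constant coefficient nonzero.
\<close>

lemma dependent_modulo:
  assumes "is_subring B" "range \<iota> \<subseteq> B" "h \<in> L" "u \<in> L" "h \<in> B" "u \<in> B" "u \<noteq> 0"
  obtains p r where "p \<noteq> 0" "r \<in> B" "hpoly \<iota> p h = u * r"
proof -
  from dependent[OF \<open>h \<in> L\<close> \<open>u \<in> L\<close>] obtain d c where
    nz: "\<exists>j. j \<le> d \<and> (\<exists>i\<le>d. c i j \<noteq> 0)" and
    rel: "(\<Sum>i\<le>d. \<Sum>j\<le>d. \<iota> (c i j) * h ^ i * u ^ j) = 0"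
    unfolding algebraically_dependent_def by blast
  \<comment> \<open>The lowest power of \<open>u\<close> that occurs in the relation.\<close>
  define j0 where "j0 = (LEAST j. j \<le> d \<and> (\<exists>i\<le>d. c i j \<noteq> 0))"
  have j0: "j0 \<le> d" "\<exists>i\<le>d. c i j0 \<noteq> 0"
    using LeastI_ex[OF nz] by (simp_all add: j0_def)
  have below: "c i j = 0" if "j < j0" "i \<le> d" for i j
    using not_less_Least[of j "\<lambda>j. j \<le> d \<and> (\<exists>i\<le>d. c i j \<noteq> 0)"] that j0(1) unfolding j0_def by auto
  define C where "C j = (\<Sum>i\<le>d. \<iota> (c i j) * h ^ i)" for j
  have C_in: "C j \<in> B" for j
    unfolding C_def using assms by (intro subring_sum subring_closed(6) subring_power) auto
  have C_below: "C j = 0" if "j < j0" for j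
    unfolding C_def using below that by (intro sum.neutral) simp
  define S where "S = (\<Sum>j\<in>{Suc j0..d}. C j * u ^ (j - Suc j0))"
  have "S \<in> B"
    unfolding S_def using C_in assms by (intro subring_sum subring_closed(6) subring_power) auto
  have "0 = (\<Sum>j\<le>d. C j * u ^ j)"
    using rel by (subst (asm) sum.swap) (simp add: C_def sum_distrib_right)
  also have "\<dots> = (\<Sum>j\<in>{j0..d}. C j * u ^ j)"
    by (rule sum.mono_neutral_right) (auto simp: C_below)
  also have "\<dots> = C j0 * u ^ j0 + (\<Sum>j\<in>{Suc j0..d}. C j * u ^ j)"
    using j0(1) by (simp add: sum.atLeast_Suc_atMost)
  also have "(\<Sum>j\<in>{Suc j0..d}. C j * u ^ j) = u ^ j0 * (u * S)"
    unfolding S_def sum_distrib_left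
  proof (rule sum.cong)
    fix j assume "j \<in> {Suc j0..d}"
    hence "j = j0 + Suc (j - Suc j0)" by simp
    hence "u ^ j = u ^ j0 * (u * u ^ (j - Suc j0))" by (metis power_add power_Suc)
    thus "C j * u ^ j = u ^ j0 * (u * (C j * u ^ (j - Suc j0)))" by simp
  qed simp
  finally have "u ^ j0 * (C j0 + u * S) = 0" by (simp add: algebra_simps)
  hence "C j0 = u * (- S)" using \<open>u \<noteq> 0\<close> by (simp add: add_eq_0_iff)
  also have "C j0 = hpoly \<iota> (\<Sum>i\<le>d. monom (c i j0) i) h"
    by (simp add: C_def hpoly_sum hpoly_monom)
  finally have rel': "hpoly \<iota> (\<Sum>i\<le>d. monom (c i j0) i) h = u * (- S)" .
  have nz': "(\<Sum>i\<le>d. monom (c i j0) i) \<noteq> 0"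
  proof
    assume *: "(\<Sum>i\<le>d. monom (c i j0) i) = 0"
    from j0(2) obtain i where i: "i \<le> d" "c i j0 \<noteq> 0" by blast
    have "coeff (\<Sum>i\<le>d. monom (c i j0) i) i = c i j0"
      using i by (simp add: coeff_sum)
    thus False using * i by simp
  qed
  have "- S \<in> B" using \<open>S \<in> B\<close> assms by (simp add: subring_closed)
  from that[OF nz' this rel'] show ?thesis .
qed

end

locale function_field_place = function_field \<iota> L
  for \<iota> :: "'k::alg_closed_field \<Rightarrow> 'o::field" and L +
  fixes B N :: "'o set"
  assumes place: "is_place B N" and const_in_B: "\<iota> a \<in> B"
begin

lemma subring: "is_subring B" and ideal: "is_proper_ideal B N"
  and inverse_in_ideal: "h \<notin> B \<Longrightarrow> inverse h \<in> N"
  and inverse_unit: "h \<in> B \<Longrightarrow> h \<notin> N \<Longrightarrow> inverse h \<in> B"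
  using place by (auto simp: is_place_def)

lemmas B_closed = subring_closed[OF subring]
  and N_closed = proper_ideal_closed[OF ideal] proper_ideal_uminus[OF subring ideal]

lemma N_diff: "a \<in> N \<Longrightarrow> b \<in> N \<Longrightarrow> a - b \<in> N"
  using N_closed(3)[of a "- b"] N_closed(7)[of b] by simp

lemma N_prime:
  assumes "a \<in> B" "b \<in> B" "a * b \<in> N" "a \<notin> N"
  shows "b \<in> N"
proof -
  have "a \<noteq> 0" using assms(4) N_closed(2) by blast
  hence "b = inverse a * (a * b)" by simp
  also have "\<dots> \<in> N" by (rule N_closed(5)) (use assms inverse_unit in auto)
  finally show ?thesis .
qed

lemma const_in_N: "\<iota> a \<in> N \<longleftrightarrow> a = 0"
proof
  assume *: "\<iota> a \<in> N"
  show "a = 0"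
  proof (rule ccontr)
    assume "a \<noteq> 0"
    hence "1 = \<iota> a * \<iota> (inverse a)" by (simp flip: hom_mult)
    also have "\<dots> \<in> N" by (rule N_closed(4)[OF * const_in_B])
    finally show False using N_closed(6) by simp
  qed
qed (simp add: N_closed)

lemma const_eqI: "h - \<iota> a \<in> N \<Longrightarrow> h - \<iota> b \<in> N \<Longrightarrow> a = b"
  using N_diff[of "h - \<iota> a" "h - \<iota> b"] const_in_N[of "b - a"] by (simp add: hom_minus)

lemma residue_in_B: "h - \<iota> a \<in> N \<Longrightarrow> h \<in> B"
  using B_closed(3)[of "h - \<iota> a" "\<iota> a"] N_closed(1)[of "h - \<iota> a"] const_in_B[of a] by simp

lemma residue_mult:
  assumes "g - \<iota> a \<in> N" "h - \<iota> b \<in> N"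
  shows "g * h - \<iota> (a * b) \<in> N"
proof -
  have "g * h - \<iota> (a * b) = (g - \<iota> a) * h + \<iota> a * (h - \<iota> b)"
    by (simp add: hom_mult algebra_simps)
  also have "\<dots> \<in> N"
    using assms N_closed residue_in_B[OF assms(2)] const_in_B by auto
  finally show ?thesis .
qed

lemma residue_unit: "h - \<iota> a \<in> N \<Longrightarrow> a \<noteq> 0 \<Longrightarrow> h \<notin> N"
  using N_diff[of h "h - \<iota> a"] const_in_N[of a] by auto

text \<open>
  Some linear factor of \<open>p\<close> takes a value in the prime ideal \<open>N\<close>.
\<close>

lemma root_residue:
  assumes "p \<noteq> 0" "h \<in> B" "hpoly \<iota> p h \<in> N"
  shows "\<exists>a. h - \<iota> a \<in> N"
  using assms
proof (induction "degree p" arbitrary: p)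
  case 0
  then obtain a where "p = [:a:]" "a \<noteq> 0" by (metis degree_eq_zeroE pCons_0_0)
  thus ?case using 0 const_in_N by simp
next
  case (Suc n)
  then obtain a where "poly p a = 0"
    using alg_closed_imp_poly_has_root[of p] by auto
  then obtain q where q: "p = [:- a, 1:] * q" by (metis dvdE poly_eq_0_iff_dvd)
  hence "q \<noteq> 0" using Suc.prems(1) by auto
  hence "degree p = Suc (degree q)"
    unfolding q by (subst degree_mult_eq) simp_all
  hence "degree q = n" using Suc.hyps(2) by simp
  have eval: "hpoly \<iota> p h = (h - \<iota> a) * hpoly \<iota> q h"
    unfolding q hpoly_mult by (simp add: hom_uminus)
  show ?case
  proof (cases "h - \<iota> a \<in> N")
    case False
    have "h - \<iota> a \<in> B" by (rule B_closed(4)) (fact Suc.prems(2), rule const_in_B)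
    moreover have "hpoly \<iota> q h \<in> B"
      by (rule hpoly_in_subring[OF subring image_subsetI Suc.prems(2)]) (rule const_in_B)
    ultimately have "hpoly \<iota> q h \<in> N"
      using Suc.prems(3) False unfolding eval by (rule N_prime)
    with Suc.hyps(1)[of q] Suc.prems(2) \<open>q \<noteq> 0\<close> \<open>degree q = n\<close> show ?thesis by simp
  qed blast
qed

text \<open>The residue field on \<open>L\<close> is algebraic over the constants, hence equal to them.\<close>

lemma residue_exists:
  assumes "u \<in> L" "u \<in> N" "u \<noteq> 0" "h \<in> L" "h \<in> B"
  shows "\<exists>a. h - \<iota> a \<in> N"
proof -
  obtain p r where "p \<noteq> 0" "r \<in> B" "hpoly \<iota> p h = u * r"
    using dependent_modulo[of B h u] subring const_in_B assms N_closed(1) by (metis image_subsetI)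
  thus ?thesis using root_residue[of p h] assms N_closed(4)[of u r] by simp
qed

text \<open>
  The valuation is discrete on \<open>L\<close>: modulo a unit, a nonzero polynomial in \<open>t\<close> is a power of \<open>t\<close>, and
  \<open>h\<close> divides a nonzero polynomial in \<open>t\<close>.
\<close>

lemma not_infinitely_divisible:
  assumes "t \<in> L" "t \<in> N" "t \<noteq> 0" "h \<in> L" "h \<in> B" "h \<noteq> 0"
  shows "\<exists>e. \<forall>r\<in>B. h \<noteq> t ^ e * r"
proof -
  have "t \<in> B" using assms N_closed(1) by blast
  then obtain p r where p: "p \<noteq> 0" "r \<in> B" "hpoly \<iota> p t = h * r"
    using dependent_modulo[of B t h] subring const_in_B assms by (metis image_subsetI)
  obtain q where q: "p = [:- 0, 1:] ^ order 0 p * q" "\<not> [:- 0, 1:] dvd q"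
    using order_decomp[OF p(1)] by blast
  define e where "e = order 0 p"
  have eval: "hpoly \<iota> p t = t ^ e * hpoly \<iota> q t"
    by (subst q(1)) (simp add: hpoly_mult hpoly_power e_def)
  have "coeff q 0 \<noteq> 0"
    using q(2) poly_eq_0_iff_dvd[of q 0] by (simp add: poly_0_coeff_0)
  have "hpoly \<iota> q t - \<iota> (coeff q 0) \<in> N"
  proof -
    obtain b q' where "q = pCons b q'" by (cases q)
    thus ?thesis
      using N_closed(4)[OF \<open>t \<in> N\<close>] hpoly_in_subring[OF subring _ \<open>t \<in> B\<close>] const_in_B by auto
  qed
  hence unit: "hpoly \<iota> q t \<notin> N" by (rule residue_unit) fact
  have "h \<noteq> t ^ Suc e * s" if "s \<in> B" for s
  proof
    assume "h = t ^ Suc e * s"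
    hence "t ^ e * hpoly \<iota> q t = t ^ e * (t * (s * r))" using p eval by (simp add: algebra_simps)
    hence "hpoly \<iota> q t = t * (s * r)" using \<open>t \<noteq> 0\<close> by simp
    thus False using unit N_closed(4)[OF \<open>t \<in> N\<close>] that p(2) B_closed(6) by simp
  qed
  thus ?thesis by blast
qed

end

subsection \<open>Specializations\<close>

context function_field
begin

text \<open>
  A vector \<open>\<eta>\<close> over the function field is the generic point of a projective variety; \<open>v\<close> is a
  point of that variety.
\<close>

definition specializes :: "'o ^ 'n::finite \<Rightarrow> 'k ^ 'n \<Rightarrow> bool" where
  "specializes \<eta> v \<longleftrightarrow> v \<noteq> 0 \<and> (\<forall>F. is_form F \<longrightarrow> hom_eval \<iota> F \<eta> = 0 \<longrightarrow> mpeval F v = 0)"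

text \<open>The point of projective space to which \<open>\<eta>\<close> reduces modulo the place.\<close>

definition is_center :: "'o set \<Rightarrow> 'o set \<Rightarrow> 'o ^ 'n::finite \<Rightarrow> 'k ^ 'n \<Rightarrow> bool" where
  "is_center B N \<eta> v \<longleftrightarrow> v \<noteq> 0 \<and> (\<exists>\<mu>. \<mu> \<noteq> 0 \<and> (\<forall>j. \<mu> * \<eta> $ j - \<iota> (v $ j) \<in> N))"

text \<open>The representative of \<open>\<eta>\<close> that agrees with \<open>v\<close> in the coordinate \<open>i\<close>.\<close>

definition normalized :: "'o ^ 'n::finite \<Rightarrow> 'k ^ 'n \<Rightarrow> 'n \<Rightarrow> 'o ^ 'n" where
  "normalized \<eta> v i = (\<iota> (v $ i) / \<eta> $ i) *s \<eta>"

definition generates :: "'o ^ 'n::finite \<Rightarrow> bool" where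
  "generates z \<longleftrightarrow>
     (\<forall>h\<in>L. \<exists>F G. hom_eval \<iota> G z \<noteq> 0 \<and> h = hom_eval \<iota> F z / hom_eval \<iota> G z)"

text \<open>
  The coordinate differences \<open>z\<^sub>j - v\<^sub>j\<close> are multiples of one element \<open>T(z)\<close> vanishing at \<open>v\<close>
  in the local ring of the point \<open>v\<close>.
\<close>

definition has_uniformizer :: "'o ^ 'n::finite \<Rightarrow> 'k ^ 'n \<Rightarrow> bool" where
  "has_uniformizer z v \<longleftrightarrow>
     (\<exists>T. mpeval T v = 0 \<and>
        (\<forall>j. \<exists>F G. mpeval G v \<noteq> 0 \<and>
           hom_eval \<iota> G z * (z $ j - \<iota> (v $ j)) = hom_eval \<iota> T z * hom_eval \<iota> F z))"

lemma specializes_coordinate: "specializes \<eta> v \<Longrightarrow> v $ i \<noteq> 0 \<Longrightarrow> \<eta> $ i \<noteq> 0"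
proof
  assume *: "specializes \<eta> v" "v $ i \<noteq> 0" "\<eta> $ i = 0"
  have "is_form (mpvar i :: ('a, 'k) mpoly)"
    unfolding is_form_def mpvar_def using form_of_degree_single by blast
  thus False using * unfolding specializes_def by (metis hom_eval_mpvar mpeval_mpvar)
qed

text \<open>Homogenization transfers the condition from forms to all polynomials.\<close>

lemma specializes_normalized:
  assumes "specializes \<eta> v" "v $ i \<noteq> 0" "hom_eval \<iota> F (normalized \<eta> v i) = 0"
  shows "mpeval F v = 0"
proof -
  define H where "H = homogenization i (v $ i) F"
  obtain d where d: "form_of_degree d H"
    using is_form_homogenization[of i "v $ i" F] unfolding H_def is_form_def by blast
  have nz: "\<eta> $ i \<noteq> 0" by (rule specializes_coordinate) fact+
  have "hom_eval \<iota> H (normalized \<eta> v i) = 0"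
    unfolding H_def using assms nz
    by (subst field_hom.hom_eval_homogenization[OF field_hom]) (simp_all add: normalized_def)
  hence "(\<iota> (v $ i) / \<eta> $ i) ^ d * hom_eval \<iota> H \<eta> = 0"
    unfolding normalized_def by (simp add: hom_eval_scale[OF d])
  hence "hom_eval \<iota> H \<eta> = 0" using assms nz by simp
  hence "mpeval H v = 0" using assms d unfolding specializes_def is_form_def by blast
  thus ?thesis unfolding H_def by (simp add: mpeval_homogenization assms)
qed

end

context function_field_place
begin

lemma hom_eval_residue:
  assumes "\<And>j. z $ j - \<iota> (v $ j) \<in> N"
  shows "hom_eval \<iota> F z - \<iota> (mpeval F v) \<in> N"
proof -
  obtain H where "F - mpconst (mpeval F v) = (\<Sum>k\<in>UNIV. H k * (mpvar k - mpconst (v $ k)))"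
    by (rule expand_at_point)
  hence "hom_eval \<iota> (F - mpconst (mpeval F v)) z =
      (\<Sum>k\<in>UNIV. hom_eval \<iota> (H k) z * (z $ k - \<iota> (v $ k)))"
    by (simp add: hom_eval_sum hom_eval_mult hom_eval_diff)
  also have "\<dots> \<in> N"
    using assms residue_in_B const_in_B
    by (intro proper_ideal_sum[OF ideal] N_closed(5) hom_eval_in_subring[OF subring]) auto
  finally show ?thesis by (simp add: hom_eval_diff)
qed

text \<open>
  Residues are compatible with evaluation, and a form can be evaluated at any multiple of \<open>\<eta>\<close>.
\<close>

lemma center_specializes:
  assumes "is_center B N \<eta> v"
  shows "specializes \<eta> v"
  unfolding specializes_def
proof (intro conjI allI impI)
  show "v \<noteq> 0" using assms by (simp add: is_center_def)
  fix F assume "is_form F" "hom_eval \<iota> F \<eta> = 0"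
  then obtain d where "form_of_degree d F" by (auto simp: is_form_def)
  obtain \<mu> where "\<And>j. (\<mu> *s \<eta>) $ j - \<iota> (v $ j) \<in> N"
    using assms by (auto simp: is_center_def)
  from hom_eval_residue[of "\<mu> *s \<eta>", OF this, of F] show "mpeval F v = 0"
    using \<open>hom_eval \<iota> F \<eta> = 0\<close> N_closed(7) const_in_N
    by (simp add: hom_eval_scale[OF \<open>form_of_degree d F\<close>]) fastforce
qed

lemma center_normalized:
  assumes "is_center B N \<eta> v" "v $ i \<noteq> 0"
  shows "normalized \<eta> v i $ j - \<iota> (v $ j) \<in> N"
proof -
  obtain \<mu> where \<mu>: "\<mu> \<noteq> 0" "\<And>j. \<mu> * \<eta> $ j - \<iota> (v $ j) \<in> N"
    using assms by (auto simp: is_center_def)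
  have unit: "\<mu> * \<eta> $ i \<in> B" "\<mu> * \<eta> $ i \<notin> N"
    using residue_in_B residue_unit \<mu>(2) assms(2) by blast+
  hence nz: "\<mu> * \<eta> $ i \<noteq> 0" using N_closed(2) by metis
  have "\<iota> (v $ i) * (\<mu> * \<eta> $ j) - \<iota> (v $ j) * (\<mu> * \<eta> $ i) =
      \<iota> (v $ i) * (\<mu> * \<eta> $ j - \<iota> (v $ j)) - \<iota> (v $ j) * (\<mu> * \<eta> $ i - \<iota> (v $ i))"
    by (simp add: algebra_simps)
  also have "\<dots> \<in> N" by (intro N_diff N_closed(5) const_in_B \<mu>(2))
  finally have "(\<iota> (v $ i) * (\<mu> * \<eta> $ j) - \<iota> (v $ j) * (\<mu> * \<eta> $ i)) * inverse (\<mu> * \<eta> $ i) \<in> N"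
    by (rule N_closed(4)) (use inverse_unit unit in blast)
  moreover have "(\<iota> (v $ i) * (\<mu> * \<eta> $ j) - \<iota> (v $ j) * (\<mu> * \<eta> $ i)) * inverse (\<mu> * \<eta> $ i) =
      normalized \<eta> v i $ j - \<iota> (v $ j)"
    using nz by (simp add: normalized_def field_simps)
  ultimately show ?thesis by simp
qed

text \<open>After normalization in a coordinate both centers are the residues of the same vector.\<close>

lemma center_unique:
  assumes "is_center B N \<eta> v" "is_center B N \<eta> w"
  obtains s where "s \<noteq> 0" "w = s *s v"
proof -
  obtain i where i: "v $ i \<noteq> 0"
    using assms(1) unfolding is_center_def by (metis vec_eq_iff zero_index)
  obtain \<mu> \<nu> where \<mu>: "\<And>j. \<mu> * \<eta> $ j - \<iota> (v $ j) \<in> N" and \<nu>: "\<And>j. \<nu> * \<eta> $ j - \<iota> (w $ j) \<in> N"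
    using assms unfolding is_center_def by blast
  have cross: "v $ i * w $ j = v $ j * w $ i" for j
  proof (rule const_eqI)
    show "(\<mu> * \<eta> $ i) * (\<nu> * \<eta> $ j) - \<iota> (v $ i * w $ j) \<in> N" by (rule residue_mult[OF \<mu> \<nu>])
    show "(\<mu> * \<eta> $ i) * (\<nu> * \<eta> $ j) - \<iota> (v $ j * w $ i) \<in> N"
      using residue_mult[OF \<mu> \<nu>, of j i] by (simp add: ac_simps)
  qed
  define s where "s = w $ i / v $ i"
  have w: "w = s *s v"
    using cross i by (simp add: vec_eq_iff s_def field_simps)
  hence "s \<noteq> 0"
    using assms(2) unfolding is_center_def by auto
  from that[OF this w] show ?thesis .
qed

text \<open>
  The divisibility order of a valuation ring is total, so some coordinate divides all the others.
\<close>

lemma dominant_coordinate: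
  assumes "finite S" "S \<noteq> {}" "\<And>j. j \<in> S \<Longrightarrow> \<eta> $ j \<noteq> 0"
  shows "\<exists>i\<in>S. \<forall>j\<in>S. \<eta> $ j / \<eta> $ i \<in> B"
  using assms
proof (induction rule: finite_ne_induct)
  case (singleton k)
  thus ?case by (simp add: B_closed)
next
  case (insert k S)
  then obtain i where i: "i \<in> S" "\<And>j. j \<in> S \<Longrightarrow> \<eta> $ j / \<eta> $ i \<in> B" by auto
  have nz: "\<eta> $ i \<noteq> 0" "\<eta> $ k \<noteq> 0" using insert i by auto
  show ?case
  proof (cases "\<eta> $ k / \<eta> $ i \<in> B")
    case True
    thus ?thesis using i by blast
  next
    case False
    from inverse_in_ideal[OF False] have *: "\<eta> $ i / \<eta> $ k \<in> B"
      using N_closed(1) by (simp add: inverse_eq_divide)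
    have "\<eta> $ j / \<eta> $ k \<in> B" if "j \<in> S" for j
      using B_closed(6)[OF i(2)[OF that] *] nz by simp
    thus ?thesis using nz by (auto simp: B_closed)
  qed
qed

text \<open>Projective space is complete: every place has a center.\<close>

lemma center_exists:
  assumes "u \<in> L" "u \<in> N" "u \<noteq> 0" "\<eta> \<noteq> 0" "\<And>j. \<eta> $ j \<in> L"
  obtains v where "is_center B N \<eta> v"
proof -
  have "{j. \<eta> $ j \<noteq> 0} \<noteq> {}"
    using \<open>\<eta> \<noteq> 0\<close> by (auto simp: vec_eq_iff)
  hence "\<exists>i\<in>{j. \<eta> $ j \<noteq> 0}. \<forall>j\<in>{j. \<eta> $ j \<noteq> 0}. \<eta> $ j / \<eta> $ i \<in> B"
    by (intro dominant_coordinate) simp_all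
  then obtain i where "i \<in> {j. \<eta> $ j \<noteq> 0}" "\<forall>j\<in>{j. \<eta> $ j \<noteq> 0}. \<eta> $ j / \<eta> $ i \<in> B" ..
  hence i: "\<eta> $ i \<noteq> 0" "\<And>j. \<eta> $ j \<noteq> 0 \<Longrightarrow> \<eta> $ j / \<eta> $ i \<in> B" by simp_all
  have "\<exists>a. \<eta> $ j / \<eta> $ i - \<iota> a \<in> N" for j
  proof (rule residue_exists[OF assms(1-3)])
    show "\<eta> $ j / \<eta> $ i \<in> L"
      unfolding divide_inverse by (rule subring_closed(6)[OF L_subring assms(5) L_inverse[OF assms(5)]])
    show "\<eta> $ j / \<eta> $ i \<in> B"
      using i B_closed(2) by (cases "\<eta> $ j = 0") auto
  qed
  then obtain a where a: "\<And>j. \<eta> $ j / \<eta> $ i - \<iota> (a j) \<in> N" by metis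
  have "is_center B N \<eta> (\<chi> j. a j)"
    unfolding is_center_def
  proof (intro conjI exI allI)
    have "a i \<noteq> 0" using a[of i] i(1) N_closed(6) by auto
    thus "(\<chi> j. a j) \<noteq> 0" by (auto simp: vec_eq_iff)
    show "inverse (\<eta> $ i) \<noteq> 0" using i by simp
    show "inverse (\<eta> $ i) * \<eta> $ j - \<iota> ((\<chi> j. a j) $ j) \<in> N" for j
      using a[of j] by (simp add: field_simps)
  qed
  thus ?thesis by (rule that)
qed

end

context function_field
begin

lemma hom_eval_constants: "hom_eval \<iota> F (\<chi> j. \<iota> (v $ j)) = \<iota> (mpeval F v)"
  unfolding mpeval_conv_hom_eval using hom_eval_compose[of \<iota> "\<lambda>x. x" F v] comm_ring_hom_axioms by simp

lemma generatesE:
  assumes "generates z" "h \<in> L"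
  obtains F G where "hom_eval \<iota> G z \<noteq> 0" "h = hom_eval \<iota> F z / hom_eval \<iota> G z"
proof -
  from assms have "\<exists>F G. hom_eval \<iota> G z \<noteq> 0 \<and> h = hom_eval \<iota> F z / hom_eval \<iota> G z"
    unfolding generates_def by (rule bspec)
  thus ?thesis by (elim exE conjE) (rule that)
qed

lemma generates_nonconstant:
  assumes "generates z"
  shows "\<exists>j. z $ j \<noteq> \<iota> (v $ j)"
proof (rule ccontr)
  assume "\<nexists>j. z $ j \<noteq> \<iota> (v $ j)"
  hence z: "z = (\<chi> j. \<iota> (v $ j))" by (simp add: vec_eq_iff)
  have "h \<in> range \<iota>" if h: "h \<in> L" for h
  proof -
    obtain F G where "h = hom_eval \<iota> F z / hom_eval \<iota> G z"
      by (rule generatesE[OF assms h])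
    also have "\<dots> = \<iota> (mpeval F v * inverse (mpeval G v))"
      unfolding z hom_eval_constants by (simp add: hom_mult hom_inverse divide_inverse)
    finally show ?thesis by blast
  qed
  thus False using nonconstant by blast
qed

text \<open>
  Every point of the variety is the center of a place: the polynomial functions vanishing at the
  point form a proper ideal of the coordinate ring.
\<close>

lemma place_over_point:
  assumes v: "specializes \<eta> v" and \<eta>: "\<And>j. \<eta> $ j \<in> L"
    and gen: "\<And>s. s \<noteq> 0 \<Longrightarrow> generates (s *s \<eta>)"
  obtains B N u where "function_field_place \<iota> L B N" "is_center B N \<eta> v" "u \<in> L" "u \<in> N" "u \<noteq> 0"
proof -
  obtain i where i: "v $ i \<noteq> 0"
    using v unfolding specializes_def by (metis vec_eq_iff zero_index)
  define \<mu> where "\<mu> = \<iota> (v $ i) / \<eta> $ i"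
  have \<mu>: "\<mu> \<noteq> 0" "\<mu> \<in> L"
    using i specializes_coordinate[OF v i] \<eta> const_in_L L_inverse L_subring
    unfolding \<mu>_def divide_inverse by (auto intro!: subring_closed(6))
  define z where "z = \<mu> *s \<eta>"
  have z: "z = normalized \<eta> v i" unfolding z_def \<mu>_def normalized_def ..
  define A where "A = range (\<lambda>F. hom_eval \<iota> F z)"
  define M where "M = (\<lambda>F. hom_eval \<iota> F z) ` {F. mpeval F v = 0}"
  have AI: "hom_eval \<iota> F z \<in> A" for F unfolding A_def by blast
  have MI: "hom_eval \<iota> F z \<in> M" if "mpeval F v = 0" for F unfolding M_def using that by blast
  have AE: "\<exists>F. a = hom_eval \<iota> F z" if "a \<in> A" for a using that unfolding A_def by blast
  have ME: "\<exists>F. mpeval F v = 0 \<and> a = hom_eval \<iota> F z" if "a \<in> M" for a using that unfolding M_def by blast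
  have "is_subring A"
    unfolding is_subring_def
  proof (intro conjI ballI)
    show "1 \<in> A" using AI[of 1] by simp
    fix a b assume "a \<in> A" "b \<in> A"
    then obtain F G where "a = hom_eval \<iota> F z" "b = hom_eval \<iota> G z" using AE by metis
    thus "a - b \<in> A" "a * b \<in> A"
      using AI[of "F - G"] AI[of "F * G"] by (simp_all add: hom_eval_diff hom_eval_mult)
  qed
  moreover have "is_proper_ideal A M"
    unfolding is_proper_ideal_def
  proof (intro conjI ballI)
    show "M \<subseteq> A" unfolding A_def M_def by blast
    show "0 \<in> M" using MI[of 0] by simp
    show "1 \<notin> M"
    proof
      assume "1 \<in> M"
      then obtain F where F: "mpeval F v = 0" "1 = hom_eval \<iota> F z" using ME by metis
      hence "hom_eval \<iota> (F - 1) (normalized \<eta> v i) = 0" by (simp add: hom_eval_diff flip: z)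
      hence "mpeval (F - 1) v = 0" by (rule specializes_normalized[OF v i])
      thus False using F(1) by (simp add: mpeval_diff)
    qed
  next
    fix a b assume "a \<in> M" "b \<in> M"
    then obtain F G where "a = hom_eval \<iota> F z" "b = hom_eval \<iota> G z" "mpeval F v = 0" "mpeval G v = 0"
      using ME by metis
    thus "a + b \<in> M" using MI[of "F + G"] by (simp add: hom_eval_add mpeval_add)
  next
    fix a b assume "a \<in> M" "b \<in> A"
    then obtain F G where "a = hom_eval \<iota> F z" "b = hom_eval \<iota> G z" "mpeval F v = 0"
      using ME AE by metis
    thus "a * b \<in> M" using MI[of "F * G"] by (simp add: hom_eval_mult mpeval_mult)
  qed
  ultimately obtain B N where BN: "is_place B N" "A \<subseteq> B" "M \<subseteq> N" by (rule place_exists)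
  have place: "function_field_place \<iota> L B N"
  proof
    show "is_place B N" by fact
    show "\<iota> a \<in> B" for a using subsetD[OF BN(2) AI[of "mpconst a"]] by simp
  qed
  have residue: "z $ j - \<iota> (v $ j) \<in> N" for j
    using subsetD[OF BN(3) MI[of "mpvar j - mpconst (v $ j)"]] by (simp add: hom_eval_diff mpeval_diff)
  have center: "is_center B N \<eta> v"
    unfolding is_center_def
  proof (intro conjI exI allI)
    show "v \<noteq> 0" using i by auto
    show "\<mu> \<noteq> 0" by fact
    show "\<mu> * \<eta> $ j - \<iota> (v $ j) \<in> N" for j using residue[of j] by (simp add: z_def)
  qed
  \<comment> \<open>A nonzero coordinate difference shows that the place is not trivial on \<open>L\<close>.\<close>
  obtain j where j: "z $ j \<noteq> \<iota> (v $ j)"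
    using generates_nonconstant[OF gen[OF \<mu>(1)], of v] unfolding z_def by blast
  have "z $ j - \<iota> (v $ j) \<in> L"
    using \<mu>(2) \<eta> const_in_L L_subring unfolding z_def by (auto intro!: subring_closed(4,6))
  from that[OF place center this residue] j show ?thesis by simp
qed

end

context function_field_place
begin

text \<open>
  At a point with a uniformizer \<open>t\<close>, every nonzero polynomial function is a power of \<open>t\<close> times a unit
  of the local ring. The unit is given by polynomials and does not depend on the place. Indeed a
  function vanishing at \<open>v\<close> is divisible by \<open>t\<close>, and this division cannot be repeated forever.
\<close>

lemma power_of_uniformizer:
  assumes z: "\<And>j. z $ j - \<iota> (v $ j) \<in> N" "\<And>j. z $ j \<in> L"
    and T: "mpeval T v = 0" "hom_eval \<iota> T z \<noteq> 0"
      "\<And>j. \<exists>F G. mpeval G v \<noteq> 0 \<and>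
         hom_eval \<iota> G z * (z $ j - \<iota> (v $ j)) = hom_eval \<iota> T z * hom_eval \<iota> F z"
    and F: "hom_eval \<iota> F z \<noteq> 0"
  shows "\<exists>e F' G. mpeval F' v \<noteq> 0 \<and> mpeval G v \<noteq> 0 \<and>
           hom_eval \<iota> G z * hom_eval \<iota> F z = hom_eval \<iota> T z ^ e * hom_eval \<iota> F' z"
proof (rule ccontr)
  assume no: "\<not> ?thesis"
  define t where "t = hom_eval \<iota> T z"
  define S where "S = {a. \<exists>F G. mpeval G v \<noteq> 0 \<and> hom_eval \<iota> G z * a = t * hom_eval \<iota> F z}"
  have SI: "a \<in> S" if "mpeval G v \<noteq> 0" "hom_eval \<iota> G z * a = t * hom_eval \<iota> F z" for a F G
    unfolding S_def using that by blast
  have SE: "\<exists>F G. mpeval G v \<noteq> 0 \<and> hom_eval \<iota> G z * a = t * hom_eval \<iota> F z" if "a \<in> S" for a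
    using that unfolding S_def by blast
  have S_add: "a + b \<in> S" if a: "a \<in> S" and b: "b \<in> S" for a b
  proof -
    from SE[OF a] obtain F G where 1: "mpeval G v \<noteq> 0" "hom_eval \<iota> G z * a = t * hom_eval \<iota> F z" by blast
    from SE[OF b] obtain F' G' where 2: "mpeval G' v \<noteq> 0" "hom_eval \<iota> G' z * b = t * hom_eval \<iota> F' z" by blast
    have "hom_eval \<iota> (G * G') z * (a + b) =
        hom_eval \<iota> G' z * (hom_eval \<iota> G z * a) + hom_eval \<iota> G z * (hom_eval \<iota> G' z * b)"
      by (simp add: hom_eval_mult algebra_simps)
    also have "\<dots> = t * hom_eval \<iota> (G' * F + G * F') z"
      unfolding 1(2) 2(2) by (simp add: hom_eval_mult hom_eval_add algebra_simps)
    finally show ?thesis by (rule SI[rotated]) (simp add: mpeval_mult 1 2)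
  qed
  have S_mult: "hom_eval \<iota> H z * a \<in> S" if "a \<in> S" for a H
  proof -
    from SE[OF that] obtain F G where 1: "mpeval G v \<noteq> 0" "hom_eval \<iota> G z * a = t * hom_eval \<iota> F z" by blast
    have "hom_eval \<iota> G z * (hom_eval \<iota> H z * a) = hom_eval \<iota> H z * (hom_eval \<iota> G z * a)"
      by (simp add: algebra_simps)
    also have "\<dots> = t * hom_eval \<iota> (H * F) z"
      unfolding 1(2) by (simp add: hom_eval_mult algebra_simps)
    finally show ?thesis by (rule SI[OF 1(1)])
  qed
  have S_0: "0 \<in> S" by (rule SI[of 1 0 0]) simp_all
  have S_sum: "(\<Sum>k\<in>I. f k) \<in> S" if "\<And>k. f k \<in> S" for f and I :: "'a set"
    using that S_0 S_add by (induction I rule: infinite_finite_induct) auto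
  have vanishing: "hom_eval \<iota> F z \<in> S" if "mpeval F v = 0" for F
  proof -
    obtain H where H: "F - mpconst (mpeval F v) = (\<Sum>k\<in>UNIV. H k * (mpvar k - mpconst (v $ k)))"
      by (rule expand_at_point)
    have "hom_eval \<iota> F z = hom_eval \<iota> (F - mpconst (mpeval F v)) z"
      using that by (simp add: hom_eval_diff)
    also have "\<dots> = (\<Sum>k\<in>UNIV. hom_eval \<iota> (H k) z * (z $ k - \<iota> (v $ k)))"
      unfolding H by (simp add: hom_eval_sum hom_eval_mult hom_eval_diff)
    also have "\<dots> \<in> S"
    proof (rule S_sum, rule S_mult)
      fix k
      from T(3)[of k] obtain F' G' where
        "mpeval G' v \<noteq> 0" "hom_eval \<iota> G' z * (z $ k - \<iota> (v $ k)) = t * hom_eval \<iota> F' z"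
        unfolding t_def by blast
      thus "z $ k - \<iota> (v $ k) \<in> S" by (rule SI)
    qed
    finally show ?thesis .
  qed
  have divisible: "\<exists>F' G. mpeval G v \<noteq> 0 \<and> hom_eval \<iota> G z * hom_eval \<iota> F z = t ^ e * hom_eval \<iota> F' z" for e
  proof (induction e)
    case 0
    show ?case by (intro exI[of _ F] exI[of _ 1]) simp
  next
    case (Suc e)
    then obtain F' G where FG: "mpeval G v \<noteq> 0" "hom_eval \<iota> G z * hom_eval \<iota> F z = t ^ e * hom_eval \<iota> F' z"
      by blast
    with no have "mpeval F' v = 0" unfolding t_def by blast
    from SE[OF vanishing[OF this]] obtain F'' G' where
      FG': "mpeval G' v \<noteq> 0" "hom_eval \<iota> G' z * hom_eval \<iota> F' z = t * hom_eval \<iota> F'' z" by blast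
    have "hom_eval \<iota> (G' * G) z * hom_eval \<iota> F z = hom_eval \<iota> G' z * (hom_eval \<iota> G z * hom_eval \<iota> F z)"
      by (simp add: hom_eval_mult algebra_simps)
    also have "\<dots> = t ^ e * (hom_eval \<iota> G' z * hom_eval \<iota> F' z)"
      unfolding FG(2) by (simp add: algebra_simps)
    also have "\<dots> = t ^ Suc e * hom_eval \<iota> F'' z"
      unfolding FG'(2) by (simp add: algebra_simps)
    finally show ?case
      using FG(1) FG'(1) by (intro exI[of _ F''] exI[of _ "G' * G"]) (simp add: mpeval_mult)
  qed
  have in_B: "hom_eval \<iota> G z \<in> B" for G
    by (rule residue_in_B[OF hom_eval_residue[OF z(1)]])
  have in_L: "hom_eval \<iota> G z \<in> L" for G
    by (rule hom_eval_in_subring[OF L_subring image_subsetI z(2)]) (rule const_in_L)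
  have "t \<in> N"
    using hom_eval_residue[OF z(1), of T] T(1) by (simp add: t_def)
  from not_infinitely_divisible[OF in_L[of T, folded t_def] this T(2)[folded t_def] in_L in_B F]
  obtain e where e: "\<And>r. r \<in> B \<Longrightarrow> hom_eval \<iota> F z \<noteq> t ^ e * r" by blast
  from divisible[of e] obtain F' G where
    FG: "mpeval G v \<noteq> 0" "hom_eval \<iota> G z * hom_eval \<iota> F z = t ^ e * hom_eval \<iota> F' z"
    by blast
  have unit: "hom_eval \<iota> G z \<notin> N"
    by (rule residue_unit[OF hom_eval_residue[OF z(1)] FG(1)])
  hence "hom_eval \<iota> G z \<noteq> 0" using N_closed(2) by metis
  hence "hom_eval \<iota> F z = t ^ e * (hom_eval \<iota> F' z * inverse (hom_eval \<iota> G z))"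
    using FG(2) by (simp add: field_simps)
  moreover have "hom_eval \<iota> F' z * inverse (hom_eval \<iota> G z) \<in> B"
    by (rule B_closed(6)[OF in_B inverse_unit[OF in_B unit]])
  ultimately show False using e by blast
qed

text \<open>Up to units, \<open>h\<close> is \<open>t\<close> to the power \<open>a - b\<close>.\<close>

lemma ideal_iff_positive_order:
  assumes "t \<in> N" "t \<noteq> 0" "x \<in> B" "x \<notin> N" "y \<in> B" "y \<notin> N" and rel: "t ^ b * (y * h) = t ^ a * x"
  shows "h \<in> N \<longleftrightarrow> b < a"
proof
  assume "b < a"
  hence "t ^ a = t ^ b * (t * t ^ (a - Suc b))"
    by (metis Suc_diff_Suc add_diff_inverse_nat less_imp_le_nat not_less power_Suc power_add)
  hence "t ^ b * (y * h) = t ^ b * (t * (t ^ (a - Suc b) * x))"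
    using rel by (simp add: mult.assoc)
  hence "y * h = t * (t ^ (a - Suc b) * x)" using \<open>t \<noteq> 0\<close> by simp
  moreover have "t * (t ^ (a - Suc b) * x) \<in> N"
    using assms(1,3) N_closed(1) by (intro N_closed(4) B_closed(6) subring_power[OF subring]) auto
  moreover have "h = inverse y * (y * h)" using assms(6) N_closed(2) by (cases "y = 0") auto
  ultimately show "h \<in> N"
    using N_closed(5)[OF inverse_unit[OF assms(5,6)]] by metis
next
  assume h: "h \<in> N"
  show "b < a"
  proof (rule ccontr)
    assume "\<not> b < a"
    hence "t ^ b = t ^ a * t ^ (b - a)" by (simp flip: power_add)
    hence "t ^ a * (t ^ (b - a) * y * h) = t ^ a * x" using rel by (simp add: mult.assoc)
    hence "x = t ^ (b - a) * y * h" using \<open>t \<noteq> 0\<close> by simp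
    also have "\<dots> \<in> N"
      using assms(1,5) N_closed(1) h by (intro N_closed(5) B_closed(6) subring_power[OF subring]) auto
    finally show False using assms(4) by simp
  qed
qed

end

context function_field
begin

text \<open>Hence two places with the same center, at a point with a uniformizer, agree on \<open>L\<close>.\<close>

lemma same_center_same_place:
  assumes "function_field_place \<iota> L B N" "function_field_place \<iota> L B' N'"
    and z: "\<And>j. z $ j - \<iota> (v $ j) \<in> N" "\<And>j. z $ j - \<iota> (v $ j) \<in> N'" "\<And>j. z $ j \<in> L"
    and "has_uniformizer z v" "generates z" and h: "h \<in> L" "h \<in> N"
  shows "h \<in> N'"
proof (cases "h = 0")
  case True
  interpret Q: function_field_place \<iota> L B' N' by fact
  show ?thesis using True Q.N_closed(2) by simp
next
  case False
  interpret P: function_field_place \<iota> L B N by fact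
  interpret Q: function_field_place \<iota> L B' N' by fact
  from \<open>has_uniformizer z v\<close> obtain T where T: "mpeval T v = 0"
    "\<And>j. \<exists>F G. mpeval G v \<noteq> 0 \<and>
         hom_eval \<iota> G z * (z $ j - \<iota> (v $ j)) = hom_eval \<iota> T z * hom_eval \<iota> F z"
    unfolding has_uniformizer_def by blast
  have unit_nz: "hom_eval \<iota> G z \<noteq> 0" if "mpeval G v \<noteq> 0" for G
    using P.residue_unit[OF P.hom_eval_residue[OF z(1)] that] P.N_closed(2) by fastforce
  obtain j where j: "z $ j \<noteq> \<iota> (v $ j)"
    using generates_nonconstant[OF \<open>generates z\<close>, of v] by blast
  have t_nz: "hom_eval \<iota> T z \<noteq> 0"
  proof
    assume *: "hom_eval \<iota> T z = 0"
    from T(2)[of j] obtain F G where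
      "mpeval G v \<noteq> 0" "hom_eval \<iota> G z * (z $ j - \<iota> (v $ j)) = hom_eval \<iota> T z * hom_eval \<iota> F z"
      by blast
    thus False using * j unit_nz by simp
  qed
  obtain F G where FG: "hom_eval \<iota> G z \<noteq> 0" "h = hom_eval \<iota> F z / hom_eval \<iota> G z"
    by (rule generatesE[OF \<open>generates z\<close> h(1)])
  hence "hom_eval \<iota> F z \<noteq> 0" using False by auto
  from P.power_of_uniformizer[OF z(1,3) T(1) t_nz T(2) this] obtain a F1 G1 where
    1: "mpeval F1 v \<noteq> 0" "mpeval G1 v \<noteq> 0" "hom_eval \<iota> G1 z * hom_eval \<iota> F z = hom_eval \<iota> T z ^ a * hom_eval \<iota> F1 z"
    by blast
  from P.power_of_uniformizer[OF z(1,3) T(1) t_nz T(2) FG(1)] obtain b F2 G2 where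
    2: "mpeval F2 v \<noteq> 0" "mpeval G2 v \<noteq> 0" "hom_eval \<iota> G2 z * hom_eval \<iota> G z = hom_eval \<iota> T z ^ b * hom_eval \<iota> F2 z"
    by blast
  define t x y where "t = hom_eval \<iota> T z" and "x = hom_eval \<iota> (F1 * G2) z" and "y = hom_eval \<iota> (F2 * G1) z"
  have "t ^ b * (y * h) = hom_eval \<iota> G1 z * h * (hom_eval \<iota> T z ^ b * hom_eval \<iota> F2 z)"
    by (simp add: t_def y_def hom_eval_mult algebra_simps)
  also have "\<dots> = hom_eval \<iota> G2 z * (hom_eval \<iota> G1 z * hom_eval \<iota> F z)"
    unfolding 2(3)[symmetric] using FG by simp
  also have "\<dots> = t ^ a * x"
    unfolding 1(3) by (simp add: t_def x_def hom_eval_mult algebra_simps)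
  finally have rel: "t ^ b * (y * h) = t ^ a * x" .
  have "mpeval (F1 * G2) v \<noteq> 0" "mpeval (F2 * G1) v \<noteq> 0" using 1 2 by (simp_all add: mpeval_mult)
  note P_units = P.residue_in_B[OF P.hom_eval_residue[OF z(1)]]
      P.residue_unit[OF P.hom_eval_residue[OF z(1)] this(1)] P.residue_unit[OF P.hom_eval_residue[OF z(1)] this(2)]
    and Q_units = Q.residue_in_B[OF Q.hom_eval_residue[OF z(2)]]
      Q.residue_unit[OF Q.hom_eval_residue[OF z(2)] this(1)] Q.residue_unit[OF Q.hom_eval_residue[OF z(2)] this(2)]
  have "t \<in> N" "t \<in> N'"
    using P.hom_eval_residue[OF z(1), of T] Q.hom_eval_residue[OF z(2), of T] T(1) by (simp_all add: t_def)
  have "h \<in> N \<longleftrightarrow> b < a"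
    by (rule P.ideal_iff_positive_order[OF \<open>t \<in> N\<close> t_nz[folded t_def] _ _ _ _ rel])
       (unfold x_def y_def, (rule P_units)+)
  moreover have "h \<in> N' \<longleftrightarrow> b < a"
    by (rule Q.ideal_iff_positive_order[OF \<open>t \<in> N'\<close> t_nz[folded t_def] _ _ _ _ rel])
       (unfold x_def y_def, (rule Q_units)+)
  ultimately show ?thesis using h(2) by blast
qed

subsection \<open>Two models of the same function field\<close>

text \<open>
  A nonsingular projective curve with function field \<open>L\<close>, given by a generic point. As
  homogeneous coordinates the vector matters only up to a factor, hence the condition on all its
  multiples.
\<close>

definition is_model :: "'o ^ 'n::finite \<Rightarrow> bool" where
  "is_model \<eta> \<longleftrightarrow>
     (\<forall>j. \<eta> $ j \<in> L) \<and> (\<forall>s. s \<noteq> 0 \<longrightarrow> generates (s *s \<eta>)) \<and>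
     (\<forall>v. specializes \<eta> v \<longrightarrow> (\<exists>i. v $ i \<noteq> 0 \<and> has_uniformizer (normalized \<eta> v i) v))"

text \<open>The correspondence between the points of two models: having a common place.\<close>

definition same_place :: "'o ^ 'n::finite \<Rightarrow> 'o ^ 'm::finite \<Rightarrow> 'k ^ 'n \<Rightarrow> 'k ^ 'm \<Rightarrow> bool" where
  "same_place \<eta> \<xi> v w \<longleftrightarrow>
     (\<exists>B N. function_field_place \<iota> L B N \<and> is_center B N \<eta> v \<and> is_center B N \<xi> w)"

lemma same_place_sym: "same_place \<eta> \<xi> v w \<longleftrightarrow> same_place \<xi> \<eta> w v"
  unfolding same_place_def by blast

lemma same_place_specializes:
  "same_place \<eta> \<xi> v w \<Longrightarrow> specializes \<eta> v" "same_place \<eta> \<xi> v w \<Longrightarrow> specializes \<xi> w"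
  unfolding same_place_def using function_field_place.center_specializes by blast+

lemma is_model_nonzero: "is_model \<eta> \<Longrightarrow> \<eta> \<noteq> 0"
proof
  assume "is_model \<eta>" "\<eta> = 0"
  hence "generates (1 *s \<eta>)" unfolding is_model_def by (metis one_neq_zero)
  from generates_nonconstant[OF this, of 0] \<open>\<eta> = 0\<close> show False by simp
qed

lemma same_place_exists:
  assumes "is_model \<eta>" "is_model \<xi>" "specializes \<eta> v"
  obtains w where "same_place \<eta> \<xi> v w"
proof -
  obtain B N u where BN: "function_field_place \<iota> L B N" "is_center B N \<eta> v" "u \<in> L" "u \<in> N" "u \<noteq> 0"
    using place_over_point[OF assms(3)] assms(1) unfolding is_model_def by metis
  interpret function_field_place \<iota> L B N by fact
  obtain w where "is_center B N \<xi> w"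
    using center_exists[OF BN(3-5) is_model_nonzero[OF assms(2)]] assms(2) unfolding is_model_def by metis
  with BN(1,2) have "same_place \<eta> \<xi> v w" unfolding same_place_def by blast
  thus ?thesis by (rule that)
qed

text \<open>
  Two places with the center \<open>v\<close> agree on \<open>L\<close>, and the center on \<open>\<xi>\<close> depends only on that.
\<close>

lemma same_place_unique:
  assumes "is_model \<eta>" "is_model \<xi>" "same_place \<eta> \<xi> v w" "same_place \<eta> \<xi> v w'"
  obtains s where "s \<noteq> 0" "w' = s *s w"
proof -
  obtain B N where BN: "function_field_place \<iota> L B N" "is_center B N \<eta> v" "is_center B N \<xi> w"
    using assms(3) unfolding same_place_def by blast
  obtain B' N' where BN': "function_field_place \<iota> L B' N'" "is_center B' N' \<eta> v" "is_center B' N' \<xi> w'"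
    using assms(4) unfolding same_place_def by blast
  interpret P: function_field_place \<iota> L B N by fact
  interpret Q: function_field_place \<iota> L B' N' by fact
  have v: "specializes \<eta> v" and w: "specializes \<xi> w"
    using P.center_specializes BN by blast+
  from assms(1) v obtain i where i: "v $ i \<noteq> 0" and unif: "has_uniformizer (normalized \<eta> v i) v"
    unfolding is_model_def by blast
  obtain k where k: "w $ k \<noteq> 0"
    using w unfolding specializes_def by (metis vec_eq_iff zero_index)
  have quotient: "\<iota> a / b \<in> L" if "b \<in> L" for a b
    unfolding divide_inverse by (rule subring_closed(6)[OF L_subring const_in_L L_inverse[OF that]])
  have normalized_L: "normalized \<zeta> u l $ j \<in> L" if "\<And>j. \<zeta> $ j \<in> L" for \<zeta> :: "'o ^ 'q::finite" and u l j
    unfolding normalized_def using subring_closed(6)[OF L_subring quotient[OF that] that] by simp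
  have \<eta>: "\<eta> $ j \<in> L" for j using assms(1) unfolding is_model_def by blast
  have \<xi>: "\<xi> $ j \<in> L" for j using assms(2) unfolding is_model_def by blast
  have gen: "generates (normalized \<eta> v i)"
    using assms(1) i specializes_coordinate[OF v i] unfolding is_model_def normalized_def by simp
  have "normalized \<xi> w k $ j - \<iota> (w $ j) \<in> N'" for j
  proof (rule same_center_same_place[OF BN(1) BN'(1) _ _ _ unif gen])
    show "normalized \<eta> v i $ j - \<iota> (v $ j) \<in> N" for j by (rule P.center_normalized[OF BN(2) i])
    show "normalized \<eta> v i $ j - \<iota> (v $ j) \<in> N'" for j by (rule Q.center_normalized[OF BN'(2) i])
    show "normalized \<eta> v i $ j \<in> L" for j by (rule normalized_L[OF \<eta>])
    show "normalized \<xi> w k $ j - \<iota> (w $ j) \<in> N" by (rule P.center_normalized[OF BN(3) k])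
    show "normalized \<xi> w k $ j - \<iota> (w $ j) \<in> L"
      by (rule subring_closed(4)[OF L_subring normalized_L[OF \<xi>] const_in_L])
  qed
  hence "is_center B' N' \<xi> w"
    using w k specializes_coordinate[OF w k] unfolding is_center_def normalized_def specializes_def
    by (intro conjI exI[of _ "\<iota> (w $ k) / \<xi> $ k"]) simp_all
  from Q.center_unique[OF this BN'(3)] show ?thesis using that by metis
qed

lemma same_place_scale:
  assumes "same_place \<eta> \<xi> v w" "s \<noteq> 0"
  shows "same_place \<eta> \<xi> (s *s v) w"
proof -
  obtain B N where BN: "function_field_place \<iota> L B N" "is_center B N \<eta> v" "is_center B N \<xi> w"
    using assms(1) unfolding same_place_def by blast
  interpret function_field_place \<iota> L B N by fact
  obtain \<mu> where \<mu>: "\<mu> \<noteq> 0" "\<And>j. \<mu> * \<eta> $ j - \<iota> (v $ j) \<in> N" and "v \<noteq> 0"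
    using BN(2) unfolding is_center_def by blast
  have "is_center B N \<eta> (s *s v)"
    unfolding is_center_def
  proof (intro conjI exI allI)
    show "s *s v \<noteq> 0" using \<open>v \<noteq> 0\<close> assms(2) by simp
    show "\<iota> s * \<mu> \<noteq> 0" using assms(2) \<mu>(1) by simp
    show "\<iota> s * \<mu> * \<eta> $ j - \<iota> ((s *s v) $ j) \<in> N" for j
      using N_closed(5)[OF const_in_B[of s] \<mu>(2)[of j]] by (simp add: hom_mult algebra_simps)
  qed
  thus ?thesis using BN unfolding same_place_def by blast
qed

end

lemma ppoint_self: "v \<in> ppoint v"
  unfolding ppoint_def by (auto intro!: exI[of _ 1])

lemma ppoint_eqD:
  assumes "ppoint v = ppoint w"
  obtains s where "s \<noteq> 0" "v = s *s w"
proof -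
  have "v \<in> ppoint w" using ppoint_self[of v] assms by simp
  thus ?thesis unfolding ppoint_def using that by auto
qed

lemma ppoint_scale:
  fixes v :: "'a::field ^ 'n::finite"
  assumes "s \<noteq> 0"
  shows "ppoint (s *s v) = ppoint v"
proof (intro equalityI subsetI)
  fix x assume "x \<in> ppoint (s *s v)"
  then obtain t where "x = (t * s) *s v" "t * s \<noteq> 0"
    using assms unfolding ppoint_def by (auto simp: vector_smult_assoc)
  thus "x \<in> ppoint v" unfolding ppoint_def by blast
next
  fix x assume "x \<in> ppoint v"
  then obtain t where "x = t *s v" "t \<noteq> 0" unfolding ppoint_def by blast
  hence "x = (t / s) *s (s *s v)" "t / s \<noteq> 0" using assms by (simp_all add: vector_smult_assoc)
  thus "x \<in> ppoint (s *s v)" unfolding ppoint_def by blast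
qed

subsection \<open>Rational points\<close>

text \<open>
  The intended \<open>\<tau>\<close> is Frobenius on the constants, extended by \<open>\<sigma>\<close> to the big field. A generic
  point with coordinates fixed by \<open>\<sigma>\<close> stands for a variety over the fixed field of \<open>\<tau>\<close>.
\<close>

locale function_field_frobenius = function_field \<iota> L
  for \<iota> :: "'k::alg_closed_field \<Rightarrow> 'o::field" and L +
  fixes \<tau> :: "'k \<Rightarrow> 'k" and \<sigma> :: "'o \<Rightarrow> 'o"
  assumes \<tau>_hom: "inj_idom_hom \<tau>" and \<tau>_surj: "surj \<tau>"
    and \<sigma>_hom: "inj_idom_hom \<sigma>" and \<sigma>_const: "\<sigma> (\<iota> a) = \<iota> (\<tau> a)"
begin

sublocale \<tau>: inj_idom_hom \<tau> by (rule \<tau>_hom)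
sublocale \<sigma>: inj_idom_hom \<sigma> by (rule \<sigma>_hom)

lemma \<sigma>_inverse: "\<sigma> (inverse a) = inverse (\<sigma> a)"
proof (cases "a = 0")
  case False
  hence "\<sigma> (inverse a) * \<sigma> a = 1" by (simp flip: \<sigma>.hom_mult)
  thus ?thesis by (metis inverse_unique mult.commute)
qed simp

definition frob :: "'k ^ 'n \<Rightarrow> 'k ^ 'n" where
  "frob v = (\<chi> j. \<tau> (v $ j))"

lemma preimage_place:
  assumes "function_field_place \<iota> L B N"
  shows "function_field_place \<iota> L (\<sigma> -` B) (\<sigma> -` N)"
proof -
  interpret function_field_place \<iota> L B N by fact
  show ?thesis
  proof
    show "\<iota> a \<in> \<sigma> -` B" for a by (simp add: \<sigma>_const const_in_B)
    show "is_place (\<sigma> -` B) (\<sigma> -` N)"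
      unfolding is_place_def is_subring_def is_proper_ideal_def
      using inverse_in_ideal inverse_unit N_closed B_closed
      by (auto simp: \<sigma>.hom_add \<sigma>.hom_mult \<sigma>.hom_minus \<sigma>_inverse)
  qed
qed

text \<open>
  The map \<open>\<sigma>\<close> fixes \<open>\<eta>\<close> and applies Frobenius to the constants.
\<close>

lemma preimage_center:
  assumes "function_field_place \<iota> L B N" "is_center B N \<eta> (frob v)" "\<And>j. \<sigma> (\<eta> $ j) = \<eta> $ j"
  shows "is_center (\<sigma> -` B) (\<sigma> -` N) \<eta> v"
proof -
  interpret function_field_place \<iota> L B N by fact
  have "frob v \<noteq> 0" using assms(2) unfolding is_center_def by blast
  then obtain i where i: "frob v $ i \<noteq> 0" by (metis vec_eq_iff zero_index)
  have nz: "\<eta> $ i \<noteq> 0" by (rule specializes_coordinate[OF center_specializes[OF assms(2)] i])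
  show ?thesis
    unfolding is_center_def
  proof (intro conjI exI allI)
    show "v \<noteq> 0" using \<open>frob v \<noteq> 0\<close> by (auto simp: frob_def vec_eq_iff)
    show "\<iota> (v $ i) / \<eta> $ i \<noteq> 0" using i nz by (simp add: frob_def)
    show "\<iota> (v $ i) / \<eta> $ i * \<eta> $ j - \<iota> (v $ j) \<in> \<sigma> -` N" for j
      using center_normalized[OF assms(2) i, of j]
      by (simp add: \<sigma>.hom_minus \<sigma>.hom_mult divide_inverse \<sigma>_inverse \<sigma>_const assms(3) normalized_def frob_def)
  qed
qed

lemma same_place_frob:
  assumes "same_place \<eta> \<xi> (frob v) (frob w)" "\<And>j. \<sigma> (\<eta> $ j) = \<eta> $ j" "\<And>j. \<sigma> (\<xi> $ j) = \<xi> $ j"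
  shows "same_place \<eta> \<xi> v w"
  using assms(1) preimage_place preimage_center[OF _ _ assms(2)] preimage_center[OF _ _ assms(3)]
  unfolding same_place_def by blast

text \<open>
  By uniqueness of the partner, Frobenius fixes the projective point of \<open>w\<close>. Scaling a nonzero
  coordinate to \<open>1\<close> yields a representative fixed coordinatewise.
\<close>

lemma rational_partner:
  assumes "is_model \<eta>" "is_model \<xi>" "\<And>j. \<sigma> (\<eta> $ j) = \<eta> $ j" "\<And>j. \<sigma> (\<xi> $ j) = \<xi> $ j"
    and "specializes \<eta> v" "frob v = v"
  obtains w where "same_place \<eta> \<xi> v w" "frob w = w"
proof -
  obtain w where w: "same_place \<eta> \<xi> v w" using same_place_exists assms(1,2,5) by metis
  define w' where "w' = (\<chi> j. inv_into UNIV \<tau> (w $ j))"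
  have w': "frob w' = w"
    unfolding frob_def w'_def by (simp add: vec_eq_iff f_inv_into_f \<tau>_surj)
  have "same_place \<eta> \<xi> (frob v) (frob w')" using w w' assms(6) by simp
  hence "same_place \<eta> \<xi> v w'" using assms(3,4) by (rule same_place_frob)
  from same_place_unique[OF assms(1,2) w this]
  obtain s where s: "s \<noteq> 0" "w' = s *s w" .
  have frob_w: "w $ j = \<tau> s * \<tau> (w $ j)" for j
    using w' s(2) by (auto simp: frob_def vec_eq_iff \<tau>.hom_mult)
  have "w \<noteq> 0" using same_place_specializes(2)[OF w] unfolding specializes_def by blast
  then obtain i where i: "w $ i \<noteq> 0" by (metis vec_eq_iff zero_index)
  define r where "r = inverse (w $ i)"
  have "\<tau> r * \<tau> (w $ i) = 1" using i by (simp add: r_def flip: \<tau>.hom_mult)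
  moreover have "(r * \<tau> s) * \<tau> (w $ i) = 1"
    using i by (simp only: mult.assoc frob_w[of i, symmetric]) (simp add: r_def)
  ultimately have "\<tau> r * \<tau> (w $ i) = (r * \<tau> s) * \<tau> (w $ i)" by simp
  hence r: "\<tau> r = r * \<tau> s" using i by simp
  have "frob (r *s w) = r *s w"
    unfolding vec_eq_iff
  proof
    fix j
    have "frob (r *s w) $ j = r * (\<tau> s * \<tau> (w $ j))"
      by (simp add: frob_def \<tau>.hom_mult r mult.assoc)
    thus "frob (r *s w) $ j = (r *s w) $ j" by (simp flip: frob_w)
  qed
  moreover have "same_place \<eta> \<xi> v (r *s w)"
    using same_place_scale[of \<xi> \<eta> w v r] w i unfolding r_def by (simp add: same_place_sym[of \<eta>])
  ultimately show ?thesis by (intro that)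
qed

text \<open>
  Having a common place is a functional relation in both directions, and each rational point has
  a rational partner.
\<close>

theorem rational_points_equinumerous:
  fixes \<eta> :: "'o ^ 'n::finite" and \<xi> :: "'o ^ 'm::finite"
  assumes "is_model \<eta>" "is_model \<xi>" "\<And>j. \<sigma> (\<eta> $ j) = \<eta> $ j" "\<And>j. \<sigma> (\<xi> $ j) = \<xi> $ j"
  shows "card (ppoint ` {v. specializes \<eta> v \<and> frob v = v}) = card (ppoint ` {w. specializes \<xi> w \<and> frob w = w})"
proof -
  define R where "R P Q \<longleftrightarrow> (\<exists>v w. P = ppoint v \<and> Q = ppoint w \<and> frob v = v \<and> frob w = w \<and> same_place \<eta> \<xi> v w)" for P Q
  have functional: "ppoint w = ppoint w'"
    if "is_model \<alpha>" "is_model \<beta>" "same_place \<alpha> \<beta> v w" "same_place \<alpha> \<beta> v' w'" "ppoint v = ppoint v'"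
    for \<alpha> :: "'o ^ 'a::finite" and \<beta> :: "'o ^ 'b::finite" and v v' w w'
  proof -
    from that(5) obtain s where "s \<noteq> 0" "v = s *s v'" by (rule ppoint_eqD)
    hence "same_place \<alpha> \<beta> v w'" using same_place_scale[OF that(4)] by simp
    from same_place_unique[OF that(1-3) this] obtain s where "s \<noteq> 0" "w' = s *s w" .
    thus ?thesis by (simp add: ppoint_scale)
  qed
  define U V where "U = ppoint ` {v. specializes \<eta> v \<and> frob v = v}"
    and "V = ppoint ` {w. specializes \<xi> w \<and> frob w = w}"
  have R_in: "P \<in> U \<and> Q \<in> V" if "R P Q" for P Q
  proof -
    from that obtain v w where vw: "P = ppoint v" "Q = ppoint w" "frob v = v" "frob w = w" "same_place \<eta> \<xi> v w"
      unfolding R_def by blast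
    show ?thesis
      unfolding U_def V_def vw(1,2)
      using vw(3,4) same_place_specializes[OF vw(5)] by (intro conjI imageI CollectI)
  qed
  have right: "\<exists>Q. R P Q" if "P \<in> U" for P
  proof -
    from that obtain v where v: "P = ppoint v" "specializes \<eta> v" "frob v = v" unfolding U_def by auto
    obtain w where "same_place \<eta> \<xi> v w" "frob w = w" by (rule rational_partner[OF assms v(2,3)])
    thus ?thesis unfolding R_def using v by blast
  qed
  have left: "\<exists>P. R P Q" if "Q \<in> V" for Q
  proof -
    from that obtain w where w: "Q = ppoint w" "specializes \<xi> w" "frob w = w" unfolding V_def by auto
    obtain v where "same_place \<xi> \<eta> w v" "frob v = v" by (rule rational_partner[OF assms(2,1,4,3) w(2,3)])
    thus ?thesis unfolding R_def using w same_place_sym by blast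
  qed
  have right_unique: "Q = Q'" if "R P Q" "R P Q'" for P Q Q'
    using that functional[OF assms(1,2)] unfolding R_def by metis
  have left_unique: "P = P'" if "R P Q" "R P' Q" for P P' Q
    using that functional[OF assms(2,1)] same_place_sym unfolding R_def by metis
  define f where "f P = (SOME Q. R P Q)" for P
  have f: "R P (f P)" if "P \<in> U" for P
    unfolding f_def using right[OF that] by (rule someI_ex)
  have "bij_betw f U V"
  proof (rule bij_betwI')
    show "(f P = f P') = (P = P')" if "P \<in> U" "P' \<in> U" for P P'
      using f[OF that(1)] f[OF that(2)] left_unique by metis
    show "f P \<in> V" if "P \<in> U" for P using R_in[OF f[OF that]] by blast
    show "\<exists>P\<in>U. Q = f P" if Q: "Q \<in> V" for Q
    proof -
      obtain P where "R P Q" using left[OF Q] by blast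
      thus ?thesis using right_unique[OF f] R_in by metis
    qed
  qed
  thus ?thesis unfolding U_def V_def by (rule bij_betw_same_card)
qed

end

section \<open>Nonsingular points have uniformizers\<close>

text \<open>
  Nakayama's lemma by elimination. Here \<open>R\<close>, \<open>M\<close> and \<open>U\<close> are the numerators, the numerators
  of nonunits and the denominators of a local ring.
\<close>

lemma nakayama_elimination:
  fixes w :: "'i \<Rightarrow> 'o::comm_ring_1"
  assumes R: "is_subring R" and M: "is_proper_ideal R M" and "U \<subseteq> R"
    and U_mult: "\<And>u u'. u \<in> U \<Longrightarrow> u' \<in> U \<Longrightarrow> u * u' \<in> U"
    and U_diff: "\<And>u m. u \<in> U \<Longrightarrow> m \<in> M \<Longrightarrow> u - m \<in> U" and "1 \<in> U"
    and "finite S"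
    and "\<And>j. j \<in> S \<Longrightarrow> \<exists>d\<in>U. \<exists>p\<in>R. \<exists>q. (\<forall>k\<in>S. q k \<in> M) \<and> d * w j = p * t + (\<Sum>k\<in>S. q k * w k)"
  shows "\<forall>j\<in>S. \<exists>d\<in>U. \<exists>p\<in>R. d * w j = p * t"
  using assms(7,8)
proof (induction S rule: finite_induct)
  case (insert s S)
  note R_closed = subring_closed[OF R] and M_closed = proper_ideal_closed[OF M]
  have U_R: "u \<in> R" if "u \<in> U" for u using that \<open>U \<subseteq> R\<close> by blast
  have "s \<in> insert s S" by simp
  from insert.prems[OF this] obtain ds ps qs where s: "ds \<in> U" "ps \<in> R" "\<forall>k\<in>insert s S. qs k \<in> M"
    "ds * w s = ps * t + (\<Sum>k\<in>insert s S. qs k * w k)" by blast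
  define D where "D = ds - qs s"
  have "D \<in> U" unfolding D_def by (rule U_diff) (use s in auto)
  have s_eq: "D * w s = ps * t + (\<Sum>k\<in>S. qs k * w k)"
    using s(4) insert.hyps by (simp add: D_def algebra_simps)
  have IH: "\<forall>j\<in>S. \<exists>d\<in>U. \<exists>p\<in>R. d * w j = p * t"
  proof (rule insert.IH)
    fix j assume "j \<in> S"
    hence "j \<in> insert s S" by simp
    from insert.prems[OF this] obtain d p q where j: "d \<in> U" "p \<in> R" "\<forall>k\<in>insert s S. q k \<in> M"
      "d * w j = p * t + (\<Sum>k\<in>insert s S. q k * w k)" by blast
    have "(D * d) * w j = D * (d * w j)" by (rule mult.assoc)
    also have "\<dots> = D * p * t + (q s * (D * w s) + (\<Sum>k\<in>S. D * q k * w k))"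
      unfolding j(4) using insert.hyps by (simp add: sum_distrib_left algebra_simps)
    also have "\<dots> = (D * p + q s * ps) * t + (\<Sum>k\<in>S. (q s * qs k + D * q k) * w k)"
      unfolding s_eq by (simp add: sum_distrib_left sum.distrib algebra_simps)
    finally have "(D * d) * w j = (D * p + q s * ps) * t + (\<Sum>k\<in>S. (q s * qs k + D * q k) * w k)" .
    moreover have "D * d \<in> U" by (rule U_mult) fact+
    moreover have "D * p + q s * ps \<in> R"
      using \<open>D \<in> U\<close> U_R j(2,3) s(2) M_closed(1) by (intro R_closed(3,6)) auto
    moreover have "q s * qs k + D * q k \<in> M" if "k \<in> S" for k
      using that j(3) s(3) \<open>D \<in> U\<close> U_R M_closed(1) by (intro M_closed(3) M_closed(5)) auto
    ultimately show "\<exists>d\<in>U. \<exists>p\<in>R. \<exists>q. (\<forall>k\<in>S. q k \<in> M) \<and> d * w j = p * t + (\<Sum>k\<in>S. q k * w k)"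
      by (intro bexI[of _ "D * d"] bexI[of _ "D * p + q s * ps"] exI[of _ "\<lambda>k. q s * qs k + D * q k"]) auto
  qed
  have partial: "\<exists>d\<in>U. \<exists>p\<in>R. d * (\<Sum>k\<in>A. qs k * w k) = p * t" if "A \<subseteq> S" for A
  proof -
    have "finite A" using that insert.hyps(1) by (rule finite_subset)
    thus ?thesis using that
    proof (induction A rule: finite_induct)
      case empty
      show ?case using \<open>1 \<in> U\<close> R_closed(2) by (intro bexI[of _ 1] bexI[of _ 0]) auto
    next
      case (insert k A)
      from insert.IH insert.prems obtain d p where 1: "d \<in> U" "p \<in> R" "d * (\<Sum>k\<in>A. qs k * w k) = p * t" by auto
      from IH insert.prems obtain d' p' where 2: "d' \<in> U" "p' \<in> R" "d' * w k = p' * t" by auto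
      have "(d * d') * (\<Sum>k\<in>insert k A. qs k * w k) =
          d * qs k * (d' * w k) + d' * (d * (\<Sum>k\<in>A. qs k * w k))"
        using insert.hyps by (simp add: algebra_simps)
      also have "\<dots> = (d * qs k * p' + d' * p) * t"
        unfolding 1(3) 2(3) by (simp add: algebra_simps)
      finally have "(d * d') * (\<Sum>k\<in>insert k A. qs k * w k) = (d * qs k * p' + d' * p) * t" .
      moreover have "qs k \<in> R" using insert.prems s(3) M_closed(1) by auto
      ultimately show ?case
        using U_mult[OF 1(1) 2(1)] 1 2 U_R
        by (intro bexI[of _ "d * d'"] bexI[of _ "d * qs k * p' + d' * p"]) (auto intro!: R_closed(3,6))
    qed
  qed
  from partial[OF order.refl] obtain d p where dp: "d \<in> U" "p \<in> R" "d * (\<Sum>k\<in>S. qs k * w k) = p * t" by blast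
  have "(d * D) * w s = d * (D * w s)" by (rule mult.assoc)
  also have "\<dots> = (d * ps + p) * t"
    unfolding s_eq using dp(3) by (simp add: algebra_simps)
  finally have "\<exists>d\<in>U. \<exists>p\<in>R. d * w s = p * t"
    using U_mult[OF dp(1) \<open>D \<in> U\<close>] dp s(2) U_R
    by (intro bexI[of _ "d * D"] bexI[of _ "d * ps + p"]) (auto intro!: R_closed(3,6))
  with IH show ?case by blast
qed simp

context function_field
begin

text \<open>
  The gradients and the unit vector \<open>e\<^sub>i\<close> span a space of codimension one, which leaves a single
  coordinate \<open>r\<close>. Since \<open>z\<^sub>i = v\<^sub>i\<close> and each equation is linear up to second order, all
  differences \<open>z\<^sub>j - v\<^sub>j\<close> are multiples of \<open>z\<^sub>r - v\<^sub>r\<close> modulo second order terms. Nakayama's lemma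
  removes these terms.
\<close>

lemma jacobian_uniformizer:
  fixes \<eta> :: "'o ^ 'n::finite" and I :: "('n, 'k) mpoly set"
  assumes spec: "specializes \<eta> v" and i: "v $ i \<noteq> 0"
    and vanish: "\<And>F. F \<in> I \<Longrightarrow> mpeval F v = 0 \<and> hom_eval \<iota> F (normalized \<eta> v i) = 0"
    and euler: "\<And>F. F \<in> I \<Longrightarrow> (\<Sum>j\<in>UNIV. v $ j * gradient F v $ j) = 0"
    and rank: "vec.dim ((\<lambda>F. gradient F v) ` I) + 2 = CARD('n)"
  shows "has_uniformizer (normalized \<eta> v i) v"
proof -
  define z where "z = normalized \<eta> v i"
  define w where "w j = z $ j - \<iota> (v $ j)" for j
  have "w i = 0"
    using i specializes_coordinate[OF spec i] by (simp add: w_def z_def normalized_def)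
  define W where "W = (\<lambda>F. gradient F v) ` I"
  define e where "e j = (axis j 1 :: 'k ^ 'n)" for j
  \<comment> \<open>By Euler's relation the coordinate \<open>i\<close>, nonzero at the point, is independent of the gradients.\<close>
  have orthogonal: "(\<Sum>j\<in>UNIV. v $ j * g $ j) = 0" if "g \<in> vec.span W" for g
    using that
  proof (induction rule: vec.span_induct_alt)
    case (step c x y)
    then obtain F where "F \<in> I" "x = gradient F v" unfolding W_def by blast
    hence "(\<Sum>j\<in>UNIV. v $ j * x $ j) = 0" using euler by simp
    moreover have "(\<Sum>j\<in>UNIV. v $ j * (c *s x + y) $ j) =
        c * (\<Sum>j\<in>UNIV. v $ j * x $ j) + (\<Sum>j\<in>UNIV. v $ j * y $ j)"
      by (simp add: sum_distrib_left sum.distrib algebra_simps)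
    ultimately show ?case using step by simp
  qed simp
  have "e i \<notin> vec.span W"
  proof
    assume "e i \<in> vec.span W"
    moreover have "(\<Sum>j\<in>UNIV. v $ j * e i $ j) = (\<Sum>j\<in>UNIV. if j = i then v $ i else 0)"
      by (rule sum.cong) (auto simp: e_def axis_def)
    ultimately show False using orthogonal[of "e i"] i by simp
  qed
  hence dim1: "vec.dim (insert (e i) W) + 1 = CARD('n)"
    using rank by (simp add: vec.dim_insert W_def)
  have "\<exists>r. e r \<notin> vec.span (insert (e i) W)"
  proof (rule ccontr)
    assume "\<not> ?thesis"
    hence all: "e j \<in> vec.span (insert (e i) W)" for j by blast
    have "g \<in> vec.span (insert (e i) W)" for g
    proof -
      have "g = (\<Sum>j\<in>UNIV. (g $ j) *s e j)" unfolding e_def by (rule basis_expansion[symmetric])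
      also have "\<dots> \<in> vec.span (insert (e i) W)" by (intro vec.span_sum vec.span_scale all)
      finally show ?thesis .
    qed
    hence "vec.span (insert (e i) W) = UNIV" by blast
    hence "vec.dim (insert (e i) W) = CARD('n)"
      using vec.dim_span[of "insert (e i) W"] by (simp only: vec_dim_card)
    thus False using dim1 by simp
  qed
  then obtain r where r: "e r \<notin> vec.span (insert (e i) W)" by blast
  have full: "g \<in> vec.span (insert (e r) (insert (e i) W))" for g
  proof -
    have "vec.dim (insert (e r) (insert (e i) W)) = CARD('n)"
      using dim1 r by (simp add: vec.dim_insert)
    hence "vec.dim (insert (e r) (insert (e i) W)) = vec.dim (UNIV :: ('k ^ 'n) set)"
      by (simp only: vec_dim_card)
    thus ?thesis
      using vec.dim_eq_full[of "insert (e r) (insert (e i) W)"] by (simp add: vec.dimension_def)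
  qed
  \<comment> \<open>The linear forms given by the gradients vanish to second order.\<close>
  have second_order: "\<exists>Q. (\<forall>k. mpeval (Q k) v = 0) \<and>
      (\<Sum>k\<in>UNIV. \<iota> (g $ k) * w k) = (\<Sum>k\<in>UNIV. hom_eval \<iota> (Q k) z * w k)" if "g \<in> vec.span W" for g
    using that
  proof (induction rule: vec.span_induct_alt)
    case base
    show ?case by (rule exI[of _ "\<lambda>_. 0"]) simp
  next
    case (step c x y)
    from step(2) obtain Q where Q: "\<forall>k. mpeval (Q k) v = 0"
      "(\<Sum>k\<in>UNIV. \<iota> (y $ k) * w k) = (\<Sum>k\<in>UNIV. hom_eval \<iota> (Q k) z * w k)" by blast
    from step(1) obtain F where F: "F \<in> I" "x = gradient F v" unfolding W_def by blast
    obtain H where H: "F - mpconst (mpeval F v) = (\<Sum>k\<in>UNIV. H k * (mpvar k - mpconst (v $ k)))"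
      "\<And>j. mpeval (H j) v = mpeval (mpderiv j F) v"
      by (rule expand_at_point[of F v], rule that)
    have "(\<Sum>k\<in>UNIV. hom_eval \<iota> (H k) z * w k) = hom_eval \<iota> (F - mpconst (mpeval F v)) z"
      unfolding H(1) by (simp add: hom_eval_sum hom_eval_mult hom_eval_diff w_def)
    also have "\<dots> = 0" using vanish[OF F(1)] by (simp add: hom_eval_diff z_def)
    finally have zero: "(\<Sum>k\<in>UNIV. hom_eval \<iota> (H k) z * w k) = 0" .
    define Q' where "Q' k = mpconst (c * x $ k) - mpconst c * H k + Q k" for k
    have "mpeval (Q' k) v = 0" for k
      using Q(1) H(2)[of k] F(2)
      by (simp add: Q'_def mpeval_add mpeval_diff mpeval_mult gradient_def)
    moreover have "(\<Sum>k\<in>UNIV. hom_eval \<iota> (Q' k) z * w k) =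
        (\<Sum>k\<in>UNIV. \<iota> (c * x $ k) * w k) - \<iota> c * (\<Sum>k\<in>UNIV. hom_eval \<iota> (H k) z * w k)
          + (\<Sum>k\<in>UNIV. hom_eval \<iota> (Q k) z * w k)"
      unfolding sum_distrib_left sum_subtractf[symmetric] sum.distrib[symmetric]
      by (rule sum.cong) (simp_all add: Q'_def hom_eval_add hom_eval_diff hom_eval_mult algebra_simps)
    moreover have "(\<Sum>k\<in>UNIV. \<iota> ((c *s x + y) $ k) * w k) =
        (\<Sum>k\<in>UNIV. \<iota> (c * x $ k) * w k) + (\<Sum>k\<in>UNIV. \<iota> (y $ k) * w k)"
      unfolding sum.distrib[symmetric] by (rule sum.cong) (simp_all add: hom_add algebra_simps)
    ultimately have "(\<forall>k. mpeval (Q' k) v = 0) \<and>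
        (\<Sum>k\<in>UNIV. \<iota> ((c *s x + y) $ k) * w k) = (\<Sum>k\<in>UNIV. hom_eval \<iota> (Q' k) z * w k)"
      using zero Q(2) by simp
    thus ?case by (rule exI[of _ Q'])
  qed
  have relation: "\<exists>a Q. (\<forall>k. mpeval (Q k) v = 0) \<and>
      w j = \<iota> a * w r + (\<Sum>k\<in>UNIV. hom_eval \<iota> (Q k) z * w k)" for j
  proof -
    from full[of "e j"] have "\<exists>a b. e j - a *s e r - b *s e i \<in> vec.span W"
      by (simp only: vec.span_breakdown_eq)
    then obtain a b where "e j - a *s e r - b *s e i \<in> vec.span W" by blast
    from second_order[OF this] obtain Q where Q: "\<forall>k. mpeval (Q k) v = 0"
      "(\<Sum>k\<in>UNIV. \<iota> ((e j - a *s e r - b *s e i) $ k) * w k) = (\<Sum>k\<in>UNIV. hom_eval \<iota> (Q k) z * w k)"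
      by blast
    have "(\<Sum>k\<in>UNIV. \<iota> ((e j - a *s e r - b *s e i) $ k) * w k) =
        (\<Sum>k\<in>UNIV. (if k = j then w j else 0) - (if k = r then \<iota> a * w r else 0) - (if k = i then \<iota> b * w i else 0))"
      by (rule sum.cong) (auto simp: e_def axis_def hom_minus hom_mult hom_uminus hom_add algebra_simps)
    also have "\<dots> = w j - \<iota> a * w r"
      using \<open>w i = 0\<close> by (simp add: sum_subtractf)
    finally have "w j - \<iota> a * w r = (\<Sum>k\<in>UNIV. hom_eval \<iota> (Q k) z * w k)"
      unfolding Q(2) by (rule sym)
    hence "w j = \<iota> a * w r + (\<Sum>k\<in>UNIV. hom_eval \<iota> (Q k) z * w k)"
      by (simp only: diff_eq_eq add.commute)
    with Q(1) show ?thesis by blast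
  qed
  \<comment> \<open>The local ring of the point, described by numerators and denominators.\<close>
  define R where "R = range (\<lambda>F. hom_eval \<iota> F z)"
  define M where "M = (\<lambda>F. hom_eval \<iota> F z) ` {F. mpeval F v = 0}"
  define U where "U = (\<lambda>F. hom_eval \<iota> F z) ` {F. mpeval F v \<noteq> 0}"
  have RI: "hom_eval \<iota> F z \<in> R" for F unfolding R_def by blast
  have MI: "hom_eval \<iota> F z \<in> M" if "mpeval F v = 0" for F unfolding M_def using that by blast
  have UI: "hom_eval \<iota> F z \<in> U" if "mpeval F v \<noteq> 0" for F unfolding U_def using that by blast
  have RE: "\<exists>F. a = hom_eval \<iota> F z" if "a \<in> R" for a using that unfolding R_def by blast
  have ME: "\<exists>F. mpeval F v = 0 \<and> a = hom_eval \<iota> F z" if "a \<in> M" for a using that unfolding M_def by blast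
  have UE: "\<exists>F. mpeval F v \<noteq> 0 \<and> a = hom_eval \<iota> F z" if "a \<in> U" for a using that unfolding U_def by blast
  have "\<forall>j\<in>UNIV. \<exists>d\<in>U. \<exists>p\<in>R. d * w j = p * w r"
  proof (rule nakayama_elimination[where M = M])
    show "is_subring R"
      unfolding is_subring_def
    proof (intro conjI ballI)
      show "1 \<in> R" using RI[of 1] by simp
      fix a b assume "a \<in> R" "b \<in> R"
      from this[THEN RE] obtain F G where "a = hom_eval \<iota> F z" "b = hom_eval \<iota> G z" by blast
      thus "a - b \<in> R" "a * b \<in> R"
        using RI[of "F - G"] RI[of "F * G"] by (simp_all add: hom_eval_diff hom_eval_mult)
    qed
    show "is_proper_ideal R M"
      unfolding is_proper_ideal_def
    proof (intro conjI ballI)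
      show "M \<subseteq> R" unfolding R_def M_def by blast
      show "0 \<in> M" using MI[of 0] by simp
      show "1 \<notin> M"
      proof
        assume "1 \<in> M"
        from ME[OF this] obtain F where F: "mpeval F v = 0" "1 = hom_eval \<iota> F z" by blast
        hence "hom_eval \<iota> (F - 1) (normalized \<eta> v i) = 0" by (simp add: hom_eval_diff flip: z_def)
        hence "mpeval (F - 1) v = 0" by (rule specializes_normalized[OF spec i])
        thus False using F(1) by (simp add: mpeval_diff)
      qed
    next
      fix a b assume "a \<in> M" "b \<in> M"
      from this[THEN ME] obtain F G where
        "a = hom_eval \<iota> F z" "b = hom_eval \<iota> G z" "mpeval F v = 0" "mpeval G v = 0" by blast
      thus "a + b \<in> M" using MI[of "F + G"] by (simp add: hom_eval_add mpeval_add)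
    next
      fix a b assume ab: "a \<in> M" "b \<in> R"
      from ME[OF ab(1)] RE[OF ab(2)] obtain F G where
        "a = hom_eval \<iota> F z" "b = hom_eval \<iota> G z" "mpeval F v = 0" by blast
      thus "a * b \<in> M" using MI[of "F * G"] by (simp add: hom_eval_mult mpeval_mult)
    qed
    show "U \<subseteq> R" unfolding U_def R_def by blast
    show "1 \<in> U" using UI[of 1] by simp
    show "a * b \<in> U" if "a \<in> U" "b \<in> U" for a b
    proof -
      from that[THEN UE] obtain F G where
        "a = hom_eval \<iota> F z" "b = hom_eval \<iota> G z" "mpeval F v \<noteq> 0" "mpeval G v \<noteq> 0" by blast
      thus ?thesis using UI[of "F * G"] by (simp add: hom_eval_mult mpeval_mult)
    qed
    show "a - b \<in> U" if "a \<in> U" "b \<in> M" for a b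
    proof -
      from UE[OF that(1)] ME[OF that(2)] obtain F G where
        "a = hom_eval \<iota> F z" "b = hom_eval \<iota> G z" "mpeval F v \<noteq> 0" "mpeval G v = 0" by blast
      thus ?thesis using UI[of "F - G"] by (simp add: hom_eval_diff mpeval_diff)
    qed
    fix j
    from relation[of j] obtain a Q where Q: "\<forall>k. mpeval (Q k) v = 0"
      "w j = \<iota> a * w r + (\<Sum>k\<in>UNIV. hom_eval \<iota> (Q k) z * w k)" by blast
    have "\<iota> a \<in> R" using RI[of "mpconst a"] by simp
    show "\<exists>d\<in>U. \<exists>p\<in>R. \<exists>q. (\<forall>k\<in>UNIV. q k \<in> M) \<and> d * w j = p * w r + (\<Sum>k\<in>UNIV. q k * w k)"
    proof (intro bexI exI conjI ballI)
      show "1 * w j = \<iota> a * w r + (\<Sum>k\<in>UNIV. hom_eval \<iota> (Q k) z * w k)"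
        using Q(2) by (simp only: mult_1)
      show "hom_eval \<iota> (Q k) z \<in> M" for k using MI Q(1) by blast
    qed fact+
  qed simp
  hence uniform: "\<exists>d\<in>U. \<exists>p\<in>R. d * w j = p * w r" for j by blast
  define T where "T = (mpvar r - mpconst (v $ r) :: ('n, 'k) mpoly)"
  have "\<exists>F G. mpeval G v \<noteq> 0 \<and> hom_eval \<iota> G z * w j = hom_eval \<iota> T z * hom_eval \<iota> F z" for j
  proof -
    from uniform[of j] obtain d p where dp: "d \<in> U" "p \<in> R" "d * w j = p * w r" by blast
    from UE[OF dp(1)] obtain G where G: "mpeval G v \<noteq> 0" "d = hom_eval \<iota> G z" by blast
    from RE[OF dp(2)] obtain F where F: "p = hom_eval \<iota> F z" by blast
    have "hom_eval \<iota> G z * w j = hom_eval \<iota> T z * hom_eval \<iota> F z"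
      using dp(3) G(2) F by (simp add: T_def w_def hom_eval_diff mult.commute)
    thus ?thesis using G(1) by blast
  qed
  moreover have "mpeval T v = 0" by (simp add: T_def mpeval_diff)
  ultimately show ?thesis
    unfolding has_uniformizer_def z_def[symmetric] w_def[symmetric] by blast
qed

end

section \<open>The function field of a double cover of the line\<close>

text \<open>
  Stated for families rather than sets, as the vectors \<open>f i\<close> need not be distinct.
\<close>

lemma linear_relation:
  fixes f :: "'i \<Rightarrow> 'v::ab_group_add" and scale :: "'k::field \<Rightarrow> 'v \<Rightarrow> 'v"
  assumes "vector_space scale" "finite I" "finite T" "card T < card I"
    and "\<And>i. i \<in> I \<Longrightarrow> f i \<in> module.span scale T"
  shows "\<exists>c. (\<exists>i\<in>I. c i \<noteq> 0) \<and> (\<Sum>i\<in>I. scale (c i) (f i)) = 0"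
proof -
  interpret vector_space scale by fact
  show ?thesis
  proof (cases "inj_on f I")
    case True
    have "dependent (f ` I)"
    proof (rule ccontr)
      assume "\<not> dependent (f ` I)"
      hence "card (f ` I) \<le> card T"
        using independent_span_bound[OF \<open>finite T\<close>, of "f ` I"] assms(5) by blast
      thus False using card_image[OF True] assms(4) by simp
    qed
    then obtain u v where u: "v \<in> f ` I" "u v \<noteq> 0" "(\<Sum>v\<in>f ` I. scale (u v) v) = 0"
      using dependent_finite[of "f ` I"] \<open>finite I\<close> by blast
    have "(\<Sum>i\<in>I. scale (u (f i)) (f i)) = 0"
      using u(3) by (simp add: sum.reindex[OF True])
    thus ?thesis using u(1,2) by (intro exI[of _ "\<lambda>i. u (f i)"]) blast
  next
    case False
    then obtain a b where ab: "a \<in> I" "b \<in> I" "a \<noteq> b" "f a = f b" unfolding inj_on_def by blast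
    define c where "c i = (if i = a then 1 else if i = b then - 1 else (0 :: 'k))" for i
    have "(\<Sum>i\<in>I. scale (c i) (f i)) = (\<Sum>i\<in>{a, b}. scale (c i) (f i))"
      using ab \<open>finite I\<close> by (intro sum.mono_neutral_right) (auto simp: c_def)
    also have "\<dots> = 0" using ab by (simp add: c_def)
    finally show ?thesis using ab by (intro exI[of _ c]) (auto simp: c_def)
  qed
qed

text \<open>
  If \<open>g \<noteq> 0\<close>, then multiplying by \<open>X - a\<close> for all \<open>a \<in> A\<close> gives a nonconstant polynomial \<open>h\<close> that
  vanishes everywhere, and \<open>h + 1\<close> would have no root.
\<close>

lemma poly_eq_0_if_cofinitely_many_roots:
  fixes g :: "'k::alg_closed_field poly"
  assumes "finite A" "\<And>a. a \<notin> A \<Longrightarrow> poly g a = 0"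
  shows "g = 0"
proof (rule ccontr)
  assume "g \<noteq> 0"
  define h where "h = g * (\<Prod>a\<in>A. [:- a, 1:])"
  have h: "poly h a = 0" for a
    using assms by (cases "a \<in> A") (auto simp: h_def poly_prod)
  have "h \<noteq> 0" using \<open>g \<noteq> 0\<close> assms(1) by (auto simp: h_def)
  have "degree (h + 1) > 0"
  proof (rule ccontr)
    assume "\<not> degree (h + 1) > 0"
    then obtain c where "h + 1 = [:c:]" by (metis degree_eq_zeroE neq0_conv)
    hence "h = [:c - 1:]" by (metis add_diff_cancel_right' diff_pCons diff_zero one_pCons)
    thus False using h[of 0] \<open>h \<noteq> 0\<close> by simp
  qed
  then obtain a where "poly (h + 1) a = 0" using alg_closed_imp_poly_has_root by blast
  thus False using h[of a] by simp
qed

text \<open>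
  Comparing the values at the conjugate points \<open>(a, \<plusminus>b)\<close> shows that \<open>p\<close> and \<open>q f\<close> have almost
  all elements as roots.
\<close>

lemma curve_function_zero:
  fixes f :: "'k::alg_closed_field poly"
  assumes "f \<noteq> 0" "(2 :: 'k) \<noteq> 0" "finite A"
    and vanish: "\<And>a b. b\<^sup>2 = poly f a \<Longrightarrow> a \<notin> A \<Longrightarrow> poly p a + poly q a * b = 0"
  shows "p = 0 \<and> q = 0"
proof -
  have both: "poly p a = 0 \<and> poly (q * f) a = 0" if "a \<notin> A" for a
  proof -
    obtain b where b: "b\<^sup>2 = poly f a" using nth_root_exists[of 2 "poly f a"] by auto
    hence b': "(- b)\<^sup>2 = poly f a" by simp
    have 1: "poly p a + poly q a * b = 0" using vanish[OF b that] .
    have 2: "poly p a + poly q a * (- b) = 0" using vanish[OF b' that] .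
    from 1 2 have "2 * poly p a = 0" by (simp add: algebra_simps)
    hence p: "poly p a = 0" using assms(2) by simp
    hence "poly q a * b = 0" using 1 by simp
    thus ?thesis using p b by (auto simp: power2_eq_square)
  qed
  have "p = 0" "q * f = 0"
    using both by (intro poly_eq_0_if_cofinitely_many_roots[OF assms(3)], blast)+
  thus ?thesis using assms(1) by simp
qed

text \<open>
  The curve \<open>y\<^sup>2 = f(x)\<close>, realized in a field \<open>'o\<close> with \<open>x\<close> transcendental over the constants.
\<close>

locale double_cover = inj_idom_hom \<iota>
  for \<iota> :: "'k::alg_closed_field \<Rightarrow> 'o::field" +
  fixes f :: "'k poly" and x y :: 'o
  assumes equation: "y\<^sup>2 = hpoly \<iota> f x"
    and transcendental: "hpoly \<iota> p x = 0 \<Longrightarrow> p = 0"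
    and not_square: "p\<^sup>2 = q\<^sup>2 * f \<Longrightarrow> p = 0 \<and> q = 0"
    and two: "(2 :: 'k) \<noteq> 0"
begin

definition reg :: "'k poly \<Rightarrow> 'k poly \<Rightarrow> 'o" where
  "reg p q = hpoly \<iota> p x + hpoly \<iota> q x * y"

text \<open>
  The function \<open>\<phi>\<close> on the points of the affine curve and the element \<open>h\<close> of the function field are
  given by the same polynomial expression \<open>p(x) + q(x) y\<close>.
\<close>

definition corresponds :: "('k \<Rightarrow> 'k \<Rightarrow> 'k) \<Rightarrow> 'o \<Rightarrow> bool" where
  "corresponds \<phi> h \<longleftrightarrow>
     (\<exists>p q. h = reg p q \<and> (\<forall>a b. b\<^sup>2 = poly f a \<longrightarrow> \<phi> a b = poly p a + poly q a * b))"

lemma f_nonzero: "f \<noteq> 0"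
  using not_square[of 0 1] by auto

lemma reg_add: "reg p q + reg p' q' = reg (p + p') (q + q')"
  by (simp add: reg_def hpoly_add algebra_simps)

lemma reg_diff: "reg p q - reg p' q' = reg (p - p') (q - q')"
  by (simp add: reg_def hpoly_diff algebra_simps)

lemma reg_mult: "reg p q * reg p' q' = reg (p * p' + q * q' * f) (p * q' + q * p')"
proof -
  have "reg p q * reg p' q' =
      hpoly \<iota> p x * hpoly \<iota> p' x + hpoly \<iota> q x * hpoly \<iota> q' x * y\<^sup>2 +
      (hpoly \<iota> p x * hpoly \<iota> q' x + hpoly \<iota> q x * hpoly \<iota> p' x) * y"
    by (simp add: reg_def power2_eq_square algebra_simps)
  thus ?thesis by (simp add: reg_def equation hpoly_add hpoly_mult)
qed

text \<open>
  The norm \<open>p\<^sup>2 - q\<^sup>2 f\<close> vanishes, and \<open>f\<close> is not a square.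
\<close>

lemma reg_eq_0:
  assumes "reg p q = 0"
  shows "p = 0 \<and> q = 0"
proof -
  have "reg (p * p - q * q * f) 0 = reg p q * reg p (- q)"
    by (simp add: reg_mult)
  hence "hpoly \<iota> (p * p - q * q * f) x = 0" using assms by (simp add: reg_def)
  hence "p * p - q * q * f = 0" by (rule transcendental)
  thus ?thesis using not_square[of p q] by (simp add: power2_eq_square)
qed

lemma corresponds_const: "corresponds (\<lambda>a b. c) (\<iota> c)"
  unfolding corresponds_def by (intro exI[of _ "[:c:]"] exI[of _ 0]) (simp add: reg_def)

lemma corresponds_x: "corresponds (\<lambda>a b. a) x"
  unfolding corresponds_def by (intro exI[of _ "[:0, 1:]"] exI[of _ 0]) (simp add: reg_def)

lemma corresponds_y: "corresponds (\<lambda>a b. b) y"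
  unfolding corresponds_def by (intro exI[of _ 0] exI[of _ 1]) (simp add: reg_def)

lemma corresponds_add:
  assumes "corresponds \<phi> h" "corresponds \<psi> g"
  shows "corresponds (\<lambda>a b. \<phi> a b + \<psi> a b) (h + g)"
proof -
  from assms obtain p q p' q' where "h = reg p q" "g = reg p' q'"
    "\<And>a b. b\<^sup>2 = poly f a \<Longrightarrow> \<phi> a b = poly p a + poly q a * b"
    "\<And>a b. b\<^sup>2 = poly f a \<Longrightarrow> \<psi> a b = poly p' a + poly q' a * b"
    unfolding corresponds_def by blast
  thus ?thesis unfolding corresponds_def
    by (intro exI[of _ "p + p'"] exI[of _ "q + q'"]) (auto simp: reg_add algebra_simps)
qed

lemma corresponds_mult:
  assumes "corresponds \<phi> h" "corresponds \<psi> g"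
  shows "corresponds (\<lambda>a b. \<phi> a b * \<psi> a b) (h * g)"
proof -
  from assms obtain p q p' q' where *: "h = reg p q" "g = reg p' q'"
    "\<And>a b. b\<^sup>2 = poly f a \<Longrightarrow> \<phi> a b = poly p a + poly q a * b"
    "\<And>a b. b\<^sup>2 = poly f a \<Longrightarrow> \<psi> a b = poly p' a + poly q' a * b"
    unfolding corresponds_def by blast
  have "\<phi> a b * \<psi> a b = poly (p * p' + q * q' * f) a + poly (p * q' + q * p') a * b" if "b\<^sup>2 = poly f a" for a b
    unfolding *(3,4)[OF that] poly_add poly_mult that[symmetric]
    by (simp add: power2_eq_square algebra_simps)
  thus ?thesis unfolding corresponds_def using *(1,2)
    by (intro exI[of _ "p * p' + q * q' * f"] exI[of _ "p * q' + q * p'"]) (auto simp: reg_mult)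
qed

lemma corresponds_power: "corresponds \<phi> h \<Longrightarrow> corresponds (\<lambda>a b. \<phi> a b ^ n) (h ^ n)"
  using corresponds_const[of 1] by (induction n) (auto intro: corresponds_mult)

lemma corresponds_sum:
  "(\<And>i. i \<in> I \<Longrightarrow> corresponds (\<phi> i) (h i)) \<Longrightarrow> corresponds (\<lambda>a b. \<Sum>i\<in>I. \<phi> i a b) (\<Sum>i\<in>I. h i)"
  using corresponds_const[of 0] by (induction I rule: infinite_finite_induct) (auto intro: corresponds_add)

lemma corresponds_prod:
  "(\<And>i. i \<in> I \<Longrightarrow> corresponds (\<phi> i) (h i)) \<Longrightarrow> corresponds (\<lambda>a b. \<Prod>i\<in>I. \<phi> i a b) (\<Prod>i\<in>I. h i)"
  using corresponds_const[of 1] by (induction I rule: infinite_finite_induct) (auto intro: corresponds_mult)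

lemma corresponds_hom_eval:
  assumes "\<And>j. corresponds (\<lambda>a b. v a b $ j) (z $ j)"
  shows "corresponds (\<lambda>a b. hom_eval \<kappa> F (v a b)) (hom_eval (\<lambda>c. \<iota> (\<kappa> c)) F z)"
  unfolding hom_eval_def
  by (intro corresponds_sum corresponds_mult corresponds_const corresponds_prod corresponds_power assms)

text \<open>A function on the curve is zero at all points iff it is zero in the function field.\<close>

lemma corresponds_zero:
  assumes "corresponds \<phi> h"
  shows "h = 0 \<longleftrightarrow> (\<forall>a b. b\<^sup>2 = poly f a \<longrightarrow> \<phi> a b = 0)"
proof -
  from assms obtain p q where pq: "h = reg p q"
    "\<And>a b. b\<^sup>2 = poly f a \<Longrightarrow> \<phi> a b = poly p a + poly q a * b"
    unfolding corresponds_def by blast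
  show ?thesis
  proof
    assume "h = 0"
    hence "p = 0 \<and> q = 0" using pq(1) reg_eq_0 by simp
    thus "\<forall>a b. b\<^sup>2 = poly f a \<longrightarrow> \<phi> a b = 0" using pq(2) by simp
  next
    assume zero: "\<forall>a b. b\<^sup>2 = poly f a \<longrightarrow> \<phi> a b = 0"
    have "p = 0 \<and> q = 0"
      by (rule curve_function_zero[OF f_nonzero two, of "{}"]) (use pq(2) zero in force)+
    thus "h = 0" using pq(1) by (simp add: reg_def)
  qed
qed

subsection \<open>Algebraic dependence\<close>

text \<open>The filtration of the coordinate ring by degree, of linear growth.\<close>

definition bounded :: "nat \<Rightarrow> 'o set" where
  "bounded d = {reg p q | p q. degree p \<le> d \<and> degree q \<le> d}"

lemma bounded_mult:
  assumes "h \<in> bounded d" "g \<in> bounded e"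
  shows "h * g \<in> bounded (d + e + degree f)"
proof -
  from assms obtain p q p' q' where *: "h = reg p q" "g = reg p' q'"
    "degree p \<le> d" "degree q \<le> d" "degree p' \<le> e" "degree q' \<le> e"
    unfolding bounded_def by blast
  have deg: "degree (r * s) \<le> d + e" if "degree r \<le> d" "degree s \<le> e" for r s :: "'k poly"
    using order.trans[OF degree_mult_le add_mono[OF that]] .
  have "degree (q * q' * f) \<le> d + e + degree f"
    by (rule order.trans[OF degree_mult_le]) (use deg * in simp)
  hence "degree (p * p' + q * q' * f) \<le> d + e + degree f"
    using deg[of p p'] * by (intro degree_add_le) auto
  moreover have "degree (p * q' + q * p') \<le> d + e + degree f"
    using deg[of p q'] deg[of q p'] * by (intro degree_add_le) auto
  ultimately show ?thesis
    unfolding *(1,2) reg_mult bounded_def by blast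
qed

lemma bounded_power: "h \<in> bounded d \<Longrightarrow> h ^ n \<in> bounded (n * (d + degree f))"
proof (induction n)
  case 0
  have "1 = reg 1 0" by (simp add: reg_def)
  thus ?case unfolding bounded_def by force
next
  case (Suc n)
  from bounded_mult[OF Suc.prems Suc.IH[OF Suc.prems]] show ?case by (simp add: algebra_simps)
qed

lemma bounded_in_span:
  assumes "h \<in> bounded d"
  shows "h \<in> module.span (\<lambda>a h. \<iota> a * h) ((\<lambda>i. x ^ i) ` {..d} \<union> (\<lambda>i. x ^ i * y) ` {..d})"
proof -
  interpret vector_space "\<lambda>a h. \<iota> a * h"
    by unfold_locales (simp_all add: hom_add hom_mult algebra_simps)
  let ?T = "(\<lambda>i. x ^ i) ` {..d} \<union> (\<lambda>i. x ^ i * y) ` {..d}"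
  from assms obtain p q where *: "h = reg p q" "degree p \<le> d" "degree q \<le> d"
    unfolding bounded_def by blast
  have expand: "hpoly \<iota> r x = (\<Sum>i\<le>d. \<iota> (coeff r i) * x ^ i)" if "degree r \<le> d" for r
  proof -
    have "r = (\<Sum>i\<le>d. monom (coeff r i) i)" by (rule poly_as_sum_of_monoms'[OF that, symmetric])
    hence "hpoly \<iota> r x = hpoly \<iota> (\<Sum>i\<le>d. monom (coeff r i) i) x" by (rule arg_cong)
    also have "\<dots> = (\<Sum>i\<le>d. \<iota> (coeff r i) * x ^ i)" by (simp only: hpoly_sum hpoly_monom)
    finally show ?thesis .
  qed
  have "h = (\<Sum>i\<le>d. \<iota> (coeff p i) * x ^ i) + (\<Sum>i\<le>d. \<iota> (coeff q i) * (x ^ i * y))"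
    unfolding *(1) reg_def expand[OF *(2)] expand[OF *(3)] by (simp add: sum_distrib_right mult.assoc)
  also have "\<dots> \<in> span ?T"
    by (intro span_add span_sum span_scale) (rule span_base, blast)+
  finally show ?thesis .
qed

definition fractions :: "'o set" where
  "fractions = {a / b | a b. a \<in> range (case_prod reg) \<and> b \<in> range (case_prod reg) \<and> b \<noteq> 0}"

text \<open>
  Two functions with a common denominator \<open>D\<close> generate \<open>(n+1)\<^sup>2\<close> products of degree \<open>2n\<close> with
  numerators in a space whose dimension grows only linearly in \<open>n\<close>.
\<close>

lemma fractions_dependent:
  assumes "h \<in> fractions" "u \<in> fractions"
  shows "algebraically_dependent \<iota> h u"
proof -
  have in_bounded: "\<exists>d. a \<in> bounded d" if "a \<in> range (case_prod reg)" for a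
  proof -
    from that obtain p q where "a = reg p q" by auto
    moreover have "degree p \<le> max (degree p) (degree q)" "degree q \<le> max (degree p) (degree q)" by simp_all
    ultimately show ?thesis unfolding bounded_def by blast
  qed
  have mono: "a \<in> bounded e" if "a \<in> bounded d" "d \<le> e" for a d e
    using that unfolding bounded_def by (auto intro: order.trans)
  obtain a1 b1 where 1: "h = a1 / b1" "a1 \<in> range (case_prod reg)" "b1 \<in> range (case_prod reg)" "b1 \<noteq> 0"
    using assms(1) unfolding fractions_def by blast
  obtain a2 b2 where 2: "u = a2 / b2" "a2 \<in> range (case_prod reg)" "b2 \<in> range (case_prod reg)" "b2 \<noteq> 0"
    using assms(2) unfolding fractions_def by blast
  have mult: "a * b \<in> range (case_prod reg)"
    if "a \<in> range (case_prod reg)" "b \<in> range (case_prod reg)" for a b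
  proof -
    from that obtain p q p' q' where "a = reg p q" "b = reg p' q'" by auto
    thus ?thesis by (intro range_eqI[of _ _ "(p * p' + q * q' * f, p * q' + q * p')"]) (simp add: reg_mult)
  qed
  define D A C where "D = b1 * b2" and "A = a1 * b2" and "C = a2 * b1"
  have D: "D \<noteq> 0" "h = A / D" "u = C / D" using 1 2 by (simp_all add: D_def A_def C_def)
  have "D \<in> range (case_prod reg)" "A \<in> range (case_prod reg)" "C \<in> range (case_prod reg)"
    unfolding D_def A_def C_def using mult 1 2 by blast+
  from this[THEN in_bounded] obtain d1 d2 d3 where
    d: "D \<in> bounded d1" "A \<in> bounded d2" "C \<in> bounded d3" by blast
  define d where "d = d1 + d2 + d3"
  have bd: "D \<in> bounded d" "A \<in> bounded d" "C \<in> bounded d"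
    using mono[OF d(1), of d] mono[OF d(2), of d] mono[OF d(3), of d] by (simp_all add: d_def)
  define m where "m = d + 2 * degree f"
  define n where "n = 8 * (m + 1)"
  define g where "g = (\<lambda>(i, j). (D ^ (2 * n - i - j) * A ^ i) * C ^ j)"
  have g_bounded: "g (i, j) \<in> bounded (2 * n * (d + degree f) + 2 * degree f)" if "i \<le> n" "j \<le> n" for i j
  proof -
    have "(D ^ (2 * n - i - j) * A ^ i) * C ^ j \<in>
        bounded ((2 * n - i - j) * (d + degree f) + i * (d + degree f) + degree f + j * (d + degree f) + degree f)"
      by (intro bounded_mult bounded_power bd)
    also have "(2 * n - i - j) * (d + degree f) + i * (d + degree f) + degree f + j * (d + degree f) + degree f =
        ((2 * n - i - j) + i + j) * (d + degree f) + 2 * degree f"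
      by (simp add: algebra_simps)
    also have "(2 * n - i - j) + i + j = 2 * n" using that by simp
    finally show ?thesis by (simp add: g_def)
  qed
  define M where "M = 2 * n * (d + degree f) + 2 * degree f"
  define T where "T = (\<lambda>i. x ^ i) ` {..M} \<union> (\<lambda>i. x ^ i * y) ` {..M}"
  interpret V: vector_space "\<lambda>a h. \<iota> a * h"
    by unfold_locales (simp_all add: hom_add hom_mult algebra_simps)
  have "card T \<le> card {..M} + card {..M}"
    unfolding T_def by (rule order.trans[OF card_Un_le add_mono]) (rule card_image_le, simp)+
  also have "\<dots> < (n + 1) * (n + 1)"
  proof -
    have "M \<le> 2 * (n * m) + m" unfolding M_def m_def by (simp add: algebra_simps)
    moreover have "n * n = 8 * (n * m) + 8 * n"
      by (subst (2) n_def) (simp add: algebra_simps)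
    moreover have "m \<le> n" "8 \<le> n" by (simp_all add: n_def)
    moreover have "(n + 1) * (n + 1) = n * n + 2 * n + 1" by (simp add: algebra_simps)
    ultimately show ?thesis by simp
  qed
  finally have "card T < card ({..n} \<times> {..n})" by (simp add: card_cartesian_product)
  moreover have "g ij \<in> V.span T" if "ij \<in> {..n} \<times> {..n}" for ij
    using that bounded_in_span[OF g_bounded] unfolding T_def M_def by (cases ij) auto
  ultimately obtain c where c: "\<exists>ij\<in>{..n} \<times> {..n}. c ij \<noteq> 0" "(\<Sum>ij\<in>{..n} \<times> {..n}. \<iota> (c ij) * g ij) = 0"
    using linear_relation[OF V.vector_space_axioms, of "{..n} \<times> {..n}" T g] unfolding T_def by auto
  have "g (i, j) = D ^ (2 * n) * (h ^ i * u ^ j)" if "i \<le> n" "j \<le> n" for i j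
  proof -
    have "D ^ (2 * n) = D ^ (2 * n - i - j) * D ^ i * D ^ j"
      using that by (simp flip: power_add)
    thus ?thesis using D by (simp add: g_def power_divide)
  qed
  hence "(\<Sum>ij\<in>{..n} \<times> {..n}. \<iota> (c ij) * g ij) =
      (\<Sum>ij\<in>{..n} \<times> {..n}. D ^ (2 * n) * (\<iota> (c ij) * h ^ fst ij * u ^ snd ij))"
    by (intro sum.cong) auto
  also have "\<dots> = D ^ (2 * n) * (\<Sum>i\<le>n. \<Sum>j\<le>n. \<iota> (c (i, j)) * h ^ i * u ^ j)"
    by (simp add: sum_distrib_left sum.cartesian_product case_prod_beta)
  finally have "(\<Sum>i\<le>n. \<Sum>j\<le>n. \<iota> (c (i, j)) * h ^ i * u ^ j) = 0"
    using c(2) D(1) by simp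
  thus ?thesis unfolding algebraically_dependent_def using c(1)
    by (intro exI[of _ n] exI[of _ "\<lambda>i j. c (i, j)"]) auto
qed

lemma fractions_field: "function_field \<iota> fractions"
proof -
  let ?E = "range (case_prod reg)"
  have E: "reg p q \<in> ?E" for p q by (rule range_eqI[of _ _ "(p, q)"]) simp
  have EE: "\<exists>p q. a = reg p q" if "a \<in> ?E" for a using that by auto
  have mult: "a * b \<in> ?E" if "a \<in> ?E" "b \<in> ?E" for a b
    using EE[OF that(1)] EE[OF that(2)] by (auto simp: reg_mult E)
  have diff: "a - b \<in> ?E" if "a \<in> ?E" "b \<in> ?E" for a b
    using EE[OF that(1)] EE[OF that(2)] by (auto simp: reg_diff E)
  have one: "1 \<in> ?E" using E[of 1 0] by (simp add: reg_def)
  have I: "a / b \<in> fractions" if "a \<in> ?E" "b \<in> ?E" "b \<noteq> 0" for a b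
    unfolding fractions_def using that by blast
  have Ex: "\<exists>a b. h = a / b \<and> a \<in> ?E \<and> b \<in> ?E \<and> b \<noteq> 0" if "h \<in> fractions" for h
    using that unfolding fractions_def by blast
  show ?thesis
  proof
    show "is_subring fractions"
      unfolding is_subring_def
    proof (intro conjI ballI)
      show "1 \<in> fractions" using I[OF one one] by simp
      fix h g assume "h \<in> fractions" "g \<in> fractions"
      then obtain a b a' b' where *: "h = a / b" "a \<in> ?E" "b \<in> ?E" "b \<noteq> 0" "g = a' / b'" "a' \<in> ?E" "b' \<in> ?E" "b' \<noteq> 0"
        using Ex by metis
      have "h - g = (a * b' - a' * b) / (b * b')" "h * g = (a * a') / (b * b')"
        using * by (simp_all add: diff_frac_eq)
      thus "h - g \<in> fractions" "h * g \<in> fractions"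
        using I[of "a * b' - a' * b" "b * b'"] I[of "a * a'" "b * b'"] mult diff * by simp_all
    qed
    show "inverse h \<in> fractions" if "h \<in> fractions" for h
    proof -
      from Ex[OF that] obtain a b where *: "h = a / b" "a \<in> ?E" "b \<in> ?E" "b \<noteq> 0" by blast
      show ?thesis
      proof (cases "a = 0")
        case True
        thus ?thesis using * that by simp
      next
        case False
        thus ?thesis using I[of b a] * by simp
      qed
    qed
    show "\<iota> a \<in> fractions" for a
      using I[OF E[of "[:a:]" 0] one] by (simp add: reg_def)
    show "algebraically_dependent \<iota> h u" if "h \<in> fractions" "u \<in> fractions" for h u
      by (rule fractions_dependent[OF that])
    show "\<exists>h\<in>fractions. h \<notin> range \<iota>"
    proof
      show "x \<in> fractions" using I[OF E[of "[:0, 1:]" 0] one] by (simp add: reg_def)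
      show "x \<notin> range \<iota>"
      proof
        assume "x \<in> range \<iota>"
        then obtain a where "x = \<iota> a" by blast
        hence "hpoly \<iota> [:- a, 1:] x = 0" by (simp add: hom_uminus)
        hence "[:- a, 1:] = (0 :: 'k poly)" by (rule transcendental)
        thus False by simp
      qed
    qed
  qed
qed

sublocale field: function_field \<iota> fractions
  by (rule fractions_field)

lemma corresponds_in_fractions: "corresponds \<phi> h \<Longrightarrow> h \<in> fractions"
proof -
  assume "corresponds \<phi> h"
  then obtain p q where "h = reg p q" unfolding corresponds_def by blast
  moreover have "1 = reg 1 0" by (simp add: reg_def)
  ultimately have "h = reg p q / reg 1 0" "reg 1 0 \<noteq> 0" by (simp, metis one_neq_zero)
  thus ?thesis unfolding fractions_def by fastforce
qed

text \<open>
  The fractions of polynomials in the coordinates of \<open>z\<close> form a field, so it is enough that \<open>x\<close>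
  and \<open>y\<close> are among them.
\<close>

lemma generatesI:
  assumes "hom_eval \<iota> G z \<noteq> 0" "x = hom_eval \<iota> F z / hom_eval \<iota> G z"
    and "hom_eval \<iota> G' z \<noteq> 0" "y = hom_eval \<iota> F' z / hom_eval \<iota> G' z"
  shows "field.generates z"
proof -
  define Q where "Q = {h. \<exists>F G. hom_eval \<iota> G z \<noteq> 0 \<and> h = hom_eval \<iota> F z / hom_eval \<iota> G z}"
  have QI: "h \<in> Q" if "hom_eval \<iota> G z \<noteq> 0" "h = hom_eval \<iota> F z / hom_eval \<iota> G z" for h F G
    unfolding Q_def using that by blast
  have QE: "\<exists>F G. hom_eval \<iota> G z \<noteq> 0 \<and> h = hom_eval \<iota> F z / hom_eval \<iota> G z" if "h \<in> Q" for h
    using that unfolding Q_def by blast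
  have const: "\<iota> a \<in> Q" for a by (rule QI[of 1 _ "mpconst a"]) simp_all
  have add: "h + g \<in> Q" if "h \<in> Q" "g \<in> Q" for h g
  proof -
    from that[THEN QE] obtain F G F' G' where *: "hom_eval \<iota> G z \<noteq> 0" "h = hom_eval \<iota> F z / hom_eval \<iota> G z"
      "hom_eval \<iota> G' z \<noteq> 0" "g = hom_eval \<iota> F' z / hom_eval \<iota> G' z" by blast
    show ?thesis
      by (rule QI[of "G * G'" _ "F * G' + F' * G"])
         (use * in \<open>simp_all add: hom_eval_mult hom_eval_add add_frac_eq\<close>)
  qed
  have mult: "h * g \<in> Q" if "h \<in> Q" "g \<in> Q" for h g
  proof -
    from that[THEN QE] obtain F G F' G' where *: "hom_eval \<iota> G z \<noteq> 0" "h = hom_eval \<iota> F z / hom_eval \<iota> G z"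
      "hom_eval \<iota> G' z \<noteq> 0" "g = hom_eval \<iota> F' z / hom_eval \<iota> G' z" by blast
    show ?thesis
      by (rule QI[of "G * G'" _ "F * F'"]) (use * in \<open>simp_all add: hom_eval_mult\<close>)
  qed
  have x_in: "x \<in> Q" and y_in: "y \<in> Q"
    by (rule QI[OF assms(1,2)], rule QI[OF assms(3,4)])
  have "hpoly \<iota> p x \<in> Q" for p
    using const[of 0] by (induction p) (auto intro!: add mult const x_in)
  hence reg_in: "reg p q \<in> Q" for p q
    unfolding reg_def by (intro add mult y_in)
  show ?thesis
    unfolding field.generates_def
  proof
    fix h assume "h \<in> fractions"
    then obtain p q r s where "h = reg p q / reg r s" "reg r s \<noteq> 0"
      unfolding fractions_def by auto
    moreover from QE[OF reg_in[of p q]] QE[OF reg_in[of r s]] obtain F G F' G' where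
      *: "hom_eval \<iota> G z \<noteq> 0" "reg p q = hom_eval \<iota> F z / hom_eval \<iota> G z"
      "hom_eval \<iota> G' z \<noteq> 0" "reg r s = hom_eval \<iota> F' z / hom_eval \<iota> G' z" by blast
    ultimately have "hom_eval \<iota> (G * F') z \<noteq> 0" "h = hom_eval \<iota> (F * G') z / hom_eval \<iota> (G * F') z"
      by (auto simp: hom_eval_mult)
    thus "\<exists>F G. hom_eval \<iota> G z \<noteq> 0 \<and> h = hom_eval \<iota> F z / hom_eval \<iota> G z" by blast
  qed
qed

end

section \<open>The function field of the quartic inside Laurent series\<close>

text \<open>
  Comparing coefficients in \<open>b\<^sup>2 = g\<close>, with \<open>b\<^sub>0 = 1\<close>, determines \<open>2 b\<^sub>n\<^sub>+\<^sub>1\<close> from the earlier ones.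
\<close>

function sqrt_coeff :: "(nat \<Rightarrow> 'a::field) \<Rightarrow> nat \<Rightarrow> 'a" where
  "sqrt_coeff a 0 = 1"
| "sqrt_coeff a (Suc n) = (a (Suc n) - (\<Sum>i\<in>{1..n}. sqrt_coeff a i * sqrt_coeff a (Suc n - i))) / 2"
  by pat_completeness auto
termination by (relation "measure snd") auto

declare sqrt_coeff.simps [simp del]

definition fps_sqrt :: "'a::field fps \<Rightarrow> 'a fps" where
  "fps_sqrt g = Abs_fps (sqrt_coeff (fps_nth g))"

lemma fps_sqrt_square:
  fixes g :: "'a::field fps"
  assumes "(2 :: 'a) \<noteq> 0" "fps_nth g 0 = 1"
  shows "fps_sqrt g * fps_sqrt g = g"
proof (rule fps_ext)
  fix n
  show "fps_nth (fps_sqrt g * fps_sqrt g) n = fps_nth g n"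
  proof (cases n)
    case 0
    thus ?thesis using assms by (simp add: fps_sqrt_def sqrt_coeff.simps)
  next
    case (Suc m)
    define b where "b = sqrt_coeff (fps_nth g)"
    have "fps_nth (fps_sqrt g * fps_sqrt g) (Suc m) = (\<Sum>i=0..Suc m. b i * b (Suc m - i))"
      by (simp add: fps_mult_nth fps_sqrt_def b_def)
    also have "\<dots> = b 0 * b (Suc m) + (\<Sum>i\<in>{1..m}. b i * b (Suc m - i)) + b (Suc m) * b 0"
      by (simp add: sum.atLeast_Suc_atMost)
    also have "b 0 = 1" by (simp add: b_def sqrt_coeff.simps)
    also have "1 * b (Suc m) + (\<Sum>i\<in>{1..m}. b i * b (Suc m - i)) + b (Suc m) * 1 =
        2 * b (Suc m) + (\<Sum>i\<in>{1..m}. b i * b (Suc m - i))"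
      by (simp only: mult_2 mult_1 mult_1_right ac_simps)
    also have "2 * b (Suc m) = fps_nth g (Suc m) - (\<Sum>i\<in>{1..m}. b i * b (Suc m - i))"
      using assms(1) by (simp add: b_def sqrt_coeff.simps(2))
    also have "\<dots> + (\<Sum>i\<in>{1..m}. b i * b (Suc m - i)) = fps_nth g (Suc m)"
      by (rule diff_add_cancel)
    finally show ?thesis using Suc by simp
  qed
qed

definition fls_map :: "('a::zero \<Rightarrow> 'a) \<Rightarrow> 'a fls \<Rightarrow> 'a fls" where
  "fls_map \<tau> h = Abs_fls (\<lambda>n. \<tau> (fls_nth h n))"

locale fls_map_hom = inj_idom_hom \<tau> for \<tau> :: "'a::field \<Rightarrow> 'a"
begin

lemma fls_map_nth [simp]: "fls_nth (fls_map \<tau> h) n = \<tau> (fls_nth h n)"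
  unfolding fls_map_def by (rule nth_Abs_fls_lower_bound[of "fls_subdegree h"]) auto

lemma fls_map_subdegree [simp]: "fls_subdegree (fls_map \<tau> h) = fls_subdegree h"
proof (cases "h = 0")
  case True
  hence "fls_map \<tau> h = 0" by (intro fls_eqI) simp
  thus ?thesis using True by simp
next
  case False
  thus ?thesis by (intro fls_subdegree_eqI) auto
qed

lemma fls_map_is_hom: "inj_idom_hom (fls_map \<tau>)"
proof
  show "fls_map \<tau> (h + g) = fls_map \<tau> h + fls_map \<tau> g" for h g
    by (intro fls_eqI) (simp add: hom_add)
  show "fls_map \<tau> 1 = 1"
    by (intro fls_eqI) simp
  show "fls_map \<tau> (h * g) = fls_map \<tau> h * fls_map \<tau> g" for h g
    by (intro fls_eqI) (simp add: fls_times_nth(2) hom_sum hom_mult)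
  show "h = 0" if "fls_map \<tau> h = 0" for h
  proof (rule fls_eqI)
    fix n
    have "\<tau> (fls_nth h n) = 0" using that by (metis fls_map_nth fls_zero_nth)
    thus "fls_nth h n = fls_nth 0 n" by simp
  qed
qed (intro fls_eqI, simp)

lemma fls_map_const: "fls_map \<tau> (fls_const a) = fls_const (\<tau> a)"
  by (intro fls_eqI) simp

lemma fls_map_X_inv: "fls_map \<tau> fls_X_inv = fls_X_inv"
  by (intro fls_eqI) simp

end

definition quartic_poly :: "'k::field \<Rightarrow> 'k poly" where
  "quartic_poly c = [:- 1, 0, 1:] * [:- c, 0, 1:]"

lemma poly_quartic: "poly (quartic_poly c) a = (a\<^sup>2 - 1) * (a\<^sup>2 - c)"
  by (simp add: quartic_poly_def power2_eq_square algebra_simps)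

text \<open>The root \<open>1\<close> of the quartic is simple, so the quartic is not a square.\<close>

lemma quartic_not_square:
  fixes c :: "'k::field"
  assumes "(2 :: 'k) \<noteq> 0" "c \<noteq> 1" "p\<^sup>2 = q\<^sup>2 * quartic_poly c"
  shows "p = 0 \<and> q = 0"
proof (rule ccontr)
  assume no: "\<not> (p = 0 \<and> q = 0)"
  have f0: "quartic_poly c \<noteq> 0" by (simp add: quartic_poly_def)
  hence nz: "p \<noteq> 0" "q \<noteq> 0" using no assms(3) by auto
  define r where "r = [:1, 1:] * [:- c, 0, 1:]"
  have f: "quartic_poly c = [:- 1, 1:] ^ 1 * r"
    by (simp add: quartic_poly_def r_def)
  have "poly r 1 \<noteq> 0" using assms(1,2) by (simp add: r_def)
  hence "order 1 r = 0" by (rule order_0I)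
  hence "order 1 (quartic_poly c) = 1"
    unfolding f using f0 by (subst order_mult) (simp_all only: f[symmetric] order_power_n_n not_False_eq_True)
  moreover have "order 1 (p\<^sup>2) = 2 * order 1 p" "order 1 (q\<^sup>2) = 2 * order 1 q"
    using nz by (simp_all add: order_power_n_n power2_eq_square order_mult)
  moreover have "order 1 (q\<^sup>2 * quartic_poly c) = order 1 (q\<^sup>2) + order 1 (quartic_poly c)"
    using nz f0 by (intro order_mult) simp
  ultimately have "2 * order 1 p = 2 * order 1 q + 1" using assms(3) by simp
  thus False by presburger
qed

text \<open>
  The expansion at infinity, in \<open>s = 1/x\<close>, of \<open>y = x\<^sup>2 sqrt ((1 - s\<^sup>2)(1 - c s\<^sup>2))\<close>.
\<close>

definition quartic_y :: "'k::field \<Rightarrow> 'k fls" where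
  "quartic_y c = fls_X_inv\<^sup>2 * fps_to_fls (fps_sqrt ((1 - fps_X\<^sup>2) * (1 - fps_const c * fps_X\<^sup>2)))"

lemma inj_idom_hom_fls_const: "inj_idom_hom (fls_const :: 'k::field \<Rightarrow> 'k fls)"
  by unfold_locales (auto simp: fls_plus_const)

text \<open>
  A polynomial in \<open>x = 1/s\<close> has its coefficients at the nonpositive powers of \<open>s\<close>, so \<open>x\<close> is
  transcendental.
\<close>

lemma hpoly_X_inv_nth:
  fixes p :: "'k::field poly"
  shows "fls_nth (hpoly fls_const p fls_X_inv) n = (if n \<le> 0 then coeff p (nat (- n)) else 0)"
proof (induction p arbitrary: n)
  case 0
  interpret inj_idom_hom "fls_const :: 'k \<Rightarrow> 'k fls" by (rule inj_idom_hom_fls_const)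
  show ?case by simp
next
  case (pCons a p)
  interpret inj_idom_hom "fls_const :: 'k \<Rightarrow> 'k fls" by (rule inj_idom_hom_fls_const)
  show ?case
  proof (cases "n < 0")
    case True
    hence "nat (- n) = Suc (nat (- (n + 1)))" by simp
    thus ?thesis using True by (simp add: fls_X_inv_times_conv_shift(1) pCons.IH)
  next
    case False
    thus ?thesis by (cases "n = 0") (simp_all add: fls_X_inv_times_conv_shift(1) pCons.IH)
  qed
qed

locale quartic =
  fixes c :: "'k::alg_closed_field" and \<tau> :: "'k \<Rightarrow> 'k"
  assumes c: "c \<noteq> 0" "c \<noteq> 1" and two_nonzero: "(2 :: 'k) \<noteq> 0"
    and \<tau>_is_hom: "inj_idom_hom \<tau>" and \<tau>_is_surj: "surj \<tau>" and \<tau>_c: "\<tau> c = c"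
begin

sublocale const: inj_idom_hom "fls_const :: 'k \<Rightarrow> 'k fls" by (rule inj_idom_hom_fls_const)

sublocale F: fls_map_hom \<tau> unfolding fls_map_hom_def by (rule \<tau>_is_hom)

definition reciprocal_quartic :: "'k fps" where "reciprocal_quartic = (1 - fps_X\<^sup>2) * (1 - fps_const c * fps_X\<^sup>2)"

lemma reciprocal_quartic_0: "fps_nth reciprocal_quartic 0 = 1"
  by (simp add: reciprocal_quartic_def power2_eq_square)

lemma quartic_y_square: "(quartic_y c)\<^sup>2 = hpoly fls_const (quartic_poly c) fls_X_inv"
proof -
  define s :: "'k fls" where "s = fls_X"
  have sx: "fls_X_inv * s = 1" unfolding s_def by (simp flip: fls_inverse_X)
  have "(quartic_y c)\<^sup>2 = fls_X_inv ^ 4 * fps_to_fls (fps_sqrt reciprocal_quartic * fps_sqrt reciprocal_quartic)"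
    unfolding quartic_y_def reciprocal_quartic_def[symmetric]
    by (simp add: power_mult_distrib fls_times_fps_to_fls power2_eq_square power4_eq_xxxx)
  also have "fps_to_fls (fps_sqrt reciprocal_quartic * fps_sqrt reciprocal_quartic) = (1 - s\<^sup>2) * (1 - fls_const c * s\<^sup>2)"
    unfolding fps_sqrt_square[OF two_nonzero reciprocal_quartic_0]
    by (simp add: reciprocal_quartic_def fls_times_fps_to_fls fps_to_fls_power s_def)
  also have "fls_X_inv ^ 4 * ((1 - s\<^sup>2) * (1 - fls_const c * s\<^sup>2)) =
      (fls_X_inv\<^sup>2 - (fls_X_inv * s)\<^sup>2) * (fls_X_inv\<^sup>2 - fls_const c * (fls_X_inv * s)\<^sup>2)"
    by (simp add: power4_eq_xxxx power2_eq_square algebra_simps)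
  also have "\<dots> = (fls_X_inv\<^sup>2 - 1) * (fls_X_inv\<^sup>2 - fls_const c)"
    unfolding sx by simp
  also have "\<dots> = hpoly fls_const (quartic_poly c) fls_X_inv"
    unfolding quartic_poly_def const.hpoly_mult
    by (simp add: const.hom_uminus power2_eq_square algebra_simps)
  finally show ?thesis .
qed

sublocale cover: double_cover fls_const "quartic_poly c" fls_X_inv "quartic_y c"
proof
  show "(quartic_y c)\<^sup>2 = hpoly fls_const (quartic_poly c) fls_X_inv" by (rule quartic_y_square)
  show "p = 0" if "hpoly fls_const p fls_X_inv = 0" for p :: "'k poly"
  proof (rule poly_eqI)
    fix n
    have "fls_nth (hpoly fls_const p fls_X_inv) (- int n) = 0" using that by simp
    thus "coeff p n = coeff 0 n" by (simp add: hpoly_X_inv_nth)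
  qed
  show "p = 0 \<and> q = 0" if "p\<^sup>2 = q\<^sup>2 * quartic_poly c" for p q
    by (rule quartic_not_square[OF two_nonzero c(2) that])
qed (rule two_nonzero)

lemma \<sigma>_y: "fls_map \<tau> (quartic_y c) = quartic_y c"
proof -
  interpret \<sigma>: inj_idom_hom "fls_map \<tau>" by (rule F.fls_map_is_hom)
  define b where "b = fps_to_fls (fps_sqrt reciprocal_quartic)"
  have b_square: "b * b = fps_to_fls reciprocal_quartic"
    unfolding b_def by (simp add: fps_sqrt_square[OF two_nonzero reciprocal_quartic_0] flip: fls_times_fps_to_fls)
  have X: "fls_map \<tau> fls_X = fls_X" by (intro fls_eqI) simp
  have "fps_to_fls reciprocal_quartic = (1 - fls_X\<^sup>2) * (1 - fls_const c * fls_X\<^sup>2)"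
    by (simp add: reciprocal_quartic_def fls_times_fps_to_fls fps_to_fls_power)
  hence "fls_map \<tau> (fps_to_fls reciprocal_quartic) = fps_to_fls reciprocal_quartic"
    by (simp add: \<sigma>.hom_mult \<sigma>.hom_minus \<sigma>.hom_power X F.fls_map_const \<tau>_c)
  hence "fls_map \<tau> b * fls_map \<tau> b = b * b"
    by (simp add: b_square flip: \<sigma>.hom_mult)
  hence "(fls_map \<tau> b - b) * (fls_map \<tau> b + b) = 0" by (simp add: algebra_simps)
  moreover have "fls_map \<tau> b + b \<noteq> 0"
  proof
    \<comment> \<open>The square roots with constant coefficients \<open>1\<close> and \<open>- 1\<close> differ.\<close>
    assume *: "fls_map \<tau> b + b = 0"
    have "fls_nth b 0 = 1" by (simp add: b_def fps_sqrt_def sqrt_coeff.simps)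
    hence "fls_nth (fls_map \<tau> b + b) 0 = 2" by simp
    thus False using * two_nonzero by simp
  qed
  ultimately have "fls_map \<tau> b = b" by simp
  thus ?thesis
    by (simp add: quartic_y_def \<sigma>.hom_mult \<sigma>.hom_power F.fls_map_X_inv flip: reciprocal_quartic_def b_def)
qed

sublocale frobenius: function_field_frobenius fls_const cover.fractions \<tau> "fls_map \<tau>"
  by (intro function_field_frobenius.intro function_field_frobenius_axioms.intro
      cover.fractions_field \<tau>_is_hom \<tau>_is_surj F.fls_map_is_hom F.fls_map_const)

end

(* It would undo the distribution of fls_const over products. *)
declare fls_const_mult_const [simp del]

section \<open>A nonsingular model in space\<close>

lemma form_of_degree_mpvar: "form_of_degree 1 (mpvar i)"
  using form_of_degree_single[of "Poly_Mapping.single i 1" 1] by (simp add: mpvar_def)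

lemma form_of_degree_mpconst: "form_of_degree 0 (mpconst a)"
  using form_of_degree_single[of 0 a] by (simp add: mpconst_def)

lemma form_of_degree_scale: "form_of_degree d F \<Longrightarrow> form_of_degree d (mpconst a * F)"
  using form_of_degree_mult[OF form_of_degree_mpconst, of d F a] by simp

lemma form_of_degree_uminus: "form_of_degree d F \<Longrightarrow> form_of_degree d (- F)"
  unfolding form_of_degree_def by (simp add: in_keys_iff)

lemma form_of_degree_diff: "form_of_degree d F \<Longrightarrow> form_of_degree d G \<Longrightarrow> form_of_degree d (F - G)"
  using form_of_degree_add[OF _ form_of_degree_uminus, of d F G] by simp

definition quad :: "'a \<Rightarrow> 'a \<Rightarrow> 'a \<Rightarrow> 'a \<Rightarrow> 'a ^ 4" where
  "quad a b d e = (\<chi> i. if i = 1 then a else if i = 2 then b else if i = 3 then d else e)"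

lemma quad_nth [simp]: "quad a b d e $ 1 = a" "quad a b d e $ 2 = b" "quad a b d e $ 3 = d" "quad a b d e $ 4 = e"
  by (simp_all add: quad_def)

lemma hom_eval_zero_if_proportional:
  assumes "comm_ring_hom \<phi>" "form_of_degree d F" "hom_eval \<phi> F z = 0"
  shows "hom_eval \<phi> F (s *s z) = 0"
  using comm_ring_hom.hom_eval_scale[OF assms(1,2)] assms(3) by simp

context quartic
begin

abbreviation x where "x \<equiv> (fls_X_inv :: 'k fls)"
abbreviation y where "y \<equiv> quartic_y c"

text \<open>
  The plane closure of the quartic is singular at infinity; the additional coordinate \<open>x\<^sup>2\<close> separates
  its two branches.
\<close>

definition space_model :: "'k fls ^ 4" where
  "space_model = quad 1 x (x\<^sup>2) y"

definition on_space_curve :: "'a::comm_ring_1 \<Rightarrow> 'a ^ 4 \<Rightarrow> bool" where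
  "on_space_curve e w \<longleftrightarrow>
     w $ 1 * w $ 3 = (w $ 2)\<^sup>2 \<and> (w $ 4)\<^sup>2 = (w $ 3 - w $ 1) * (w $ 3 - e * w $ 1)"

lemma y_square: "y\<^sup>2 = (x\<^sup>2 - 1) * (x\<^sup>2 - fls_const c)"
  unfolding quartic_y_square quartic_poly_def const.hpoly_mult
  by (simp add: const.hom_uminus power2_eq_square algebra_simps)

lemma on_space_curve_model: "on_space_curve (fls_const c) (s *s space_model)"
  by (simp add: on_space_curve_def space_model_def y_square power_mult_distrib)
     (simp add: power2_eq_square algebra_simps)

lemma vanishing_on_affine_part:
  assumes "hom_eval fls_const F space_model = 0" "b\<^sup>2 = (a\<^sup>2 - 1) * (a\<^sup>2 - c)"
  shows "mpeval F (quad 1 a (a\<^sup>2) b) = 0"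
proof -
  have "cover.corresponds (\<lambda>a b. quad 1 a (a\<^sup>2) b $ j) (space_model $ j)" for j :: 4
    unfolding space_model_def
    using cover.corresponds_const[of 1] cover.corresponds_x cover.corresponds_y
      cover.corresponds_power[OF cover.corresponds_x, of 2]
    by (cases rule: exhaust_4[of j, THEN disjE]) auto
  from cover.corresponds_hom_eval[of _ _ "\<lambda>x. x", OF this]
  have "cover.corresponds (\<lambda>a b. mpeval F (quad 1 a (a\<^sup>2) b)) (hom_eval fls_const F space_model)"
    unfolding mpeval_conv_hom_eval by simp
  from cover.corresponds_zero[OF this] assms show ?thesis by (simp add: poly_quartic)
qed

text \<open>
  At the two points at infinity the generic point becomes a power series in \<open>1/x\<close> after scaling,
  and a relation between power series survives evaluation at \<open>0\<close>.
\<close>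

lemma vanishing_at_infinity:
  assumes "form_of_degree d F" "hom_eval fls_const F space_model = 0" "e = 1 \<or> e = - 1"
  shows "mpeval F (quad 0 0 1 e) = 0"
proof -
  \<comment> \<open>Replacing \<open>y\<close> by \<open>- y\<close> gives another generic point and exchanges the points at infinity.\<close>
  define m where "m = quad 1 x (x\<^sup>2) (fls_const e * y)"
  have "cover.corresponds (\<lambda>a b. quad 1 a (a\<^sup>2) (e * b) $ j) (m $ j)" for j :: 4
    unfolding m_def
    using cover.corresponds_const[of 1] cover.corresponds_x
      cover.corresponds_mult[OF cover.corresponds_const[of e] cover.corresponds_y]
      cover.corresponds_power[OF cover.corresponds_x, of 2]
    by (cases rule: exhaust_4[of j, THEN disjE]) auto
  from cover.corresponds_hom_eval[of _ _ "\<lambda>x. x", OF this]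
  have "cover.corresponds (\<lambda>a b. mpeval F (quad 1 a (a\<^sup>2) (e * b))) (hom_eval fls_const F m)"
    unfolding mpeval_conv_hom_eval by simp
  moreover have "mpeval F (quad 1 a (a\<^sup>2) (e * b)) = 0" if "b\<^sup>2 = (a\<^sup>2 - 1) * (a\<^sup>2 - c)" for a b
    using vanishing_on_affine_part[OF assms(2), of "e * b" a] that assms(3) by auto
  ultimately have m: "hom_eval fls_const F m = 0"
    using cover.corresponds_zero by (simp add: poly_quartic)
  define b where "b = fps_sqrt reciprocal_quartic"
  define \<zeta> where "\<zeta> = quad (fps_X\<^sup>2) fps_X 1 (fps_const e * b)"
  have sx: "fls_X * x = 1" by (simp flip: fls_inverse_X)
  have "fls_X\<^sup>2 * x = fls_X * (fls_X * x)" "fls_X\<^sup>2 * x\<^sup>2 = (fls_X * x)\<^sup>2"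
    "fls_X\<^sup>2 * y = (fls_X * x)\<^sup>2 * fps_to_fls b"
    unfolding quartic_y_def b_def reciprocal_quartic_def by (simp_all only: power2_eq_square mult.assoc mult.left_commute)
  hence scaled: "fls_X\<^sup>2 * x = fls_X" "fls_X\<^sup>2 * x\<^sup>2 = 1" "fls_X\<^sup>2 * y = fps_to_fls b"
    unfolding sx by simp_all
  have "(\<chi> i. fps_to_fls (\<zeta> $ i)) = fls_X\<^sup>2 *s m"
    unfolding vec_eq_iff forall_4
    by (simp add: \<zeta>_def m_def scaled mult.left_commute[of "fls_X\<^sup>2"] fps_to_fls_power fls_times_fps_to_fls)
  hence "hom_eval fls_const F (\<chi> i. fps_to_fls (\<zeta> $ i)) = 0"
    using hom_eval_zero_if_proportional[OF const.comm_ring_hom_axioms assms(1) m] by simp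
  moreover have "comm_ring_hom (fps_to_fls :: 'k fps \<Rightarrow> 'k fls)"
    by unfold_locales (simp_all add: fls_times_fps_to_fls)
  from hom_eval_compose[OF this, of fps_const F \<zeta>]
  have "fps_to_fls (hom_eval fps_const F \<zeta>) = hom_eval fls_const F (\<chi> i. fps_to_fls (\<zeta> $ i))" by simp
  ultimately have "hom_eval fps_const F \<zeta> = 0" by simp
  moreover have "comm_ring_hom (\<lambda>g :: 'k fps. fps_nth g 0)"
    by unfold_locales simp_all
  from hom_eval_compose[OF this, of fps_const F \<zeta>]
  have "fps_nth (hom_eval fps_const F \<zeta>) 0 = mpeval F (\<chi> i. fps_nth (\<zeta> $ i) 0)"
    by (simp add: mpeval_conv_hom_eval)
  moreover have "(\<chi> i. fps_nth (\<zeta> $ i) 0) = quad 0 0 1 e"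
    unfolding vec_eq_iff forall_4
    by (simp add: \<zeta>_def b_def fps_sqrt_def sqrt_coeff.simps power2_eq_square)
  ultimately show ?thesis by simp
qed

text \<open>The affine points and the two points at infinity.\<close>

lemma space_curve_cases:
  assumes "w \<noteq> 0" "on_space_curve c w"
  obtains a b where "w $ 1 \<noteq> 0" "w = w $ 1 *s quad 1 a (a\<^sup>2) b" "b\<^sup>2 = (a\<^sup>2 - 1) * (a\<^sup>2 - c)"
  | e where "w $ 3 \<noteq> 0" "w = w $ 3 *s quad 0 0 1 e" "e = 1 \<or> e = - 1"
proof (cases "w $ 1 = 0")
  case False
  define a b where "a = w $ 2 / w $ 1" and "b = w $ 4 / w $ 1"
  have w13: "(w $ 2)\<^sup>2 = w $ 1 * w $ 3" and w4: "(w $ 4)\<^sup>2 = (w $ 3 - w $ 1) * (w $ 3 - c * w $ 1)"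
    using assms(2) by (simp_all add: on_space_curve_def)
  have w3: "w $ 3 = w $ 1 * a\<^sup>2"
    unfolding a_def power_divide w13 using False by (simp add: power2_eq_square)
  have "w = w $ 1 *s quad 1 a (a\<^sup>2) b"
    unfolding vec_eq_iff forall_4 using False w3 by (simp add: a_def b_def)
  moreover have "b\<^sup>2 = (a\<^sup>2 - 1) * (a\<^sup>2 - c)"
  proof -
    have "(w $ 4)\<^sup>2 = (w $ 1)\<^sup>2 * ((a\<^sup>2 - 1) * (a\<^sup>2 - c))"
      unfolding w4 w3 by (simp add: power2_eq_square algebra_simps)
    thus ?thesis using False by (simp add: b_def power_divide)
  qed
  ultimately show ?thesis using False that(1) by blast
next
  case True
  hence w2: "w $ 2 = 0" and w4: "(w $ 4)\<^sup>2 = (w $ 3)\<^sup>2"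
    using assms(2) by (simp_all add: on_space_curve_def power2_eq_square)
  have w3: "w $ 3 \<noteq> 0"
  proof
    assume "w $ 3 = 0"
    hence "w = 0" unfolding vec_eq_iff forall_4 using True w2 w4 by simp
    thus False using assms(1) by simp
  qed
  define e where "e = w $ 4 / w $ 3"
  have "e\<^sup>2 = 1" using w3 w4 by (simp add: e_def power_divide)
  hence "e = 1 \<or> e = - 1" by (simp add: power2_eq_1_iff)
  moreover have "w = w $ 3 *s quad 0 0 1 e"
    unfolding vec_eq_iff forall_4 using True w2 w3 by (simp add: e_def)
  ultimately show ?thesis using w3 that(2) by blast
qed

text \<open>The two quadrics already cut out the variety of the generic point.\<close>

lemma specializes_space_model:
  "cover.field.specializes space_model w \<longleftrightarrow> w \<noteq> 0 \<and> on_space_curve c w"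
proof
  assume w: "cover.field.specializes space_model w"
  have vanish: "mpeval F w = 0" if "form_of_degree d F" "hom_eval fls_const F space_model = 0" for F d
    using w that unfolding cover.field.specializes_def is_form_def by blast
  have model: "on_space_curve (fls_const c) space_model"
    using on_space_curve_model[of 1] by simp
  have "mpeval (mpvar 1 * mpvar 3 - mpvar 2 * mpvar 2) w = 0"
  proof (rule vanish)
    show "form_of_degree (1 + 1) (mpvar 1 * mpvar 3 - mpvar 2 * mpvar 2 :: (4, 'k) mpoly)"
      by (intro form_of_degree_diff form_of_degree_mult form_of_degree_mpvar)
    show "hom_eval fls_const (mpvar 1 * mpvar 3 - mpvar 2 * mpvar 2) space_model = 0"
      using model by (simp add: const.hom_eval_diff const.hom_eval_mult on_space_curve_def power2_eq_square)
  qed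
  moreover have "mpeval (mpvar 4 * mpvar 4 - (mpvar 3 - mpvar 1) * (mpvar 3 - mpconst c * mpvar 1)) w = 0"
  proof (rule vanish)
    show "form_of_degree (1 + 1)
        (mpvar 4 * mpvar 4 - (mpvar 3 - mpvar 1) * (mpvar 3 - mpconst c * mpvar 1) :: (4, 'k) mpoly)"
      by (intro form_of_degree_diff form_of_degree_mult form_of_degree_mpvar form_of_degree_scale)
    show "hom_eval fls_const (mpvar 4 * mpvar 4 - (mpvar 3 - mpvar 1) * (mpvar 3 - mpconst c * mpvar 1)) space_model = 0"
      using model by (simp add: const.hom_eval_diff const.hom_eval_mult on_space_curve_def power2_eq_square)
  qed
  moreover have "w \<noteq> 0" using w unfolding cover.field.specializes_def by blast
  ultimately show "w \<noteq> 0 \<and> on_space_curve c w"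
    by (simp add: on_space_curve_def mpeval_diff mpeval_mult power2_eq_square)
next
  assume w: "w \<noteq> 0 \<and> on_space_curve c w"
  show "cover.field.specializes space_model w"
    unfolding cover.field.specializes_def
  proof (intro conjI allI impI)
    show "w \<noteq> 0" using w by blast
    fix F assume F: "is_form F" "hom_eval fls_const F space_model = 0"
    then obtain d where d: "form_of_degree d F" unfolding is_form_def by blast
    from w have "w \<noteq> 0" "on_space_curve c w" by blast+
    thus "mpeval F w = 0"
    proof (cases rule: space_curve_cases)
      case (1 a b)
      from 1(2) have "mpeval F w = mpeval F (w $ 1 *s quad 1 a (a\<^sup>2) b)" by (rule arg_cong)
      thus ?thesis using vanishing_on_affine_part[OF F(2) 1(3)] by (simp add: mpeval_scale[OF d])
    next
      case (2 e)
      from 2(2) have "mpeval F w = mpeval F (w $ 3 *s quad 0 0 1 e)" by (rule arg_cong)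
      thus ?thesis using vanishing_at_infinity[OF d F(2) 2(3)] by (simp add: mpeval_scale[OF d])
    qed
  qed
qed

subsection \<open>Nonsingularity of the model\<close>

lemma has_uniformizerI:
  assumes "mpeval T v = 0"
    and "\<And>j. mpeval (G j) v \<noteq> 0 \<and>
      hom_eval fls_const (G j) z * (z $ j - fls_const (v $ j)) = hom_eval fls_const T z * hom_eval fls_const (F j) z"
  shows "cover.field.has_uniformizer z v"
  unfolding cover.field.has_uniformizer_def using assms by blast

text \<open>
  At an affine point \<open>x - a\<close> is a uniformizer unless \<open>b = 0\<close>; there the quartic has a simple root
  and \<open>y\<close> is one. At infinity \<open>1/x\<close> is one. In each case the two equations express the other
  coordinate differences.
\<close>

lemma model_uniformizer:
  assumes "w \<noteq> 0" "on_space_curve c w"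
  shows "\<exists>i. w $ i \<noteq> 0 \<and> cover.field.has_uniformizer (cover.field.normalized space_model w i) w"
proof -
  let ?k = "fls_const :: 'k \<Rightarrow> 'k fls"
  note evals = const.hom_eval_diff const.hom_eval_mult const.hom_eval_add const.hom_eval_uminus
    mpeval_diff mpeval_mult mpeval_add
  have w: "w $ 1 * w $ 3 = w $ 2 * w $ 2" "w $ 4 * w $ 4 = (w $ 3 - w $ 1) * (w $ 3 - c * w $ 1)"
    using assms(2) by (simp_all add: on_space_curve_def power2_eq_square)
  hence kw: "?k (w $ 1) * ?k (w $ 3) = ?k (w $ 2) * ?k (w $ 2)"
    "?k (w $ 4) * ?k (w $ 4) = (?k (w $ 3) - ?k (w $ 1)) * (?k (w $ 3) - ?k c * ?k (w $ 1))"
    by (simp_all flip: const.hom_mult const.hom_minus)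
  have z: "z $ 1 * z $ 3 = z $ 2 * z $ 2" "z $ 4 * z $ 4 = (z $ 3 - z $ 1) * (z $ 3 - ?k c * z $ 1)"
    if "z = cover.field.normalized space_model w i" for z i
    using on_space_curve_model[of "?k (w $ i) / space_model $ i"]
    by (simp_all add: that cover.field.normalized_def on_space_curve_def power2_eq_square)
  show ?thesis
  proof (cases "w $ 1 = 0")
    case False
    define z where "z = cover.field.normalized space_model w 1"
    note z = z[OF z_def]
    have z1: "z $ 1 = ?k (w $ 1)"
      by (simp add: z_def cover.field.normalized_def space_model_def)
    define P :: "(4, 'k) mpoly" where
      "P = (mpvar 2 + mpconst (w $ 2)) * (mpvar 3 + mpconst (w $ 3 - (1 + c) * w $ 1))"
    have "?k (w $ 1) * (z $ 3 - ?k (w $ 3)) = z $ 1 * z $ 3 - ?k (w $ 1) * ?k (w $ 3)"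
      unfolding z1 by (rule right_diff_distrib)
    also have "\<dots> = (z $ 2 - ?k (w $ 2)) * (z $ 2 + ?k (w $ 2))"
      unfolding z(1) kw(1) by (simp add: algebra_simps)
    finally have third: "?k (w $ 1) * (z $ 3 - ?k (w $ 3)) = (z $ 2 - ?k (w $ 2)) * (z $ 2 + ?k (w $ 2))" .
    have P_eval: "hom_eval ?k P z = (z $ 2 + ?k (w $ 2)) * (z $ 3 + ?k (w $ 3) - (1 + ?k c) * ?k (w $ 1))"
      by (simp add: P_def evals const.hom_minus const.hom_mult const.hom_add algebra_simps)
    have "z $ 4 * z $ 4 - ?k (w $ 4) * ?k (w $ 4) =
        (z $ 3 - ?k (w $ 3)) * (z $ 3 + ?k (w $ 3) - (1 + ?k c) * ?k (w $ 1))"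
      unfolding z(2) kw(2) z1 by (simp add: algebra_simps)
    hence "?k (w $ 1) * (z $ 4 * z $ 4 - ?k (w $ 4) * ?k (w $ 4)) =
        (?k (w $ 1) * (z $ 3 - ?k (w $ 3))) * (z $ 3 + ?k (w $ 3) - (1 + ?k c) * ?k (w $ 1))"
      by simp
    also have "\<dots> = (z $ 2 - ?k (w $ 2)) * hom_eval ?k P z"
      unfolding third P_eval by (simp add: algebra_simps)
    finally have fourth: "?k (w $ 1) * (z $ 4 * z $ 4 - ?k (w $ 4) * ?k (w $ 4)) =
        (z $ 2 - ?k (w $ 2)) * hom_eval ?k P z" .
    have "cover.field.has_uniformizer z w"
    proof (cases "w $ 4 = 0")
      case w4: False
      show ?thesis
      proof (rule has_uniformizerI[where T = "mpvar 2 - mpconst (w $ 2)"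
            and G = "\<lambda>j. if j = 3 then mpconst (w $ 1)
              else if j = 4 then mpconst (w $ 1) * (mpvar 4 + mpconst (w $ 4)) else 1"
            and F = "\<lambda>j. if j = 1 then 0 else if j = 2 then 1
              else if j = 3 then mpvar 2 + mpconst (w $ 2) else P"])
        fix j :: 4
        have "w $ 4 + w $ 4 \<noteq> 0" using w4 two_nonzero by (simp flip: mult_2)
        moreover have "?k (w $ 1) * (z $ 4 + ?k (w $ 4)) * (z $ 4 - ?k (w $ 4)) = (z $ 2 - ?k (w $ 2)) * hom_eval ?k P z"
          unfolding fourth[symmetric] by (simp add: algebra_simps)
        ultimately show "mpeval (if j = 3 then mpconst (w $ 1)
              else if j = 4 then mpconst (w $ 1) * (mpvar 4 + mpconst (w $ 4)) else 1) w \<noteq> 0 \<and>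
            hom_eval ?k (if j = 3 then mpconst (w $ 1)
              else if j = 4 then mpconst (w $ 1) * (mpvar 4 + mpconst (w $ 4)) else 1) z * (z $ j - ?k (w $ j)) =
            hom_eval ?k (mpvar 2 - mpconst (w $ 2)) z *
            hom_eval ?k (if j = 1 then 0 else if j = 2 then 1
              else if j = 3 then mpvar 2 + mpconst (w $ 2) else P) z"
          using exhaust_4[of j] False third by (elim disjE) (simp_all add: evals z1)
      qed (simp add: evals)
    next
      case w4: True
      \<comment> \<open>A root of the quartic: there the function \<open>y\<close> is the uniformizer.\<close>
      have roots: "w $ 3 = w $ 1 \<or> w $ 3 = c * w $ 1" using w(2) w4 by simp
      hence "w $ 3 \<noteq> 0" using False c(1) by auto
      hence "w $ 2 \<noteq> 0" using w(1) False by auto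
      have P_w: "mpeval P w \<noteq> 0"
      proof -
        have "w $ 2 + w $ 2 \<noteq> 0" using \<open>w $ 2 \<noteq> 0\<close> two_nonzero by (simp flip: mult_2)
        moreover have "w $ 3 + (w $ 3 - (1 + c) * w $ 1) \<noteq> 0"
        proof -
          from roots have "w $ 3 + (w $ 3 - (1 + c) * w $ 1) = (1 - c) * w $ 1 \<or>
              w $ 3 + (w $ 3 - (1 + c) * w $ 1) = (c - 1) * w $ 1"
            by (elim disjE) (simp_all add: algebra_simps)
          thus ?thesis using False c(2) by auto
        qed
        ultimately show ?thesis by (simp add: P_def evals)
      qed
      have fourth': "(z $ 2 - ?k (w $ 2)) * hom_eval ?k P z = ?k (w $ 1) * (z $ 4 * z $ 4)"
        using fourth w4 by simp
      have "?k (w $ 1) * (hom_eval ?k P z * (z $ 3 - ?k (w $ 3))) =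
          hom_eval ?k P z * (?k (w $ 1) * (z $ 3 - ?k (w $ 3)))" by (simp add: algebra_simps)
      also have "\<dots> = ((z $ 2 - ?k (w $ 2)) * hom_eval ?k P z) * (z $ 2 + ?k (w $ 2))"
        unfolding third by (simp add: algebra_simps)
      also have "\<dots> = ?k (w $ 1) * (z $ 4 * (z $ 4 * (z $ 2 + ?k (w $ 2))))"
        unfolding fourth' by (simp add: algebra_simps)
      finally have third': "hom_eval ?k P z * (z $ 3 - ?k (w $ 3)) = z $ 4 * (z $ 4 * (z $ 2 + ?k (w $ 2)))"
        using False by simp
      show ?thesis
      proof (rule has_uniformizerI[where T = "mpvar 4"
            and G = "\<lambda>j. if j = 2 \<or> j = 3 then P else 1"
            and F = "\<lambda>j. if j = 1 then 0 else if j = 2 then mpconst (w $ 1) * mpvar 4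
              else if j = 3 then mpvar 4 * (mpvar 2 + mpconst (w $ 2)) else 1"])
        fix j :: 4
        have "hom_eval ?k P z * (z $ 2 - ?k (w $ 2)) = z $ 4 * (?k (w $ 1) * z $ 4)"
          using fourth' by (simp add: algebra_simps)
        thus "mpeval (if j = 2 \<or> j = 3 then P else 1) w \<noteq> 0 \<and>
            hom_eval ?k (if j = 2 \<or> j = 3 then P else 1) z * (z $ j - ?k (w $ j)) =
            hom_eval ?k (mpvar 4) z *
            hom_eval ?k (if j = 1 then 0 else if j = 2 then mpconst (w $ 1) * mpvar 4
              else if j = 3 then mpvar 4 * (mpvar 2 + mpconst (w $ 2)) else 1) z"
          using exhaust_4[of j] third' P_w w4 by (elim disjE) (simp_all add: evals z1)
      qed (simp add: w4)
    qed
    thus ?thesis using False unfolding z_def by blast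
  next
    case True
    have w2: "w $ 2 = 0" using w(1) True by simp
    have w4: "w $ 4 * w $ 4 = w $ 3 * w $ 3" using w(2) True by simp
    have w3: "w $ 3 \<noteq> 0"
    proof
      assume "w $ 3 = 0"
      hence "w = 0" unfolding vec_eq_iff forall_4 using True w2 w4 by simp
      thus False using assms(1) by simp
    qed
    hence w4': "w $ 4 \<noteq> 0" using w4 by auto
    define z where "z = cover.field.normalized space_model w 3"
    note z = z[OF z_def]
    have cancel: "g / h * h = g" if "h \<noteq> 0" for g h :: "'k fls"
      using that by simp
    have z3: "z $ 3 = ?k (w $ 3)"
      unfolding z_def cover.field.normalized_def space_model_def vector_smult_component quad_nth
      by (rule cancel) simp
    have kw4: "?k (w $ 4) * ?k (w $ 4) = ?k (w $ 3) * ?k (w $ 3)"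
      using w4 by (simp flip: const.hom_mult)
    have first: "?k (w $ 3) * z $ 1 = z $ 2 * z $ 2" using z(1) by (simp add: z3 mult.commute)
    have "?k (w $ 3) * (z $ 4 * z $ 4 - ?k (w $ 4) * ?k (w $ 4)) =
        (?k (w $ 3) * z $ 1) * (?k c * z $ 1 - (1 + ?k c) * ?k (w $ 3))"
      unfolding z(2) kw4 z3 by (simp add: algebra_simps)
    hence fourth: "?k (w $ 3) * (z $ 4 + ?k (w $ 4)) * (z $ 4 - ?k (w $ 4)) =
        z $ 2 * (z $ 2 * (?k c * z $ 1 - (1 + ?k c) * ?k (w $ 3)))"
      unfolding first by (simp add: algebra_simps)
    have "cover.field.has_uniformizer z w"
    proof (rule has_uniformizerI[where T = "mpvar 2"
          and G = "\<lambda>j. if j = 1 then mpconst (w $ 3)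
            else if j = 4 then mpconst (w $ 3) * (mpvar 4 + mpconst (w $ 4)) else 1"
          and F = "\<lambda>j. if j = 1 then mpvar 2 else if j = 2 then 1 else if j = 3 then 0
            else mpvar 2 * (mpconst c * mpvar 1 - mpconst ((1 + c) * w $ 3))"])
      fix j :: 4
      have "w $ 4 + w $ 4 \<noteq> 0" using w4' two_nonzero by (simp flip: mult_2)
      thus "mpeval (if j = 1 then mpconst (w $ 3)
            else if j = 4 then mpconst (w $ 3) * (mpvar 4 + mpconst (w $ 4)) else 1) w \<noteq> 0 \<and>
          hom_eval ?k (if j = 1 then mpconst (w $ 3)
            else if j = 4 then mpconst (w $ 3) * (mpvar 4 + mpconst (w $ 4)) else 1) z * (z $ j - ?k (w $ j)) =
          hom_eval ?k (mpvar 2) z *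
          hom_eval ?k (if j = 1 then mpvar 2 else if j = 2 then 1 else if j = 3 then 0
            else mpvar 2 * (mpconst c * mpvar 1 - mpconst ((1 + c) * w $ 3))) z"
        using exhaust_4[of j] first fourth w3 w2 True
        by (elim disjE) (simp_all add: evals z3 const.hom_mult const.hom_add)
    qed (simp add: w2)
    thus ?thesis using w3 unfolding z_def by blast
  qed
qed

lemma space_model_is_model: "cover.field.is_model space_model"
  unfolding cover.field.is_model_def
proof (intro conjI allI impI)
  fix j :: 4
  show "space_model $ j \<in> cover.fractions"
    using exhaust_4[of j] cover.corresponds_in_fractions[OF cover.corresponds_const[of 1]]
      cover.corresponds_in_fractions[OF cover.corresponds_x]
      cover.corresponds_in_fractions[OF cover.corresponds_power[OF cover.corresponds_x, of 2]]
      cover.corresponds_in_fractions[OF cover.corresponds_y]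
    by (elim disjE) (simp_all add: space_model_def)
next
  fix s :: "'k fls" assume "s \<noteq> 0"
  thus "cover.field.generates (s *s space_model)"
    by (intro cover.generatesI[of "mpvar 1" _ "mpvar 2" "mpvar 1" "mpvar 4"])
       (simp_all add: space_model_def)
next
  fix w assume "cover.field.specializes space_model w"
  thus "\<exists>i. w $ i \<noteq> 0 \<and> cover.field.has_uniformizer (cover.field.normalized space_model w i) w"
    by (intro model_uniformizer) (simp_all add: specializes_space_model)
qed

lemma \<sigma>_space_model: "fls_map \<tau> (space_model $ j) = space_model $ j"
proof -
  show ?thesis
    using exhaust_4[of j]
    by (elim disjE) (simp_all add: space_model_def \<sigma>_y frobenius.\<sigma>.hom_power F.fls_map_X_inv)
qed

text \<open>
  A rational point has Frobenius-fixed affine coordinates, or is one of the two points at infinity,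
  which are distinct because \<open>1 \<noteq> - 1\<close>.
\<close>

lemma card_rational_points_space_model:
  assumes "finite {(a, b). \<tau> a = a \<and> \<tau> b = b \<and> b\<^sup>2 = (a\<^sup>2 - 1) * (a\<^sup>2 - c)}"
  shows "card (ppoint ` {w. cover.field.specializes space_model w \<and> frobenius.frob w = w}) =
    card {(a, b). \<tau> a = a \<and> \<tau> b = b \<and> b\<^sup>2 = (a\<^sup>2 - 1) * (a\<^sup>2 - c)} + 2"
proof -
  define A where "A = {(a, b). \<tau> a = a \<and> \<tau> b = b \<and> b\<^sup>2 = (a\<^sup>2 - 1) * (a\<^sup>2 - c)}"
  define g where "g = (\<lambda>(a :: 'k, b). ppoint (quad 1 a (a\<^sup>2) b))"
  define I where "I e = ppoint (quad 0 0 1 (e :: 'k))" for e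
  have \<tau>_inverse: "\<tau> (a / b) = a / b" if "\<tau> a = a" "\<tau> b = b" "b \<noteq> 0" for a b
  proof -
    have "\<tau> (a / b) * b = a" using that F.hom_mult[of "a / b" b] by simp
    thus ?thesis using that(3) by (simp add: field_simps)
  qed
  have curve: "on_space_curve c (quad 1 a (a\<^sup>2) b)" if "b\<^sup>2 = (a\<^sup>2 - 1) * (a\<^sup>2 - c)" for a b
    using that by (simp add: on_space_curve_def)
  have nonzero: "quad 1 a d b \<noteq> 0" "quad 0 0 1 b \<noteq> 0" for a b d :: 'k
    by (metis quad_nth(1) zero_index one_neq_zero, metis quad_nth(3) zero_index one_neq_zero)
  have "ppoint ` {w. cover.field.specializes space_model w \<and> frobenius.frob w = w} = g ` A \<union> {I 1, I (- 1)}"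
  proof (intro equalityI subsetI)
    fix P assume "P \<in> ppoint ` {w. cover.field.specializes space_model w \<and> frobenius.frob w = w}"
    then obtain w where w: "P = ppoint w" "w \<noteq> 0" "on_space_curve c w" "frobenius.frob w = w"
      by (auto simp: specializes_space_model)
    have fixed: "\<tau> (w $ j) = w $ j" for j
      using w(4) by (simp add: frobenius.frob_def vec_eq_iff)
    from w(2,3) show "P \<in> g ` A \<union> {I 1, I (- 1)}"
    proof (cases rule: space_curve_cases)
      case (1 a b)
      have "w $ 2 = w $ 1 * a" "w $ 4 = w $ 1 * b"
        using arg_cong[OF 1(2), of "\<lambda>v. v $ 2"] arg_cong[OF 1(2), of "\<lambda>v. v $ 4"] by simp_all
      hence ab: "a = w $ 2 / w $ 1" "b = w $ 4 / w $ 1" using 1(1) by simp_all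
      have "\<tau> a = a" "\<tau> b = b" unfolding ab by (intro \<tau>_inverse fixed 1(1))+
      hence "(a, b) \<in> A" using 1(3) by (simp add: A_def)
      moreover have "P = g (a, b)"
        unfolding w(1) g_def by (subst 1(2)) (simp add: ppoint_scale[OF 1(1)])
      ultimately show ?thesis by blast
    next
      case (2 e)
      have "P = I e" unfolding w(1) I_def by (subst 2(2)) (simp add: ppoint_scale[OF 2(1)])
      thus ?thesis using 2(3) by blast
    qed
  next
    fix P assume "P \<in> g ` A \<union> {I 1, I (- 1)}"
    then consider a b where "(a, b) \<in> A" "P = g (a, b)" | e where "P = I e" "e = 1 \<or> e = - 1" by auto
    thus "P \<in> ppoint ` {w. cover.field.specializes space_model w \<and> frobenius.frob w = w}"
    proof cases
      case 1
      have "frobenius.frob (quad 1 a (a\<^sup>2) b) = quad 1 a (a\<^sup>2) b"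
        using 1(1) unfolding vec_eq_iff forall_4
        by (simp add: frobenius.frob_def A_def F.hom_power)
      thus ?thesis
        using 1 curve nonzero by (auto simp: g_def A_def specializes_space_model intro!: imageI)
    next
      case 2
      have "frobenius.frob (quad 0 0 1 e) = quad 0 0 1 e"
        using 2(2) unfolding vec_eq_iff forall_4
        by (auto simp: frobenius.frob_def F.hom_uminus)
      moreover have "on_space_curve c (quad 0 0 1 e)"
        using 2(2) by (auto simp: on_space_curve_def)
      ultimately show ?thesis
        using 2 nonzero by (auto simp: I_def specializes_space_model intro!: imageI)
    qed
  qed
  moreover have "card (g ` A \<union> {I 1, I (- 1)}) = card A + 2"
  proof -
    have scaled: "\<exists>s. \<forall>j. u $ j = s * v $ j" if "ppoint u = ppoint v" for u v :: "'k ^ 4"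
      using ppoint_eqD[OF that] by (metis vector_smult_component)
    have "inj_on g A"
    proof (rule inj_onI)
      fix p q assume "p \<in> A" "q \<in> A" "g p = g q"
      obtain a b a' b' where pq: "p = (a, b)" "q = (a', b')" by (cases p, cases q)
      have "ppoint (quad 1 a (a\<^sup>2) b) = ppoint (quad 1 a' (a'\<^sup>2) b')"
        using \<open>g p = g q\<close> unfolding pq g_def by simp
      from scaled[OF this] obtain s where s: "\<And>j. quad 1 a (a\<^sup>2) b $ j = s * quad 1 a' (a'\<^sup>2) b' $ j"
        by blast
      have "s = 1" using s[of 1] by simp
      moreover have "a = s * a'" using s[of 2] by simp
      moreover have "b = s * b'" using s[of 4] by simp
      ultimately show "p = q" by (simp add: pq)
    qed
    hence "card (g ` A) = card A" by (rule card_image)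
    moreover have "I 1 \<noteq> I (- 1)"
    proof
      assume "I 1 = I (- 1)"
      from scaled[OF this[unfolded I_def]]
      obtain s :: 'k where s: "\<And>j. quad 0 0 1 1 $ j = s * quad 0 0 1 (- 1) $ j" by blast
      have "s = 1" using s[of 3] by simp
      moreover have "1 = - s" using s[of 4] by simp
      ultimately have "1 + 1 = (0 :: 'k)" by (metis add.right_inverse)
      thus False using two_nonzero by simp
    qed
    moreover have "I e \<notin> g ` A" for e
    proof
      assume "I e \<in> g ` A"
      then obtain a b where "I e = ppoint (quad 1 a (a\<^sup>2) b)" by (auto simp: g_def)
      from scaled[OF this[unfolded I_def]]
      obtain s :: 'k where s: "\<And>j. quad 0 0 1 e $ j = s * quad 1 a (a\<^sup>2) b $ j" by blast
      have "s = 0" using s[of 1] by simp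
      moreover have "1 = s * a\<^sup>2" using s[of 3] by simp
      ultimately show False by simp
    qed
    moreover have "finite A" using assms by (simp add: A_def)
    ultimately show ?thesis by (subst card_Un_disjoint) auto
  qed
  ultimately show ?thesis by (simp only: A_def)
qed

end

section \<open>The generic point of a nonsingular model\<close>

lemma form_of_degree_base_change: "form_of_degree d F \<Longrightarrow> form_of_degree d (base_change F)"
proof -
  have "Poly_Mapping.keys (base_change F) = Poly_Mapping.keys F"
    by (auto simp: base_change_def in_keys_iff Poly_Mapping.map.rep_eq when_def)
  thus "form_of_degree d F \<Longrightarrow> form_of_degree d (base_change F)"
    by (simp add: form_of_degree_def)
qed

lemma tuple_eval_scale:
  assumes "\<And>j. form_of_degree d (f $ j)"
  shows "tuple_eval f (s *s v) = s ^ d *s tuple_eval f v"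
  unfolding vec_eq_iff tuple_eval_def
  by (simp add: mpeval_scale[OF form_of_degree_base_change[OF assms]])

lemma vanishing_ideal_contains:
  assumes "is_form F" "\<And>P v. P \<in> V \<Longrightarrow> v \<in> P \<Longrightarrow> mpeval F v = 0"
  shows "F \<in> vanishing_ideal V"
  unfolding vanishing_ideal_def ideal_gen_def
  by (rule module.span_base[OF module_over_itself]) (use assms in blast)

text \<open>
  Induction over the combinations \<open>H\<^sub>1 F\<^sub>1 + \<dots> + H\<^sub>r F\<^sub>r\<close> of forms vanishing on \<open>V\<close>.
\<close>

lemma vanishing_ideal_induct [consumes 1, case_names zero step]:
  assumes "F \<in> vanishing_ideal V" and "Q 0"
    and "\<And>H F G. is_form F \<Longrightarrow> (\<And>P v. P \<in> V \<Longrightarrow> v \<in> P \<Longrightarrow> mpeval F v = 0) \<Longrightarrow> Q G \<Longrightarrow> Q (H * F + G)"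
  shows "Q F"
  using assms(1) unfolding vanishing_ideal_def ideal_gen_def
proof (induction rule: module.span_induct_alt[OF module_over_itself, consumes 1, case_names base step])
  case base
  show ?case by (rule assms(2))
next
  case (step H F G)
  show ?case by (rule assms(3)) (use step in auto)
qed

lemma vanishing_ideal_vanishes:
  assumes "F \<in> vanishing_ideal V" "P \<in> V" "v \<in> P"
  shows "mpeval F v = 0"
  using assms(1) by (induction rule: vanishing_ideal_induct) (use assms in \<open>auto simp: mpeval_add mpeval_mult\<close>)

lemma zariski_closed_subset: "zariski_closed V \<Longrightarrow> V \<subseteq> proj_space"
  unfolding zariski_closed_def zero_locus_def by auto

text \<open>For forms, one representative of a point decides.\<close>

lemma zero_locus_mem:
  assumes "v \<noteq> 0" "\<And>F. F \<in> T \<Longrightarrow> is_form F"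
  shows "ppoint v \<in> zero_locus T \<longleftrightarrow> (\<forall>F\<in>T. mpeval F v = 0)"
proof
  assume "ppoint v \<in> zero_locus T"
  thus "\<forall>F\<in>T. mpeval F v = 0" unfolding zero_locus_def using ppoint_self by blast
next
  assume vanish: "\<forall>F\<in>T. mpeval F v = 0"
  have "mpeval F u = 0" if "F \<in> T" "u \<in> ppoint v" for F u
  proof -
    from assms(2)[OF that(1)] obtain d where d: "form_of_degree d F" unfolding is_form_def by blast
    from that(2) obtain s where "u = s *s v" unfolding ppoint_def by blast
    thus ?thesis using vanish that(1) by (simp add: mpeval_scale[OF d])
  qed
  moreover have "ppoint v \<in> proj_space" unfolding proj_space_def using assms(1) by blast
  ultimately show "ppoint v \<in> zero_locus T" unfolding zero_locus_def by blast
qed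

text \<open>Chains can be truncated.\<close>

lemma has_dim_unique:
  assumes "has_dim V 1" "has_dim V d"
  shows "d = 1"
proof -
  have truncate: "irreducible_chain V e Z" if "irreducible_chain V d Z" "e \<le> d" for e Z
    using that unfolding irreducible_chain_def by auto
  have upper: "\<not> (\<exists>Z. irreducible_chain V 2 Z)" and lower: "\<exists>Z. irreducible_chain V (Suc 0) Z"
    using assms(1) unfolding has_dim_def by (simp_all add: numeral_2_eq_2)
  have longest: "\<exists>Z. irreducible_chain V d Z" "\<not> (\<exists>Z. irreducible_chain V (Suc d) Z)"
    using assms(2) unfolding has_dim_def by simp_all
  have "\<not> 2 \<le> d" using longest(1) truncate upper by blast
  moreover have "d \<noteq> 0"
  proof
    assume "d = 0"
    thus False using longest(2) lower by simp
  qed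
  ultimately show ?thesis by simp
qed

lemma (in function_field) specializes_scale:
  assumes "specializes \<eta> v" "s \<noteq> 0"
  shows "specializes \<eta> (s *s v)"
  using assms mpeval_scale unfolding specializes_def is_form_def
  by (metis mult_zero_right vector_mul_eq_0)

text \<open>
  The data of a birational equivalence over the ground field, unpacked: forms \<open>f\<close> and \<open>g\<close> of degrees
  \<open>df\<close> and \<open>dg\<close>, and the closed sets outside of which they are mutually inverse.
\<close>

locale quartic_model = quartic "to_ac c0" \<tau>
  for c0 :: "'a::field" and \<tau> :: "'a alg_closure \<Rightarrow> 'a alg_closure" +
  fixes E :: "('n::finite, 'a alg_closure) ppoint set"
    and f :: "(('n, 'a) mpoly) ^ 3" and g :: "((3, 'a) mpoly) ^ 'n"
    and df dg :: nat
    and ZE and ZW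
  assumes \<tau>_base: "\<tau> (to_ac a) = to_ac a"
    and curve: "nonsingular_proj_curve E"
    and f_form: "form_of_degree df (f $ j)" and g_form: "form_of_degree dg (g $ i)"
    and ZE: "zariski_closed ZE" "\<not> E \<subseteq> ZE"
    and ZW: "zariski_closed ZW" "\<not> affine_in_plane (quartic_curve c0) \<subseteq> ZW"
    and generic_E: "P \<in> E - ZE \<Longrightarrow> \<exists>Q\<in>affine_in_plane (quartic_curve c0). tuple_maps f P Q \<and> tuple_maps g Q P"
    and generic_W: "Q \<in> affine_in_plane (quartic_curve c0) - ZW \<Longrightarrow> \<exists>P\<in>E. tuple_maps g Q P \<and> tuple_maps f P Q"
begin

abbreviation pt :: "'a alg_closure \<Rightarrow> 'a alg_closure \<Rightarrow> 'a alg_closure ^ 3" where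
  "pt a b \<equiv> vector [1, a, b]"

abbreviation on_curve :: "'a alg_closure \<Rightarrow> 'a alg_closure \<Rightarrow> bool" where
  "on_curve a b \<equiv> b\<^sup>2 = (a\<^sup>2 - 1) * (a\<^sup>2 - to_ac c0)"

text \<open>
  The generic point of the plane quartic and its image under the rational map to \<open>E\<close>.
\<close>

definition \<omega> :: "'a alg_closure fls ^ 3" where "\<omega> = vector [1, x, y]"

definition \<eta> :: "'a alg_closure fls ^ 'n" where
  "\<eta> = (\<chi> j. hom_eval (\<lambda>a. fls_const (to_ac a)) (g $ j) \<omega>)"

lemma pt_nonzero: "pt a b \<noteq> 0"
proof
  assume "pt a b = 0"
  hence "pt a b $ 1 = 0" by simp
  thus False by simp
qed

lemma affine_mem: "Q \<in> affine_in_plane (quartic_curve c0) \<longleftrightarrow> (\<exists>a b. on_curve a b \<and> Q = ppoint (pt a b))"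
  unfolding affine_in_plane_def quartic_curve_def by auto

lemma corresponds_\<omega>: "cover.corresponds (\<lambda>a b. pt a b $ j) (\<omega> $ j)"
  using exhaust_3[of j] cover.corresponds_const[of 1] cover.corresponds_x cover.corresponds_y
  by (elim disjE) (simp_all add: \<omega>_def)

lemma corresponds_\<eta>: "cover.corresponds (\<lambda>a b. tuple_eval g (pt a b) $ j) (\<eta> $ j)"
  unfolding \<eta>_def tuple_eval_def vec_lambda_beta mpeval_base_change
  by (rule cover.corresponds_hom_eval[OF corresponds_\<omega>])

lemma corresponds_at_\<eta>:
  "cover.corresponds (\<lambda>a b. mpeval F (tuple_eval g (pt a b))) (hom_eval fls_const F \<eta>)"
  using cover.corresponds_hom_eval[of "\<lambda>a b. tuple_eval g (pt a b)" \<eta> "\<lambda>x. x", OF corresponds_\<eta>]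
  unfolding mpeval_conv_hom_eval by simp

lemma corresponds_at_\<omega>:
  "cover.corresponds (\<lambda>a b. mpeval F (pt a b)) (hom_eval fls_const F \<omega>)"
  using cover.corresponds_hom_eval[of pt \<omega> "\<lambda>x. x", OF corresponds_\<omega>]
  unfolding mpeval_conv_hom_eval by simp

text \<open>On the open part the two rational maps are inverse to each other on coordinate vectors.\<close>

lemma generic_point:
  assumes "on_curve a b" "ppoint (pt a b) \<notin> ZW"
  shows "tuple_eval g (pt a b) \<noteq> 0" "ppoint (tuple_eval g (pt a b)) \<in> E"
    "\<exists>s. s \<noteq> 0 \<and> tuple_eval f (tuple_eval g (pt a b)) = s *s pt a b"
proof -
  define v u where "v = pt a b" and "u = tuple_eval g v"
  have "ppoint v \<in> affine_in_plane (quartic_curve c0) - ZW"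
    using assms affine_mem unfolding v_def by blast
  then obtain P where P: "P \<in> E" "tuple_maps g (ppoint v) P" "tuple_maps f P (ppoint v)"
    using generic_W by blast
  obtain v' where v': "v' \<in> ppoint v" "tuple_eval g v' \<noteq> 0" "P = ppoint (tuple_eval g v')"
    using P(2) unfolding tuple_maps_def by blast
  obtain s where s: "s \<noteq> 0" "v' = s *s v" using v'(1) unfolding ppoint_def by blast
  have gv': "tuple_eval g v' = s ^ dg *s u"
    unfolding s(2) u_def by (rule tuple_eval_scale[OF g_form])
  thus "tuple_eval g (pt a b) \<noteq> 0" using v'(2) unfolding u_def v_def by auto
  have P_u: "P = ppoint u" unfolding v'(3) gv' using s(1) by (simp add: ppoint_scale)
  thus "ppoint (tuple_eval g (pt a b)) \<in> E" using P(1) unfolding u_def v_def by simp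
  obtain u' where u': "u' \<in> P" "ppoint v = ppoint (tuple_eval f u')"
    using P(3) unfolding tuple_maps_def by blast
  obtain t where t: "t \<noteq> 0" "u' = t *s u" using u'(1) unfolding P_u ppoint_def by blast
  have "ppoint (tuple_eval f u') = ppoint v" using u'(2) by simp
  then obtain r where r: "r \<noteq> 0" "tuple_eval f u' = r *s v" by (rule ppoint_eqD)
  have "t ^ df *s tuple_eval f u = r *s v"
    using r(2) unfolding t(2) tuple_eval_scale[OF f_form] .
  hence "inverse (t ^ df) *s (t ^ df *s tuple_eval f u) = inverse (t ^ df) *s (r *s v)" by simp
  hence "tuple_eval f u = (inverse (t ^ df) * r) *s v"
    using t(1) by (simp add: vector_smult_assoc)
  thus "\<exists>s. s \<noteq> 0 \<and> tuple_eval f (tuple_eval g (pt a b)) = s *s pt a b"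
    using r(1) t(1) unfolding u_def v_def by (intro exI[of _ "inverse (t ^ df) * r"]) simp
qed

lemma generic_curve_point: "\<exists>a b. on_curve a b \<and> ppoint (pt a b) \<notin> ZW"
proof -
  obtain Q where "Q \<in> affine_in_plane (quartic_curve c0)" "Q \<notin> ZW" using ZW(2) by blast
  thus ?thesis unfolding affine_mem by blast
qed

text \<open>
  Multiplying with a form that vanishes on the exceptional set but not on the whole curve makes
  the product vanish everywhere.
\<close>

lemma generically_zero:
  assumes "cover.corresponds \<phi> h" "\<And>a b. on_curve a b \<Longrightarrow> ppoint (pt a b) \<notin> ZW \<Longrightarrow> \<phi> a b = 0"
  shows "h = 0"
proof -
  obtain T where T: "\<And>F. F \<in> T \<Longrightarrow> is_form F" "ZW = zero_locus T"
    using ZW(1) unfolding zariski_closed_def by blast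
  have ZW_mem: "ppoint (pt a b) \<in> ZW \<longleftrightarrow> (\<forall>F\<in>T. mpeval F (pt a b) = 0)" for a b
    unfolding T(2) by (rule zero_locus_mem[OF pt_nonzero T(1)])
  obtain a0 b0 where "on_curve a0 b0" "ppoint (pt a0 b0) \<notin> ZW" using generic_curve_point by blast
  then obtain F0 where F0: "F0 \<in> T" "mpeval F0 (pt a0 b0) \<noteq> 0" using ZW_mem by blast
  have "hom_eval fls_const F0 \<omega> \<noteq> 0"
    using cover.corresponds_zero[OF corresponds_at_\<omega>[of F0]] F0(2) \<open>on_curve a0 b0\<close>
    by (auto simp: poly_quartic)
  moreover have "hom_eval fls_const F0 \<omega> * h = 0"
  proof (subst cover.corresponds_zero[OF cover.corresponds_mult[OF corresponds_at_\<omega> assms(1)]], intro allI impI)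
    fix a b assume "b\<^sup>2 = poly (quartic_poly (to_ac c0)) a"
    hence "on_curve a b" by (simp add: poly_quartic)
    thus "mpeval F0 (pt a b) * \<phi> a b = 0"
      using assms(2)[of b a] ZW_mem[of a b] F0(1) by (cases "ppoint (pt a b) \<in> ZW") auto
  qed
  ultimately show ?thesis by simp
qed

text \<open>
  The vector \<open>\<eta>\<close> is a generic point of \<open>E\<close>: a relation holds on \<open>E\<close> iff it holds for \<open>\<eta>\<close>.
\<close>

lemma vanishes_iff:
  assumes F: "is_form F"
  shows "(\<forall>P\<in>E. \<forall>v\<in>P. mpeval F v = 0) \<longleftrightarrow> hom_eval fls_const F \<eta> = 0"
proof
  assume vanish: "\<forall>P\<in>E. \<forall>v\<in>P. mpeval F v = 0"
  show "hom_eval fls_const F \<eta> = 0"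
    by (rule generically_zero[OF corresponds_at_\<eta>]) (use vanish generic_point(2) ppoint_self in blast)
next
  assume zero: "hom_eval fls_const F \<eta> = 0"
  have at_points: "mpeval F (tuple_eval g (pt a b)) = 0" if "on_curve a b" for a b
    using cover.corresponds_zero[OF corresponds_at_\<eta>[of F]] zero that by (simp add: poly_quartic)
  obtain d where d: "form_of_degree d F" using F unfolding is_form_def by blast
  have on_open: "mpeval F v = 0" if "P \<in> E" "P \<notin> ZE" "v \<in> P" for P v
  proof -
    from that(1,2) generic_E[of P] obtain Q where "Q \<in> affine_in_plane (quartic_curve c0)" "tuple_maps g Q P"
      by blast
    then obtain a b where Q: "on_curve a b" "tuple_maps g (ppoint (pt a b)) P" unfolding affine_mem by blast
    then obtain v' where "v' \<in> ppoint (pt a b)" "P = ppoint (tuple_eval g v')" unfolding tuple_maps_def by blast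
    moreover from this(1) obtain s where "v' = s *s pt a b" unfolding ppoint_def by blast
    ultimately have "P = ppoint (s ^ dg *s tuple_eval g (pt a b))"
      by (simp add: tuple_eval_scale[OF g_form])
    with \<open>v \<in> P\<close> obtain t where "v = t *s (s ^ dg *s tuple_eval g (pt a b))" unfolding ppoint_def by blast
    thus ?thesis using at_points[OF Q(1)] by (simp add: mpeval_scale[OF d])
  qed
  \<comment> \<open>Irreducibility spreads the vanishing from the open part to the whole curve.\<close>
  have variety: "zariski_closed E" "is_prime_ideal (vanishing_ideal E)"
    using curve unfolding nonsingular_proj_curve_def proj_variety_def by blast+
  obtain T where T: "\<And>F. F \<in> T \<Longrightarrow> is_form F" "ZE = zero_locus T"
    using ZE(1) unfolding zariski_closed_def by blast
  obtain P0 where P0: "P0 \<in> E" "P0 \<notin> ZE" using ZE(2) by blast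
  have "P0 \<in> proj_space" using zariski_closed_subset[OF variety(1)] P0(1) by blast
  hence "\<exists>F0\<in>T. \<exists>v0\<in>P0. mpeval F0 v0 \<noteq> 0"
    using P0(2) by (simp add: T(2) zero_locus_def)
  then obtain F0 v0 where F0: "F0 \<in> T" "v0 \<in> P0" "mpeval F0 v0 \<noteq> 0" by blast
  have "F * F0 \<in> vanishing_ideal E"
  proof (rule vanishing_ideal_contains)
    show "is_form (F * F0)" by (rule is_form_mult[OF F T(1)[OF F0(1)]])
    fix P v assume Pv: "P \<in> E" "v \<in> P"
    show "mpeval (F * F0) v = 0"
    proof (cases "P \<in> ZE")
      case True
      hence "\<forall>F\<in>T. \<forall>v\<in>P. mpeval F v = 0" by (simp add: T(2) zero_locus_def)
      hence "mpeval F0 v = 0" using F0(1) Pv(2) by blast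
      thus ?thesis by (simp add: mpeval_mult)
    next
      case False
      show ?thesis by (simp add: mpeval_mult on_open[OF Pv(1) False Pv(2)])
    qed
  qed
  moreover have "\<forall>a b. a * b \<in> vanishing_ideal E \<longrightarrow> a \<in> vanishing_ideal E \<or> b \<in> vanishing_ideal E"
    using variety(2) unfolding is_prime_ideal_def by (elim conjE)
  ultimately have "F \<in> vanishing_ideal E \<or> F0 \<in> vanishing_ideal E" by simp
  thus "\<forall>P\<in>E. \<forall>v\<in>P. mpeval F v = 0"
  proof
    assume "F \<in> vanishing_ideal E"
    from vanishing_ideal_vanishes[OF this] show ?thesis by simp
  next
    assume "F0 \<in> vanishing_ideal E"
    from vanishing_ideal_vanishes[OF this P0(1) F0(2)] show ?thesis using F0(3) by simp
  qed
qed

lemma E_eq: "E = ppoint ` {v. cover.field.specializes \<eta> v}"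
proof (intro equalityI subsetI)
  fix P assume "P \<in> E"
  have "zariski_closed E" using curve unfolding nonsingular_proj_curve_def proj_variety_def by blast
  hence "P \<in> proj_space" using zariski_closed_subset \<open>P \<in> E\<close> by blast
  then obtain v where v: "v \<noteq> 0" "P = ppoint v" unfolding proj_space_def by blast
  have "cover.field.specializes \<eta> v"
    unfolding cover.field.specializes_def
  proof (intro conjI allI impI)
    show "v \<noteq> 0" by fact
    show "mpeval F v = 0" if "is_form F" "hom_eval fls_const F \<eta> = 0" for F
      using vanishes_iff[OF that(1)] that(2) \<open>P \<in> E\<close> ppoint_self[of v] unfolding v(2) by blast
  qed
  thus "P \<in> ppoint ` {v. cover.field.specializes \<eta> v}" using v(2) by blast
next
  fix P assume "P \<in> ppoint ` {v. cover.field.specializes \<eta> v}"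
  then obtain v where v: "P = ppoint v" "cover.field.specializes \<eta> v" by blast
  obtain T where T: "\<And>F. F \<in> T \<Longrightarrow> is_form F" "E = zero_locus T"
    using curve unfolding nonsingular_proj_curve_def proj_variety_def zariski_closed_def by blast
  have "mpeval F v = 0" if "F \<in> T" for F
  proof -
    have "\<forall>P\<in>E. \<forall>v\<in>P. mpeval F v = 0" using that by (simp add: T(2) zero_locus_def)
    hence "hom_eval fls_const F \<eta> = 0" using vanishes_iff[OF T(1)[OF that]] by blast
    thus ?thesis using v(2) T(1)[OF that] unfolding cover.field.specializes_def by blast
  qed
  moreover have "v \<noteq> 0" using v(2) unfolding cover.field.specializes_def by blast
  ultimately show "P \<in> E" unfolding v(1) T(2) using zero_locus_mem[OF _ T(1)] by blast
qed

lemma ideal_vanishes_\<eta>: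
  assumes "F \<in> vanishing_ideal E"
  shows "hom_eval fls_const F (s *s \<eta>) = 0"
  using assms
proof (induction rule: vanishing_ideal_induct)
  case (step H F G)
  then obtain d where d: "form_of_degree d F" unfolding is_form_def by blast
  have "hom_eval fls_const F \<eta> = 0" using vanishes_iff[OF step(1)] step(2) by blast
  thus ?case using step(3)
    by (simp add: const.hom_eval_add const.hom_eval_mult const.hom_eval_scale[OF d])
qed simp

text \<open>
  The summands \<open>H F\<close> need not be forms, but at a zero of \<open>F\<close> the product rule leaves only the
  gradient of \<open>F\<close>.
\<close>

lemma ideal_euler:
  assumes "F \<in> vanishing_ideal E" "P \<in> E" "v \<in> P"
  shows "(\<Sum>j\<in>UNIV. v $ j * gradient F v $ j) = 0"
  using assms(1)
proof (induction rule: vanishing_ideal_induct)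
  case zero
  show ?case by (simp add: gradient_def)
next
  case (step H F G)
  then obtain d where d: "form_of_degree d F" unfolding is_form_def by blast
  have F_v: "mpeval F v = 0" using step(2) assms(2,3) by blast
  have "(\<Sum>j\<in>UNIV. v $ j * gradient F v $ j) = 0"
    using euler_relation[OF d, of v] F_v by (simp add: gradient_def)
  moreover have "(\<Sum>j\<in>UNIV. v $ j * gradient (H * F + G) v $ j) =
      mpeval H v * (\<Sum>j\<in>UNIV. v $ j * gradient F v $ j) + (\<Sum>j\<in>UNIV. v $ j * gradient G v $ j)"
    by (simp add: gradient_add gradient_mult F_v sum_distrib_left sum.distrib algebra_simps)
  ultimately show ?case using step(3) by simp
qed

text \<open>
  The inverse rational map recovers \<open>x\<close> and \<open>y\<close> as quotients of forms in \<open>\<eta>\<close>, so \<open>\<eta>\<close> generates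
  the function field; the Jacobian condition supplies the uniformizers.
\<close>

lemma \<eta>_is_model: "cover.field.is_model \<eta>"
  unfolding cover.field.is_model_def
proof (intro conjI allI impI)
  show "\<eta> $ j \<in> cover.fractions" for j
    by (rule cover.corresponds_in_fractions[OF corresponds_\<eta>])
next
  fix s :: "'a alg_closure fls" assume s: "s \<noteq> 0"
  define h where "h i = hom_eval fls_const (base_change (f $ i)) \<eta>" for i :: 3
  have corr: "cover.corresponds (\<lambda>a b. tuple_eval f (tuple_eval g (pt a b)) $ i) (h i)" for i
    using corresponds_at_\<eta>[of "base_change (f $ i)"] by (simp add: h_def tuple_eval_def)
  obtain a0 b0 where ab: "on_curve a0 b0" "ppoint (pt a0 b0) \<notin> ZW" using generic_curve_point by blast
  have h1: "h 1 \<noteq> 0"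
  proof
    assume "h 1 = 0"
    hence "tuple_eval f (tuple_eval g (pt a0 b0)) $ 1 = 0"
      using cover.corresponds_zero[OF corr[of 1]] ab(1) by (simp add: poly_quartic)
    thus False using generic_point(3)[OF ab] by auto
  qed
  have proportional: "h i = h 1 * \<omega> $ i" for i
  proof -
    have "cover.corresponds (\<lambda>a b. tuple_eval f (tuple_eval g (pt a b)) $ i +
        (- 1) * (tuple_eval f (tuple_eval g (pt a b)) $ 1 * pt a b $ i)) (h i + fls_const (- 1) * (h 1 * \<omega> $ i))"
      by (intro cover.corresponds_add cover.corresponds_mult cover.corresponds_const corr corresponds_\<omega>)
    hence "h i + fls_const (- 1) * (h 1 * \<omega> $ i) = 0"
    proof (rule generically_zero)
      fix a b assume "on_curve a b" "ppoint (pt a b) \<notin> ZW"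
      from generic_point(3)[OF this] obtain r where "tuple_eval f (tuple_eval g (pt a b)) = r *s pt a b" by blast
      thus "tuple_eval f (tuple_eval g (pt a b)) $ i +
        (- 1) * (tuple_eval f (tuple_eval g (pt a b)) $ 1 * pt a b $ i) = 0" by simp
    qed
    thus ?thesis by (simp add: const.hom_uminus)
  qed
  have scaled: "hom_eval fls_const (base_change (f $ i)) (s *s \<eta>) = s ^ df * h i" for i
    unfolding h_def by (rule const.hom_eval_scale[OF form_of_degree_base_change[OF f_form]])
  show "cover.field.generates (s *s \<eta>)"
  proof (rule cover.generatesI)
    show "hom_eval fls_const (base_change (f $ 1)) (s *s \<eta>) \<noteq> 0"
      "hom_eval fls_const (base_change (f $ 1)) (s *s \<eta>) \<noteq> 0"
      using s h1 by (simp_all add: scaled)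
    show "x = hom_eval fls_const (base_change (f $ 2)) (s *s \<eta>) / hom_eval fls_const (base_change (f $ 1)) (s *s \<eta>)"
      unfolding scaled proportional[of 2] using s h1 by (simp add: \<omega>_def)
    show "y = hom_eval fls_const (base_change (f $ 3)) (s *s \<eta>) / hom_eval fls_const (base_change (f $ 1)) (s *s \<eta>)"
      unfolding scaled proportional[of 3] using s h1 by (simp add: \<omega>_def)
  qed
next
  fix v assume v: "cover.field.specializes \<eta> v"
  hence "v \<noteq> 0" unfolding cover.field.specializes_def by blast
  then obtain i where i: "v $ i \<noteq> 0" by (auto simp: vec_eq_iff)
  have P: "ppoint v \<in> E" by (subst E_eq) (rule imageI, simp add: v)
  have dim: "has_dim E 1" and "nonsingular E"
    using curve by (simp_all add: nonsingular_proj_curve_def)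
  from this(2) have "\<exists>d. has_dim E d \<and>
    (\<forall>P\<in>E. \<forall>v\<in>P. vec.dim ((\<lambda>F. gradient F v) ` vanishing_ideal E) + d + 1 = CARD('n))"
    by (simp only: nonsingular_def)
  then obtain d where d: "has_dim E d"
    "\<forall>P\<in>E. \<forall>v\<in>P. vec.dim ((\<lambda>F. gradient F v) ` vanishing_ideal E) + d + 1 = CARD('n)"
    by (elim exE conjE) (rule that)
  have rank: "vec.dim ((\<lambda>F. gradient F v) ` vanishing_ideal E) + d + 1 = CARD('n)"
    by (rule d(2)[rule_format, OF P ppoint_self])
  have "d = 1" by (rule has_dim_unique[OF dim d(1)])
  have "cover.field.has_uniformizer (cover.field.normalized \<eta> v i) v"
  proof (rule cover.field.jacobian_uniformizer[OF v i, of "vanishing_ideal E"])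
    show "mpeval F v = 0 \<and> hom_eval fls_const F (cover.field.normalized \<eta> v i) = 0"
      if "F \<in> vanishing_ideal E" for F
      using vanishing_ideal_vanishes[OF that P ppoint_self] ideal_vanishes_\<eta>[OF that]
      by (simp add: cover.field.normalized_def)
    show "(\<Sum>j\<in>UNIV. v $ j * gradient F v $ j) = 0" if "F \<in> vanishing_ideal E" for F
      by (rule ideal_euler[OF that P ppoint_self])
    show "vec.dim ((\<lambda>F. gradient F v) ` vanishing_ideal E) + 2 = CARD('n)"
      using rank \<open>d = 1\<close> by simp
  qed
  thus "\<exists>i. v $ i \<noteq> 0 \<and> cover.field.has_uniformizer (cover.field.normalized \<eta> v i) v"
    using i by blast
qed

lemma \<sigma>_\<eta>: "fls_map \<tau> (\<eta> $ j) = \<eta> $ j"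
proof -
  have "comm_ring_hom (fls_map \<tau>)" by (rule frobenius.\<sigma>.comm_ring_hom_axioms)
  from hom_eval_compose[OF this, of "\<lambda>a. fls_const (to_ac a)" "g $ j" \<omega>]
  have "fls_map \<tau> (\<eta> $ j) = hom_eval (\<lambda>a. fls_const (to_ac a)) (g $ j) (\<chi> i. fls_map \<tau> (\<omega> $ i))"
    by (simp add: \<eta>_def F.fls_map_const \<tau>_base)
  also have "(\<chi> i. fls_map \<tau> (\<omega> $ i)) = \<omega>"
    unfolding vec_eq_iff forall_3 by (simp add: \<omega>_def \<sigma>_y F.fls_map_X_inv)
  finally show ?thesis by (simp add: \<eta>_def)
qed

text \<open>
  The points fixed by Frobenius are those with coordinates in the ground field, so the count on
  the space model carries over.
\<close>

lemma card_rational_points: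
  assumes fixed: "\<And>a. \<tau> a = a \<longleftrightarrow> a \<in> Set.range to_ac"
    and "finite {(a, b). \<tau> a = a \<and> \<tau> b = b \<and> on_curve a b}"
  shows "card (rational_points E) = card {(a, b). \<tau> a = a \<and> \<tau> b = b \<and> on_curve a b} + 2"
proof -
  have frob: "frobenius.frob v = v \<longleftrightarrow> (\<forall>i. v $ i \<in> Set.range to_ac)" for v :: "'a alg_closure ^ 'n"
    by (simp add: frobenius.frob_def vec_eq_iff fixed)
  have "rational_points E = ppoint ` {v. cover.field.specializes \<eta> v \<and> frobenius.frob v = v}"
  proof (intro equalityI subsetI)
    fix P assume "P \<in> rational_points E"
    then obtain u where u: "P \<in> E" "u \<in> P" "\<forall>i. u $ i \<in> Set.range to_ac" unfolding rational_points_def by blast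
    obtain v where v: "P = ppoint v" "cover.field.specializes \<eta> v" using u(1) by (subst (asm) E_eq) blast
    obtain s where s: "s \<noteq> 0" "u = s *s v" using u(2) unfolding v(1) ppoint_def by blast
    have "cover.field.specializes \<eta> u" unfolding s(2) by (rule cover.field.specializes_scale[OF v(2) s(1)])
    moreover have "P = ppoint u" unfolding v(1) s(2) by (simp add: ppoint_scale s(1))
    ultimately show "P \<in> ppoint ` {v. cover.field.specializes \<eta> v \<and> frobenius.frob v = v}"
      using u(3) frob by blast
  next
    fix P assume "P \<in> ppoint ` {v. cover.field.specializes \<eta> v \<and> frobenius.frob v = v}"
    then obtain v where "P = ppoint v" "cover.field.specializes \<eta> v" "frobenius.frob v = v" by blast
    moreover from this have "P \<in> E" by (subst E_eq) (rule image_eqI[of _ _ v], simp_all)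
    ultimately show "P \<in> rational_points E" unfolding rational_points_def using frob ppoint_self by blast
  qed
  thus ?thesis
    using frobenius.rational_points_equinumerous[OF \<eta>_is_model space_model_is_model \<sigma>_\<eta> \<sigma>_space_model]
      card_rational_points_space_model[OF assms(2)] by simp
qed

end

section \<open>Frobenius on the algebraic closure of a prime field\<close>

abbreviation frobenius_ac :: "'l::prime_card mod_ring alg_closure \<Rightarrow> 'l mod_ring alg_closure" where
  "frobenius_ac a \<equiv> a ^ CARD('l)"

lemma CHAR_mod_ring_ac: "CHAR('l::prime_card mod_ring alg_closure) = CARD('l)"
  by (simp add: CHAR_alg_closure semiring_char_mod_ring)

lemma prime_CARD: "prime CARD('l::prime_card)"
  by (rule prime_card)

lemma frobenius_ac_hom:
  "inj_idom_hom (frobenius_ac :: 'l::prime_card mod_ring alg_closure \<Rightarrow> 'l mod_ring alg_closure)"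
proof unfold_locales
  fix x y :: "'l mod_ring alg_closure"
  show "(x + y) ^ CARD('l) = x ^ CARD('l) + y ^ CARD('l)"
    by (rule freshmans_dream) (simp_all add: CHAR_mod_ring_ac prime_CARD)
qed (auto simp: power_mult_distrib)

lemma frobenius_ac_surj:
  "surj (frobenius_ac :: 'l::prime_card mod_ring alg_closure \<Rightarrow> 'l mod_ring alg_closure)"
proof
  show "UNIV \<subseteq> range (frobenius_ac :: 'l mod_ring alg_closure \<Rightarrow> 'l mod_ring alg_closure)"
  proof
    fix a :: "'l mod_ring alg_closure"
    obtain b where "b ^ CARD('l) = a" using nth_root_exists[of "CARD('l)" a] by auto
    thus "a \<in> range (frobenius_ac :: 'l mod_ring alg_closure \<Rightarrow> 'l mod_ring alg_closure)" by (metis rangeI)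
  qed
qed simp

lemma mod_ring_power_card: "(a :: 'l::prime_card mod_ring) ^ CARD('l) = a"
proof (cases "a = 0")
  case True
  thus ?thesis by simp
next
  case False
  define n where "n = nat (to_int_mod_ring a)"
  have "to_int_mod_ring a \<in> {0..<int CARD('l)}" unfolding range_to_int_mod_ring[symmetric] by (rule rangeI)
  hence a: "a = of_int (int n)" by (simp add: n_def of_int_of_int_mod_ring)
  have "\<not> CARD('l) dvd n"
  proof
    assume "CARD('l) dvd n"
    hence "[int n = 0] (mod int CARD('l))" by (simp add: cong_0_iff)
    hence "a = of_int 0" unfolding a of_int_mod_ring_congruence .
    thus False using False by simp
  qed
  hence "[n ^ (CARD('l) - 1) = 1] (mod CARD('l))" by (rule fermat_theorem[OF prime_CARD])
  hence "[int (n ^ (CARD('l) - 1)) = int 1] (mod int CARD('l))" by (simp only: cong_int_iff)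
  hence "(of_int (int (n ^ (CARD('l) - 1))) :: 'l mod_ring) = of_int (int 1)"
    by (simp only: of_int_mod_ring_congruence)
  hence "a ^ (CARD('l) - 1) = 1" by (simp add: a)
  moreover have "a ^ CARD('l) = a * a ^ (CARD('l) - 1)"
    using prime_gt_0_nat[OF prime_CARD[where 'l='l]] by (simp flip: power_Suc)
  ultimately show ?thesis by simp
qed

text \<open>
  The polynomial \<open>X\<^sup>\<ell> - X\<close> has at most \<open>\<ell>\<close> roots, and the elements of the prime field are \<open>\<ell>\<close> roots.
\<close>

lemma frobenius_ac_fixed:
  fixes a :: "'l::prime_card mod_ring alg_closure"
  shows "a ^ CARD('l) = a \<longleftrightarrow> a \<in> Set.range to_ac"
proof -
  define p :: "'l mod_ring alg_closure poly" where "p = Polynomial.monom 1 (CARD('l)) - Polynomial.monom 1 1"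
  have root: "poly p x = 0 \<longleftrightarrow> x ^ CARD('l) = x" for x
    by (simp add: p_def poly_monom)
  have "CARD('l) > 1" using prime_CARD[where 'l='l] prime_gt_1_nat by blast
  moreover have "p = Polynomial.monom 1 (CARD('l)) + (- Polynomial.monom 1 1)" by (simp add: p_def)
  ultimately have degree: "degree p = CARD('l)"
    by (simp only:) (subst degree_add_eq_left, simp_all add: degree_monom_eq)
  with \<open>CARD('l) > 1\<close> have "p \<noteq> 0" by auto
  have sub: "Set.range to_ac \<subseteq> {x. poly p x = 0}"
    by (auto simp: root simp flip: to_ac_power simp: mod_ring_power_card)
  moreover have "card {x. poly p x = 0} \<le> card (Set.range (to_ac :: 'l mod_ring \<Rightarrow> _))"
    using poly_roots_degree[OF \<open>p \<noteq> 0\<close>] degree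
    by (simp add: card_image inj_on_def)
  ultimately have "Set.range to_ac = {x. poly p x = 0}"
    by (intro card_seteq poly_roots_finite[OF \<open>p \<noteq> 0\<close>])
  thus ?thesis using root by blast
qed

lemma card_rational_points_model:
  fixes c :: "'l::prime_card mod_ring"
    and E :: "('n::finite, 'l mod_ring alg_closure) ppoint set"
  assumes "CARD('l) > 2" and "c \<noteq> 0" "c \<noteq> 1" and "smooth_projective_model E (quartic_curve c)"
  shows "card (rational_points E) = card {(a, b). b\<^sup>2 = (a\<^sup>2 - 1) * (a\<^sup>2 - c)} + 2"
proof -
  have curve: "nonsingular_proj_curve E" and "birational E (affine_in_plane (quartic_curve c))"
    using assms(4) unfolding smooth_projective_model_def by blast+
  from this(2) obtain f g where "rational_tuple f" "rational_tuple g"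
    and gen: "generically E (\<lambda>P. \<exists>Q\<in>affine_in_plane (quartic_curve c). tuple_maps f P Q \<and> tuple_maps g Q P)"
      "generically (affine_in_plane (quartic_curve c)) (\<lambda>Q. \<exists>P\<in>E. tuple_maps g Q P \<and> tuple_maps f P Q)"
    unfolding birational_def by blast
  then obtain df dg where forms: "\<And>j. form_of_degree df (f $ j)" "\<And>i. form_of_degree dg (g $ i)"
    unfolding rational_tuple_def by blast
  obtain ZE where ZE: "zariski_closed ZE" "\<not> E \<subseteq> ZE"
    "\<And>P. P \<in> E - ZE \<Longrightarrow> \<exists>Q\<in>affine_in_plane (quartic_curve c). tuple_maps f P Q \<and> tuple_maps g Q P"
    using gen(1) unfolding generically_def by blast
  obtain ZW where ZW: "zariski_closed ZW" "\<not> affine_in_plane (quartic_curve c) \<subseteq> ZW"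
    "\<And>Q. Q \<in> affine_in_plane (quartic_curve c) - ZW \<Longrightarrow> \<exists>P\<in>E. tuple_maps g Q P \<and> tuple_maps f P Q"
    using gen(2) unfolding generically_def by blast
  have fixed: "frobenius_ac (to_ac a) = to_ac a" for a :: "'l mod_ring"
    by (simp add: frobenius_ac_fixed)
  have "to_ac (2 :: 'l mod_ring) \<noteq> 0"
    unfolding to_ac_eq_0_iff by (rule two_neq_zero_mod_ring[OF assms(1)])
  hence two: "(2 :: 'l mod_ring alg_closure) \<noteq> 0" unfolding to_ac_numeral .
  have ground: "to_ac c \<noteq> 0" "to_ac c \<noteq> 1" using assms(2,3) by simp_all
  have quartic: "quartic (to_ac c) frobenius_ac"
    by (rule quartic.intro) (fact ground two frobenius_ac_hom frobenius_ac_surj fixed)+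
  interpret quartic_model c frobenius_ac E f g df dg ZE ZW
    by (rule quartic_model.intro[OF quartic], rule quartic_model_axioms.intro) (fact fixed curve forms ZE ZW)+
  let ?A = "{(a, b). b\<^sup>2 = (a\<^sup>2 - 1) * (a\<^sup>2 - c)}"
  have on_curve: "on_curve (to_ac a) (to_ac b) \<longleftrightarrow> b\<^sup>2 = (a\<^sup>2 - 1) * (a\<^sup>2 - c)" for a b
  proof -
    have "on_curve (to_ac a) (to_ac b) \<longleftrightarrow> to_ac (b\<^sup>2) = to_ac ((a\<^sup>2 - 1) * (a\<^sup>2 - c))" by simp
    thus ?thesis by (simp only: to_ac_eq_iff)
  qed
  have points: "{(a, b). frobenius_ac a = a \<and> frobenius_ac b = b \<and> on_curve a b} = map_prod to_ac to_ac ` ?A"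
  proof (intro equalityI subsetI)
    fix p assume "p \<in> {(a, b). frobenius_ac a = a \<and> frobenius_ac b = b \<and> on_curve a b}"
    then obtain a b where p: "p = (to_ac a, to_ac b)" "on_curve (to_ac a) (to_ac b)"
      unfolding frobenius_ac_fixed by blast
    hence "(a, b) \<in> ?A" using on_curve by simp
    thus "p \<in> map_prod to_ac to_ac ` ?A" unfolding p(1) by (intro image_eqI[of _ _ "(a, b)"]) simp_all
  next
    fix p :: "'l mod_ring alg_closure \<times> 'l mod_ring alg_closure"
    assume "p \<in> map_prod to_ac to_ac ` ?A"
    then obtain a b where "p = (to_ac a, to_ac b)" "b\<^sup>2 = (a\<^sup>2 - 1) * (a\<^sup>2 - c)" by auto
    thus "p \<in> {(a, b). frobenius_ac a = a \<and> frobenius_ac b = b \<and> on_curve a b}"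
      using on_curve fixed by simp
  qed
  have "inj_on (map_prod to_ac to_ac) ?A" by (auto simp: inj_on_def)
  hence "card (map_prod to_ac to_ac ` ?A) = card ?A" by (rule card_image)
  moreover have "finite (map_prod to_ac to_ac ` ?A)" by simp
  ultimately show ?thesis
    using card_rational_points[OF frobenius_ac_fixed] unfolding points by simp
qed

theorem theorem6p2:
  fixes c :: "'l::prime_card mod_ring"
    and E :: "('n::finite, 'l mod_ring alg_closure) ppoint set"
  assumes "CARD('l) > 2"
    and "c \<noteq> 0" and "c \<noteq> 1"
    and "smooth_projective_model E (quartic_curve c)"
  shows "\<forall>A. A \<noteq> 0 \<longrightarrow>
           K A (c * A) = - 1 - chi A * frobenius_trace E \<and>
           ((\<exists>b. A = b\<^sup>2) \<longrightarrow> K A (c * A) = - 1 - frobenius_trace E) \<and>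
           ((\<nexists>b. A = b\<^sup>2) \<longrightarrow> K A (c * A) = - 1 + frobenius_trace E)"
proof (intro allI impI)
  fix A :: "'l mod_ring" assume A: "A \<noteq> 0"
  have trace: "frobenius_trace E = - 1 - K 1 c"
    using card_rational_points_model[OF assms] card_affine_points[OF assms(1), of c]
    by (simp add: frobenius_trace_def)
  have K: "K A (c * A) = - 1 - chi A * frobenius_trace E"
    using K_twist[OF assms(1,3) A] by (simp add: trace algebra_simps)
  show "K A (c * A) = - 1 - chi A * frobenius_trace E \<and>
        ((\<exists>b. A = b\<^sup>2) \<longrightarrow> K A (c * A) = - 1 - frobenius_trace E) \<and>
        ((\<nexists>b. A = b\<^sup>2) \<longrightarrow> K A (c * A) = - 1 + frobenius_trace E)"
    using K A by (auto simp: chi_altdef)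
qed

end
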